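(* Let $p\ge0$ be a fixed integer constant. \textsc{Decision Equal Clustering} (with the $\ell_p$-norm) admits a polynomial kernel when parameterized by $k$ and $B$, in which the output collection consists of $\mathcal{O}(kB)$ points of $\mathbb{Z}^{d'}$ with $d'=\mathcal{O}(kB^{p+1})$, and each coordinate of each point has absolute value $\mathcal{O}(kB^2)$.
   Context: For a nonnegative integer $p$ and $\mathbf{x}\in\mathbb{R}^d$, $\|\mathbf{x}\|_p=(\sum_{i=1}^d|x[i]|^p)^{1/p}$ for $p\ge1$, and $\|\mathbf{x}\|_0$ is the number of nonzero coordinates. Collections of points are multisets. For a finite $T\subseteq\mathbb{Z}^d$, ${\sf cost}_p(T)=\min_{\mathbf{c}\in\mathbb{R}^d}\sum_{\mathbf{x}\in T}\|\mathbf{c}-\mathbf{x}\|_p$. \textsc{Decision Equal Clustering}: given a collection $\mathbf{X}$ of $n$ points of $\mathbb{Z}^d$, a positive integer $k$ dividing $n$, and a nonnegative integer $B$, decide whether there is a partition $\{X_1,\dots,X_k\}$ of $\mathbf{X}$ with $|X_1|=\dots=|X_k|=n/k$ and $\sum_i{\sf cost}_p(X_i)\le B$. A polynomial kernel for the parameterization by $k+B$ is a polynomial-time algorithm mapping an instance to an equivalent instance $(\mathbf{X}',k',B')$ whose size is bounded by a polynomial in $k+B$. *)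

theory Defs
  imports
    Complex_Main
    "HOL-Library.Multiset"
    "HOL-Library.Log_Nat"
    "HOL-Computational_Algebra.Polynomial"
begin

section \<open>Polynomial-time computation\<close>

text \<open>
  Algorithms are programs of a first-order, call-by-value language with general recursion whose
  values are binary trees with integer leaves.  Time is measured with the logarithmic cost
  criterion: producing a value (also a temporary one) costs at least its size in bits, with
  integers written in binary.  Every primitive operation is computable by a Turing machine in
  time polynomial in the sizes of its arguments, all of which have been paid for, so running
  times agree with those of Turing machines up to a polynomial.
\<close>

datatype data = Leaf int | Node data data

fun dsize :: "data \<Rightarrow> nat" where
  "dsize (Leaf z) = 1 + floorlog 2 (nat \<bar>z\<bar>)"
| "dsize (Node a b) = 1 + dsize a + dsize b"

datatype op1 = Fst | Snd | IsNode
datatype op2 = MkNode | Add | Sub | Mul | Le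

fun leaf_val :: "data \<Rightarrow> int" where
  "leaf_val (Leaf z) = z"
| "leaf_val (Node a b) = 0"

fun apply1 :: "op1 \<Rightarrow> data \<Rightarrow> data" where
  "apply1 Fst a = (case a of Node x y \<Rightarrow> x | Leaf z \<Rightarrow> Leaf 0)"
| "apply1 Snd a = (case a of Node x y \<Rightarrow> y | Leaf z \<Rightarrow> Leaf 0)"
| "apply1 IsNode a = (case a of Node x y \<Rightarrow> Leaf 1 | Leaf z \<Rightarrow> Leaf 0)"

fun apply2 :: "op2 \<Rightarrow> data \<Rightarrow> data \<Rightarrow> data" where
  "apply2 MkNode a b = Node a b"
| "apply2 Add a b = Leaf (leaf_val a + leaf_val b)"
| "apply2 Sub a b = Leaf (leaf_val a - leaf_val b)"
| "apply2 Mul a b = Leaf (leaf_val a * leaf_val b)"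
| "apply2 Le a b = Leaf (if leaf_val a \<le> leaf_val b then 1 else 0)"

text \<open>
  Variables are de Bruijn indices into the environment.  A program is the list of its function
  bodies; every function has one parameter, and function \<open>0\<close> is the main function.
\<close>

datatype expr =
    Var nat
  | Lit int
  | Op1 op1 expr
  | Op2 op2 expr expr
  | Cond expr expr expr
  | LetIn expr expr
  | Call nat expr

type_synonym program = "expr list"

text \<open>\<open>eval P env e v t\<close>: in environment \<open>env\<close>, the expression \<open>e\<close> evaluates to \<open>v\<close> at cost \<open>t\<close>.\<close>

inductive eval :: "program \<Rightarrow> data list \<Rightarrow> expr \<Rightarrow> data \<Rightarrow> nat \<Rightarrow> bool" for P where
  Var: "i < length env \<Longrightarrow> eval P env (Var i) (env ! i) (1 + dsize (env ! i))"
| Lit: "eval P env (Lit z) (Leaf z) (1 + dsize (Leaf z))"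
| Op1: "eval P env e a t \<Longrightarrow>
    eval P env (Op1 f e) (apply1 f a) (t + 1 + dsize (apply1 f a))"
| Op2: "eval P env e1 a t1 \<Longrightarrow> eval P env e2 b t2 \<Longrightarrow>
    eval P env (Op2 f e1 e2) (apply2 f a b) (t1 + t2 + 1 + dsize (apply2 f a b))"
| CondT: "eval P env e0 c t0 \<Longrightarrow> c \<noteq> Leaf 0 \<Longrightarrow> eval P env e1 v t1 \<Longrightarrow>
    eval P env (Cond e0 e1 e2) v (t0 + t1 + 1)"
| CondF: "eval P env e0 c t0 \<Longrightarrow> c = Leaf 0 \<Longrightarrow> eval P env e2 v t2 \<Longrightarrow>
    eval P env (Cond e0 e1 e2) v (t0 + t2 + 1)"
| LetIn: "eval P env e1 a t1 \<Longrightarrow> eval P (a # env) e2 v t2 \<Longrightarrow>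
    eval P env (LetIn e1 e2) v (t1 + t2 + 1)"
| Call: "eval P env e a t1 \<Longrightarrow> g < length P \<Longrightarrow> eval P [a] (P ! g) v t2 \<Longrightarrow>
    eval P env (Call g e) v (t1 + t2 + 1)"

inductive_cases eval_elims:
  "eval P env (Var i) v t"
  "eval P env (Lit z) v t"
  "eval P env (Op1 f e) v t"
  "eval P env (Op2 f e1 e2) v t"
  "eval P env (Cond e0 e1 e2) v t"
  "eval P env (LetIn e1 e2) v t"
  "eval P env (Call g e) v t"

lemma eval_deterministic:
  "eval P env e v t \<Longrightarrow> eval P env e v' t' \<Longrightarrow> v' = v \<and> t' = t"
proof (induction arbitrary: v' t' rule: eval.induct)
  case (Var i env) then show ?case by (auto elim: eval_elims)
next
  case (Lit env z) then show ?case by (auto elim: eval_elims)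
next
  case (Op1 env e a t f)
  from Op1.prems obtain a' s where
    "eval P env e a' s" "v' = apply1 f a'" "t' = s + 1 + dsize (apply1 f a')"
    by (rule eval_elims(3)) simp
  with Op1.IH[of a' s] show ?case by simp
next
  case (Op2 env e1 a t1 e2 b t2 f)
  from Op2.prems obtain a' s1 b' s2 where
    "eval P env e1 a' s1" "eval P env e2 b' s2"
    "v' = apply2 f a' b'" "t' = s1 + s2 + 1 + dsize (apply2 f a' b')"
    by (rule eval_elims(4)) simp
  with Op2.IH(1)[of a' s1] Op2.IH(2)[of b' s2] show ?case by simp
next
  case (CondT env e0 c t0 e1 v t1 e2)
  from CondT.prems show ?case
  proof (rule eval_elims(5))
    fix c' s0 s1
    assume "t' = Suc (s0 + s1)" "eval P env e0 c' s0" "eval P env e1 v' s1"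
    with CondT.IH(1)[of c' s0] CondT.IH(2)[of v' s1] show ?case by simp
  next
    fix s0
    assume "eval P env e0 (Leaf 0) s0"
    with CondT.IH(1)[of "Leaf 0" s0] CondT.hyps show ?case by simp
  qed
next
  case (CondF env e0 c t0 e2 v t2 e1)
  from CondF.prems show ?case
  proof (rule eval_elims(5))
    fix c' s0 s1
    assume "eval P env e0 c' s0" "c' \<noteq> Leaf 0"
    with CondF.IH(1)[of c' s0] CondF.hyps show ?case by simp
  next
    fix s0 s2
    assume "t' = Suc (s0 + s2)" "eval P env e0 (Leaf 0) s0" "eval P env e2 v' s2"
    with CondF.IH(1)[of "Leaf 0" s0] CondF.IH(2)[of v' s2] show ?case by simp
  qed
next
  case (LetIn env e1 a t1 e2 v t2)
  from LetIn.prems obtain a' s1 s2 where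
    "eval P env e1 a' s1" "eval P (a' # env) e2 v' s2" "t' = s1 + s2 + 1"
    by (rule eval_elims(6)) simp
  with LetIn.IH(1)[of a' s1] LetIn.IH(2)[of v' s2] show ?case by simp
next
  case (Call env e a t1 g v t2)
  from Call.prems obtain a' s1 s2 where
    "eval P env e a' s1" "eval P [a'] (P ! g) v' s2" "t' = s1 + s2 + 1"
    by (rule eval_elims(7)) simp
  with Call.IH(1)[of a' s1] Call.IH(2)[of v' s2] show ?case by simp
qed

definition poly_time_computable :: "('i \<Rightarrow> data) \<Rightarrow> 'i set \<Rightarrow> ('i \<Rightarrow> 'i) \<Rightarrow> bool" where
  "poly_time_computable enc I f \<longleftrightarrow>
    (\<exists>(P :: program) (q :: nat poly). \<forall>x\<in>I.
      \<exists>t \<le> poly q (dsize (enc x)). eval P [enc x] (Call 0 (Var 0)) (enc (f x)) t)"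


section \<open>Polynomial kernels\<close>

text \<open>
  \<open>I\<close> is the set of instances, \<open>enc\<close> their encoding, \<open>yes\<close> the decision problem and \<open>param\<close> the
  parameter.  As usual, the size of the output of a kernelization comprises its parameter.
\<close>

definition polynomial_kernel ::
    "('i \<Rightarrow> data) \<Rightarrow> 'i set \<Rightarrow> ('i \<Rightarrow> bool) \<Rightarrow> ('i \<Rightarrow> nat) \<Rightarrow> ('i \<Rightarrow> 'i) \<Rightarrow> bool" where
  "polynomial_kernel enc I yes param f \<longleftrightarrow>
    poly_time_computable enc I f \<and>
    (\<forall>x\<in>I. f x \<in> I \<and> (yes (f x) \<longleftrightarrow> yes x)) \<and>
    (\<exists>s :: nat poly. \<forall>x\<in>I. dsize (enc (f x)) + param (f x) \<le> poly s (param x))"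


section \<open>Equal clustering\<close>

text \<open>Vectors of dimension \<open>d\<close> are lists of length \<open>d\<close>.\<close>

type_synonym point = "int list"

definition lp_norm :: "nat \<Rightarrow> real list \<Rightarrow> real" where
  "lp_norm p x =
    (if p = 0 then real (card {i. i < length x \<and> x ! i \<noteq> 0})
     else root p (\<Sum>i<length x. \<bar>x ! i\<bar> ^ p))"

text \<open>The infimum is attained: for \<open>p = 0\<close> only natural numbers are involved, for \<open>p > 0\<close> by compactness.\<close>

definition cost :: "nat \<Rightarrow> nat \<Rightarrow> point multiset \<Rightarrow> real" where
  "cost p d T =
    (INF c \<in> {c :: real list. length c = d}.
      \<Sum>x\<in>#T. lp_norm p (map2 (-) c (map real_of_int x)))"

text \<open>
  An instance consists of the dimension, the points listed with multiplicity in any order, the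
  number \<open>k\<close> of clusters and the budget \<open>B\<close>.
\<close>

datatype eqc_instance =
  Eqc_Instance (dim: nat) (points: "point list") (clusters: nat) (budget: nat)

definition eqc_instances :: "eqc_instance set" where
  "eqc_instances = {x. (\<forall>a\<in>set (points x). length a = dim x) \<and>
     clusters x \<ge> 1 \<and> clusters x dvd length (points x)}"

text \<open>A partition of a multiset is an indexed family of multisets whose sum it is.\<close>

definition equal_clustering :: "nat \<Rightarrow> nat \<Rightarrow> point multiset \<Rightarrow> nat \<Rightarrow> nat \<Rightarrow> bool" where
  "equal_clustering p d X k B \<longleftrightarrow>
    (\<exists>C :: nat \<Rightarrow> point multiset.
      (\<Sum>i<k. C i) = X \<and>
      (\<forall>i<k. size (C i) = size X div k) \<and>
      (\<Sum>i<k. cost p d (C i)) \<le> real B)"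

definition eqc_yes :: "nat \<Rightarrow> eqc_instance \<Rightarrow> bool" where
  "eqc_yes p x = equal_clustering p (dim x) (mset (points x)) (clusters x) (budget x)"

definition eqc_param :: "eqc_instance \<Rightarrow> nat" where
  "eqc_param x = clusters x + budget x"

fun enc_list :: "('a \<Rightarrow> data) \<Rightarrow> 'a list \<Rightarrow> data" where
  "enc_list e [] = Leaf 0"
| "enc_list e (x # xs) = Node (e x) (enc_list e xs)"

definition enc_eqc :: "eqc_instance \<Rightarrow> data" where
  "enc_eqc x =
    Node (Leaf (int (dim x)))
      (Node (enc_list (enc_list Leaf) (points x))
        (Node (Leaf (int (clusters x))) (Leaf (int (budget x)))))"

lemma enc_list_inject: "inj e \<Longrightarrow> enc_list e xs = enc_list e ys \<longleftrightarrow> xs = ys"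
proof (induction xs arbitrary: ys)
  case Nil then show ?case by (cases ys) auto
next
  case (Cons x xs) then show ?case by (cases ys) (auto dest: injD)
qed

lemma enc_eqc_inject: "enc_eqc x = enc_eqc y \<longleftrightarrow> x = y"
proof -
  have "inj Leaf" "inj (enc_list Leaf)"
    by (auto simp: inj_def enc_list_inject)
  then show ?thesis
    by (auto simp: enc_eqc_def enc_list_inject intro: eqc_instance.expand)
qed

end

theory Submission
  imports Defs
begin

text \<open>
  If the clusters have more than \<open>4 B + 1\<close> points, each cluster of a solution consists of copies of
  one point up to at most \<open>B\<close> exceptions.  How many clusters a point dominates can be computed from
  its multiplicity, so the same number of copies can be removed from all clusters, leaving
  \<open>O(k B)\<close> points.

  Points of the same cluster differ in at most \<open>B^max(1, p)\<close> coordinates.  Call a coordinate marked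
  if two points differing in so few coordinates differ there.  A spanning forest on the clusters
  shows that a solution forces all but \<open>O(k B^(p+1))\<close> coordinates to be unmarked.  The unmarked ones
  are constant on clusters and can be replaced by few coordinates holding a label; on the others,
  long gaps between consecutive values are shortened to \<open>B + 1\<close>.

  Polynomial running time is established by closure properties: the functions computable by
  programs in polynomial time are closed under composition, the primitives, and recursion along
  lists with intermediate results of polynomial size.
\<close>

section \<open>Polynomial-time functions on encodable types\<close>

text \<open>No clustering is ever searched for. Each step tests a consequence of solvability that
  can be read off multiplicities or Hamming distances, and a failed test leads to a fixed unsolvable
  instance. The constant 4: averaging over a cluster of cost at most \<open>B\<close> gives a point
  whose distances to all points of the cluster sum to at most \<open>2 * B\<close>. Distinct integer
  points have distance at least 1, so with more than \<open>4 * B\<close> points this one makes up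
  at least half of the cluster. The obstacle in reducing the dimension is that centers are arbitrary
  real vectors and that for \<open>p = 0\<close> only equality of coordinates counts. Costs are
  therefore compared by turning any center of one cluster into a center of the other, coordinate by
  coordinate. Points of an affordable cluster are within distance \<open>B\<close> of each other,
  before and after the reduction, so it suffices that differences up to \<open>B\<close> are
  respected in both directions.\<close>

class encodable =
  fixes encode :: "'a \<Rightarrow> data"
  assumes encode_eq_iff: "encode x = encode y \<longleftrightarrow> x = y"

instantiation int :: encodable
begin
definition "encode_int = Leaf"
instance by standard (simp add: encode_int_def)
end

instantiation nat :: encodable
begin
definition "encode_nat n = Leaf (int n)"
instance by standard (simp add: encode_nat_def)
end

instantiation bool :: encodable
begin
definition "encode_bool b = Leaf (if b then 1 else 0)"
instance by standard (simp add: encode_bool_def)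
end

instantiation prod :: (encodable, encodable) encodable
begin
definition "encode_prod z = Node (encode (fst z)) (encode (snd z))"
instance by standard (auto simp: encode_prod_def encode_eq_iff prod_eq_iff)
end

instantiation list :: (encodable) encodable
begin
definition "encode_list = enc_list encode"
instance
proof
  have "inj (encode :: 'a \<Rightarrow> data)"
    by (simp add: inj_def encode_eq_iff)
  then show "encode x = encode y \<longleftrightarrow> x = y" for x y :: "'a list"
    by (simp add: encode_list_def enc_list_inject)
qed
end

lemma encode_Pair: "encode (a, b) = Node (encode a) (encode b)"
  by (simp add: encode_prod_def)

lemma encode_Nil: "encode [] = Leaf 0"
  by (simp add: encode_list_def)

lemma encode_Cons: "encode (x # xs) = Node (encode x) (encode xs)"
  by (simp add: encode_list_def)

abbreviation bits :: "'a::encodable \<Rightarrow> nat" where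
  "bits x \<equiv> dsize (encode x)"

lemma bits_Pair [simp]: "bits (a, b) = Suc (bits a + bits b)"
  by (simp add: encode_Pair)

lemma bits_Nil [simp]: "bits [] = 1"
  by (simp add: encode_Nil floorlog_def)

lemma bits_Cons [simp]: "bits (x # xs) = Suc (bits x + bits xs)"
  by (simp add: encode_Cons)

section \<open>Sizes of the results of primitive operations\<close>

lemma dsize_pos: "0 < dsize a"
  by (cases a) auto

lemma dsize_Leaf_le_iff: "dsize (Leaf z) \<le> Suc m \<longleftrightarrow> \<bar>z\<bar> < 2 ^ m"
proof -
  have "dsize (Leaf z) \<le> Suc m \<longleftrightarrow> nat \<bar>z\<bar> < 2 ^ m"
    by (auto simp: floorlog_le_iff)
  also have "\<dots> \<longleftrightarrow> \<bar>z\<bar> < 2 ^ m"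
    by (simp add: nat_less_iff)
  finally show ?thesis .
qed

lemma dsize_Leaf_obtain:
  obtains m where "dsize (Leaf z) = Suc m" "\<bar>z\<bar> < 2 ^ m"
  using dsize_Leaf_le_iff[of z "floorlog 2 (nat \<bar>z\<bar>)"] by simp

lemma dsize_leaf_val: "dsize (Leaf (leaf_val a)) \<le> dsize a"
  by (cases a) (auto simp: floorlog_def)

text \<open>The carry bit of a sum is paid for by the extra unit that \<open>dsize\<close> adds to
  every leaf.\<close>

lemma dsize_Leaf_plus: "dsize (Leaf (x + y)) \<le> dsize (Leaf x) + dsize (Leaf y)"
proof -
  obtain m where m: "dsize (Leaf x) = Suc m" "\<bar>x\<bar> < 2 ^ m" by (rule dsize_Leaf_obtain)
  obtain n where n: "dsize (Leaf y) = Suc n" "\<bar>y\<bar> < 2 ^ n" by (rule dsize_Leaf_obtain)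
  have "(2::int) ^ m \<le> 2 ^ (m + n)" "(2::int) ^ n \<le> 2 ^ (m + n)"
    by (simp_all add: power_increasing)
  moreover have "\<bar>x + y\<bar> \<le> \<bar>x\<bar> + \<bar>y\<bar>" by (rule abs_triangle_ineq)
  ultimately have "\<bar>x + y\<bar> < 2 * 2 ^ (m + n)" using m(2) n(2) by linarith
  then have "\<bar>x + y\<bar> < 2 ^ Suc (m + n)" by simp
  then have "dsize (Leaf (x + y)) \<le> Suc (Suc (m + n))"
    by (simp only: dsize_Leaf_le_iff)
  then show ?thesis using m n by simp
qed

lemma dsize_Leaf_minus: "dsize (Leaf (x - y)) \<le> dsize (Leaf x) + dsize (Leaf y)"
  using dsize_Leaf_plus[of x "- y"] by simp

lemma dsize_Leaf_mult: "dsize (Leaf (x * y)) \<le> dsize (Leaf x) + dsize (Leaf y)"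
proof -
  obtain m where m: "dsize (Leaf x) = Suc m" "\<bar>x\<bar> < 2 ^ m" by (rule dsize_Leaf_obtain)
  obtain n where n: "dsize (Leaf y) = Suc n" "\<bar>y\<bar> < 2 ^ n" by (rule dsize_Leaf_obtain)
  have "\<bar>x * y\<bar> < 2 ^ (m + n)"
    unfolding abs_mult power_add using m n by (intro mult_strict_mono) auto
  then have "dsize (Leaf (x * y)) \<le> Suc (m + n)"
    by (simp only: dsize_Leaf_le_iff)
  then show ?thesis using m n by simp
qed

lemma dsize_01: "dsize (Leaf 0) = 1" "dsize (Leaf 1) = 2"
  by (simp_all add: floorlog_def)

lemma dsize_apply1: "dsize (apply1 f a) \<le> 1 + dsize a"
  by (cases f; cases a) (auto simp: dsize_01 floorlog_def)

lemma dsize_apply2: "dsize (apply2 f a b) \<le> 1 + dsize a + dsize b"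
  using dsize_Leaf_plus[of "leaf_val a" "leaf_val b"] dsize_Leaf_minus[of "leaf_val a" "leaf_val b"]
    dsize_Leaf_mult[of "leaf_val a" "leaf_val b"] dsize_leaf_val[of a] dsize_leaf_val[of b]
    dsize_pos[of a] dsize_pos[of b]
  by (cases f) (auto simp: dsize_01 simp del: dsize.simps(1))

text \<open>Coefficients are natural numbers, so no term can decrease. This makes time bounds
  composable.\<close>

lemma poly_nat_mono: "m \<le> n \<Longrightarrow> poly q m \<le> poly q n" for q :: "nat poly"
  by (induction q) (auto intro: mult_le_mono add_le_mono)

section \<open>Upper bounds on evaluation cost\<close>

definition costs :: "program \<Rightarrow> data list \<Rightarrow> expr \<Rightarrow> data \<Rightarrow> nat \<Rightarrow> bool" where
  "costs P env e v N \<longleftrightarrow> (\<exists>t\<le>N. eval P env e v t)"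

lemma costs_mono: "costs P env e v N \<Longrightarrow> N \<le> N' \<Longrightarrow> costs P env e v N'"
  unfolding costs_def by (meson le_trans)

text \<open>Every rule that produces a new value pays for its size. A time bound thus also bounds
  the result, which composition needs in order to bound the next argument.\<close>

lemma eval_dsize_le: "eval P env e v t \<Longrightarrow> dsize v \<le> t"
  by (induction rule: eval.induct) auto

lemma costs_dsize_le: "costs P env e v N \<Longrightarrow> dsize v \<le> N"
  unfolding costs_def using eval_dsize_le le_trans by blast

lemma costs_Var: "i < length env \<Longrightarrow> env ! i = v \<Longrightarrow> costs P env (Var i) v (1 + dsize v)"
  unfolding costs_def using eval.Var by blast

lemma costs_Lit: "costs P env (Lit z) (Leaf z) (1 + dsize (Leaf z))"
  unfolding costs_def using eval.Lit by blast

lemma costs_Op1: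
  assumes "costs P env e a N" "apply1 f a = v"
  shows "costs P env (Op1 f e) v (N + 1 + dsize v)"
proof -
  from assms(1) obtain t where "t \<le> N" "eval P env e a t" unfolding costs_def by blast
  then show ?thesis unfolding costs_def assms(2)[symmetric]
    by (intro exI[of _ "t + 1 + dsize (apply1 f a)"] conjI eval.Op1) auto
qed

lemma costs_Op2:
  assumes "costs P env e1 a N1" "costs P env e2 b N2" "apply2 f a b = v"
  shows "costs P env (Op2 f e1 e2) v (N1 + N2 + 1 + dsize v)"
proof -
  from assms obtain t1 t2 where "t1 \<le> N1" "eval P env e1 a t1" "t2 \<le> N2" "eval P env e2 b t2"
    unfolding costs_def by blast
  then show ?thesis unfolding costs_def assms(3)[symmetric]
    by (intro exI[of _ "t1 + t2 + 1 + dsize (apply2 f a b)"] conjI eval.Op2) auto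
qed

lemma costs_Cond:
  assumes "costs P env e0 c N0" "c \<noteq> Leaf 0 \<Longrightarrow> costs P env e1 v N"
    "c = Leaf 0 \<Longrightarrow> costs P env e2 v N"
  shows "costs P env (Cond e0 e1 e2) v (N0 + N + 1)"
proof (cases "c = Leaf 0")
  case True
  with assms obtain t0 t where "t0 \<le> N0" "eval P env e0 c t0" "t \<le> N" "eval P env e2 v t"
    unfolding costs_def by blast
  with True show ?thesis unfolding costs_def
    by (intro exI[of _ "t0 + t + 1"] conjI eval.CondF) auto
next
  case False
  with assms obtain t0 t where "t0 \<le> N0" "eval P env e0 c t0" "t \<le> N" "eval P env e1 v t"
    unfolding costs_def by blast
  with False show ?thesis unfolding costs_def
    by (intro exI[of _ "t0 + t + 1"] conjI eval.CondT) auto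
qed

lemma costs_Call:
  assumes "costs P env e a N" "g < length P" "costs P [a] (P ! g) v M"
  shows "costs P env (Call g e) v (N + M + 1)"
proof -
  from assms obtain t1 t2 where "t1 \<le> N" "eval P env e a t1" "t2 \<le> M" "eval P [a] (P ! g) v t2"
    unfolding costs_def by blast
  with assms show ?thesis unfolding costs_def
    by (intro exI[of _ "t1 + t2 + 1"] conjI eval.Call) auto
qed

section \<open>Linking programs\<close>

primrec relocate :: "nat \<Rightarrow> expr \<Rightarrow> expr" where
  "relocate n (Var i) = Var i"
| "relocate n (Lit z) = Lit z"
| "relocate n (Op1 f e) = Op1 f (relocate n e)"
| "relocate n (Op2 f e1 e2) = Op2 f (relocate n e1) (relocate n e2)"
| "relocate n (Cond e0 e1 e2) = Cond (relocate n e0) (relocate n e1) (relocate n e2)"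
| "relocate n (LetIn e1 e2) = LetIn (relocate n e1) (relocate n e2)"
| "relocate n (Call g e) = Call (n + g) (relocate n e)"

text \<open>Variables refer to the local environment and only function indices depend on the
  position in the program, so shifting these by the length of the prefix is enough.\<close>

lemma eval_relocate:
  "eval P env e v t \<Longrightarrow>
    eval (Q @ map (relocate (length Q)) P @ R) env (relocate (length Q) e) v t"
proof (induction rule: eval.induct)
  case (Call env e a t1 g v t2)
  have "(Q @ map (relocate (length Q)) P @ R) ! (length Q + g) = relocate (length Q) (P ! g)"
    using Call.hyps by (simp add: nth_append)
  then show ?case
    using Call eval.Call[where g = "length Q + g" and P = "Q @ map (relocate (length Q)) P @ R"]
    by simp
qed (unfold relocate.simps, (rule eval.intros; assumption)+)

lemma costs_relocate:
  "costs P env e v N \<Longrightarrow>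
    costs (Q @ map (relocate (length Q)) P @ R) env (relocate (length Q) e) v N"
  unfolding costs_def using eval_relocate by blast

text \<open>Quantifying over all extensions \<open>S\<close> lets programs be combined by appending.\<close>

definition computes ::
    "program \<Rightarrow> nat \<Rightarrow> ('a::encodable \<Rightarrow> 'b::encodable) \<Rightarrow> nat poly \<Rightarrow> bool" where
  "computes P g f q \<longleftrightarrow> g < length P \<and>
    (\<forall>x S. costs (P @ S) [encode x] (P ! g) (encode (f x)) (poly q (bits x)))"

definition ptime :: "('a::encodable \<Rightarrow> 'b::encodable) \<Rightarrow> bool" where
  "ptime f \<longleftrightarrow> (\<exists>P g q. computes P g f q)"

lemma computes_append: "computes P g f q \<Longrightarrow> computes (P @ R) g f q"
  by (auto simp: computes_def nth_append)

lemma computes_relocate: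
  assumes "computes P g f q"
  shows "computes (Q @ map (relocate (length Q)) P) (length Q + g) f q"
  unfolding computes_def
proof (intro conjI allI)
  show "length Q + g < length (Q @ map (relocate (length Q)) P)"
    using assms by (simp add: computes_def)
  fix x S
  have "costs P [encode x] (P ! g) (encode (f x)) (poly q (bits x))"
    using assms unfolding computes_def by (metis append_Nil2)
  from costs_relocate[OF this, of Q S]
  show "costs ((Q @ map (relocate (length Q)) P) @ S) [encode x]
      ((Q @ map (relocate (length Q)) P) ! (length Q + g)) (encode (f x)) (poly q (bits x))"
    using assms by (simp add: nth_append computes_def)
qed

lemma ptime_extend:
  assumes "ptime f"
  obtains R g q where "computes (Q @ R) g f q"
  using assms computes_relocate unfolding ptime_def by meson

lemma ptime2:
  assumes "ptime f1" "ptime f2"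
  obtains P g1 g2 q1 q2 where "computes P g1 f1 q1" "computes P g2 f2 q2"
proof -
  from assms(1) obtain P g1 q1 where 1: "computes P g1 f1 q1" unfolding ptime_def by blast
  from assms(2) obtain R g2 q2 where "computes (P @ R) g2 f2 q2" by (rule ptime_extend)
  with 1 show thesis using that computes_append by blast
qed

lemma ptime3:
  assumes "ptime f1" "ptime f2" "ptime f3"
  obtains P g1 g2 g3 q1 q2 q3
  where "computes P g1 f1 q1" "computes P g2 f2 q2" "computes P g3 f3 q3"
proof -
  from assms(1,2) obtain P g1 g2 q1 q2
    where "computes P g1 f1 q1" "computes P g2 f2 q2" by (rule ptime2)
  moreover from assms(3) obtain R g3 q3 where "computes (P @ R) g3 f3 q3" by (rule ptime_extend)
  ultimately show thesis by (rule that[OF computes_append computes_append])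
qed

lemma costs_computes:
  assumes "computes P g f q" "costs (P @ S) env e (encode x) N"
  shows "costs (P @ S) env (Call g e) (encode (f x)) (N + poly q (bits x) + 1)"
  using assms unfolding computes_def by (intro costs_Call) (auto simp: nth_append)

lemma computes_bits_le: "computes P g f q \<Longrightarrow> bits (f x) \<le> poly q (bits x)"
  unfolding computes_def using costs_dsize_le by blast

lemma ptime_bits_le:
  assumes "ptime f"
  obtains q where "\<And>x. bits (f x) \<le> poly q (bits x)"
  using assms computes_bits_le unfolding ptime_def by blast

section \<open>Closure under primitives, conditionals and composition\<close>

lemma ptimeI:
  assumes "\<And>x S. costs ((P @ [body]) @ S) [encode x] body (encode (f x)) (poly q (bits x))"
  shows "ptime f"
  unfolding ptime_def computes_def
  \<comment> \<open>\<open>body\<close> becomes function number \<open>length P\<close>: it can call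
    everything in \<open>P\<close>, and itself through that index.\<close>
  using assms by (intro exI[of _ "P @ [body]"] exI[of _ "length P"] exI[of _ q]) simp

lemma costs_arg: "costs P [a] (Var 0) a (1 + dsize a)"
  by (rule costs_Var) auto

lemma costs_body:
  assumes "computes P g f q"
  shows "costs ((P @ R) @ S) [encode x] (Call g (Var 0)) (encode (f x)) (2 + bits x + poly q (bits x))"
  using costs_computes[OF assms costs_arg, of "R @ S" x] by simp

lemma ptime_id [simp]: "ptime (\<lambda>x. x)"
proof (rule ptimeI[of "[]" "Var 0" _ "[:1, 1:]"])
  show "costs (([] @ [Var 0]) @ S) [encode x] (Var 0) (encode x) (poly [:1, 1:] (bits x))"
    for x :: 'a and S
    using costs_arg by simp
qed

lemma ptime_Lit:
  assumes "encode c = Leaf z"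
  shows "ptime (\<lambda>x. c)"
proof (rule ptimeI[of "[]" "Lit z" _ "[:1 + dsize (Leaf z):]"])
  show "costs (([] @ [Lit z]) @ S) [encode x] (Lit z) (encode c) (poly [:1 + dsize (Leaf z):] (bits x))"
    for x :: 'b and S
    unfolding assms using costs_Lit by (simp del: dsize.simps)
qed

lemma ptime_Op1:
  assumes "ptime f" "\<And>x. encode (h x) = apply1 p (encode (f x))"
  shows "ptime h"
proof -
  from assms(1) obtain P g q where P: "computes P g f q" unfolding ptime_def by blast
  show ?thesis
  proof (rule ptimeI[of P "Op1 p (Call g (Var 0))" _ "q + q + [:4, 1:]"])
    fix x S
    have "bits (f x) \<le> poly q (bits x)" by (rule computes_bits_le[OF P])
    moreover have "bits (h x) \<le> 1 + bits (f x)" unfolding assms(2) by (rule dsize_apply1)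
    ultimately show "costs ((P @ [Op1 p (Call g (Var 0))]) @ S) [encode x] (Op1 p (Call g (Var 0)))
        (encode (h x)) (poly (q + q + [:4, 1:]) (bits x))"
      by (intro costs_mono[OF costs_Op1[OF costs_body[OF P] assms(2)[symmetric]]]) simp
  qed
qed

lemma ptime_Op2:
  assumes "ptime f1" "ptime f2" "\<And>x. encode (h x) = apply2 p (encode (f1 x)) (encode (f2 x))"
  shows "ptime h"
proof -
  from assms(1,2) obtain P g1 g2 q1 q2
    where P: "computes P g1 f1 q1" "computes P g2 f2 q2" by (rule ptime2)
  let ?b = "Op2 p (Call g1 (Var 0)) (Call g2 (Var 0))"
  \<comment> \<open>Each call costs 2 plus \<open>bits x\<close> plus its own bound. The operation
    adds 1 and the size of its result, which is at most 1 plus the sizes of both arguments.\<close>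
  let ?q = "q1 + q1 + (q2 + q2) + [:6, 2:]"
  show ?thesis
  proof (rule ptimeI[of P ?b _ ?q])
    fix x S
    have "bits (f1 x) \<le> poly q1 (bits x)" "bits (f2 x) \<le> poly q2 (bits x)"
      using P by (auto intro: computes_bits_le)
    moreover have "bits (h x) \<le> 1 + bits (f1 x) + bits (f2 x)"
      unfolding assms(3) by (rule dsize_apply2)
    ultimately show "costs ((P @ [?b]) @ S) [encode x] ?b (encode (h x)) (poly ?q (bits x))"
      by (intro costs_mono[OF costs_Op2[OF costs_body[OF P(1)] costs_body[OF P(2)] assms(3)[symmetric]]])
        simp
  qed
qed

lemma ptime_If:
  assumes "ptime b" "ptime f1" "ptime f2"
  shows "ptime (\<lambda>x. if b x then f1 x else f2 x)"
proof -
  from assms obtain P g g1 g2 q q1 q2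
    where P: "computes P g b q" "computes P g1 f1 q1" "computes P g2 f2 q2" by (rule ptime3)
  let ?b = "Cond (Call g (Var 0)) (Call g1 (Var 0)) (Call g2 (Var 0))"
  let ?q = "q + q1 + q2 + [:5, 2:]"
  show ?thesis
  proof (rule ptimeI[of P ?b _ ?q])
    fix x S
    have 1: "costs ((P @ [?b]) @ S) [encode x] (Call g1 (Var 0)) (encode (if b x then f1 x else f2 x))
        (2 + bits x + poly q1 (bits x) + poly q2 (bits x))" if "encode (b x) \<noteq> Leaf 0"
      using that costs_body[OF P(2), of "[?b]" S x]
      by (auto simp: encode_bool_def split: if_splits elim!: costs_mono)
    have 2: "costs ((P @ [?b]) @ S) [encode x] (Call g2 (Var 0)) (encode (if b x then f1 x else f2 x))
        (2 + bits x + poly q1 (bits x) + poly q2 (bits x))" if "encode (b x) = Leaf 0"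
      using that costs_body[OF P(3), of "[?b]" S x]
      by (auto simp: encode_bool_def split: if_splits elim!: costs_mono)
    show "costs ((P @ [?b]) @ S) [encode x] ?b (encode (if b x then f1 x else f2 x))
        (poly ?q (bits x))"
      by (rule costs_mono[OF costs_Cond[OF costs_body[OF P(1)] 1 2]]) auto
  qed
qed

lemma ptime_comp:
  assumes "ptime f" "ptime h"
  shows "ptime (\<lambda>x. f (h x))"
proof -
  from assms obtain P g1 g2 q1 q2
    where P: "computes P g1 f q1" "computes P g2 h q2" by (rule ptime2)
  let ?b = "Call g1 (Call g2 (Var 0))"
  let ?q = "q2 + pcompose q1 q2 + [:3, 1:]"
  show ?thesis
  proof (rule ptimeI[of P ?b _ ?q])
    fix x S
    \<comment> \<open>The outer function runs on \<open>h x\<close>, whose size is bounded by the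
      running time of the inner one.\<close>
    have "poly q1 (bits (h x)) \<le> poly q1 (poly q2 (bits x))"
      by (intro poly_nat_mono computes_bits_le[OF P(2)])
    then show "costs ((P @ [?b]) @ S) [encode x] ?b (encode (f (h x))) (poly ?q (bits x))"
      using costs_computes[OF P(1) costs_body[OF P(2), of "[?b] @ S" "[]" x, simplified]]
      by (auto simp: poly_pcompose elim!: costs_mono)
  qed
qed

section \<open>Recursion along lists\<close>

primrec para :: "('a \<Rightarrow> 'a list \<Rightarrow> 'r \<Rightarrow> 'r) \<Rightarrow> 'r \<Rightarrow> 'a list \<Rightarrow> 'r" where
  "para f a [] = a"
| "para f a (y # ys) = f y ys (para f a ys)"

text \<open>
  Recursion along a list runs in polynomial time as soon as all intermediate results have
  polynomial size, which is not automatic: a constant-time step may double the size.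
\<close>

lemma ptime_para:
  fixes step :: "'x::encodable \<Rightarrow> 'y::encodable \<Rightarrow> 'y list \<Rightarrow> 'r::encodable \<Rightarrow> 'r"
  assumes "ptime (\<lambda>z. step (fst z) (fst (snd z)) (fst (snd (snd z))) (snd (snd (snd z))))"
    and "ptime init"
    and R: "\<And>x l. bits (para (step x) (init x) l) \<le> poly R (bits (x, l))"
  shows "ptime (\<lambda>z. para (step (fst z)) (init (fst z)) (snd z))"
proof -
  let ?step = "\<lambda>z. step (fst z) (fst (snd z)) (fst (snd (snd z))) (snd (snd (snd z)))"
  from assms(1,2) obtain P gs gi qs qi
    where P: "computes P gs ?step qs" "computes P gi init qi" by (rule ptime2)
  define h where "h = length P"
  define X where "X = Op1 Fst (Var 0)"
  define Y where "Y = Op1 Fst (Op1 Snd (Var 0))"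
  define YS where "YS = Op1 Snd (Op1 Snd (Var 0))"
  \<comment> \<open>\<open>T\<close> assembles the argument of the step function. The recursive call
    goes to index \<open>h\<close>, where \<open>b\<close> itself will be stored.\<close>
  define T where "T = Op2 MkNode X (Op2 MkNode Y (Op2 MkNode YS (Call h (Op2 MkNode X YS))))"
  define b where "b = Cond (Op1 IsNode (Op1 Snd (Var 0))) (Call gs T) (Call gi X)"
  let ?para = "\<lambda>x l. para (step x) (init x) l"
  \<comment> \<open>\<open>K M\<close> bounds the cost of one level of the recursion when all
    arguments have size at most \<open>M\<close>; the summands with 40 cover projections and
    pairings.\<close>
  define K where "K M = poly qs (Suc (M + poly R M)) + poly qi M + 3 * poly R M + 40 * M + 40" for M
  \<comment> \<open>\<open>M\<close> stays fixed while the list shrinks, so each of the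
    \<open>Suc (length l)\<close> levels is charged the same amount.\<close>
  have main: "costs ((P @ [b]) @ S) [encode (x, l)] b (encode (?para x l)) (Suc (length l) * K M)"
    if "bits (x, l) \<le> M" for x l S M
    using that
  proof (induction l)
    case Nil
    let ?P = "(P @ [b]) @ S" and ?a = "encode (x, [] :: 'y list)"
    have x: "costs ?P [?a] X (encode x) (3 * M + 3)"
      unfolding X_def using Nil
      by (intro costs_mono[OF costs_Op1[OF costs_Var]]) (auto simp: encode_Pair)
    have c: "costs ?P [?a] (Op1 IsNode (Op1 Snd (Var 0))) (Leaf 0) (3 * M + 6)"
      using Nil
      by (intro costs_mono[OF costs_Op1[OF costs_Op1[OF costs_Var]]])
        (auto simp: encode_Pair encode_Nil dsize_01 simp del: dsize.simps(1))
    have "costs ?P [?a] (Call gi X) (encode (init x)) (3 * M + 3 + poly qi (bits x) + 1)"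
      by (rule costs_computes[OF computes_append[OF P(2)] x])
    moreover have "poly qi (bits x) \<le> poly qi M"
      using Nil by (intro poly_nat_mono) simp
    ultimately have i: "costs ?P [?a] (Call gi X) (encode (init x)) (3 * M + 4 + poly qi M)"
      by (auto elim!: costs_mono)
    have "costs ?P [?a] b (encode (init x)) ((3 * M + 6) + (3 * M + 4 + poly qi M) + 1)"
      by (subst (2) b_def, rule costs_Cond[OF c]) (use i in auto)
    then show ?case by (auto simp: K_def elim!: costs_mono)
  next
    case (Cons y ys)
    let ?P = "(P @ [b]) @ S" and ?a = "encode (x, y # ys)"
    have M: "bits x \<le> M" "bits y \<le> M" "bits ys \<le> M" "bits (x, ys) \<le> M" "bits (y # ys) \<le> M"
      "bits x + bits y + bits ys + 3 \<le> M + 1"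
      using Cons.prems by auto
    have x: "costs ?P [?a] X (encode x) (3 * M + 3)"
      unfolding X_def using Cons.prems
      by (intro costs_mono[OF costs_Op1[OF costs_Var]]) (auto simp: encode_Pair)
    have y: "costs ?P [?a] Y (encode y) (3 * M + 3)"
      unfolding Y_def using Cons.prems
      by (intro costs_mono[OF costs_Op1[OF costs_Op1[OF costs_Var]]])
        (auto simp: encode_Pair encode_Cons)
    have ys: "costs ?P [?a] YS (encode ys) (3 * M + 3)"
      unfolding YS_def using Cons.prems
      by (intro costs_mono[OF costs_Op1[OF costs_Op1[OF costs_Var]]])
        (auto simp: encode_Pair encode_Cons)
    have c: "costs ?P [?a] (Op1 IsNode (Op1 Snd (Var 0))) (Leaf 1) (3 * M + 6)"
      using Cons.prems
      by (intro costs_mono[OF costs_Op1[OF costs_Op1[OF costs_Var]]])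
        (auto simp: encode_Pair encode_Cons dsize_01 simp del: dsize.simps(1))
    have xys: "costs ?P [?a] (Op2 MkNode X YS) (encode (x, ys)) (7 * M + 7)"
      using M by (intro costs_mono[OF costs_Op2[OF x ys]]) (auto simp: encode_Pair)
    define r where "r = ?para x ys"
    have "bits r \<le> poly R (bits (x, ys))" unfolding r_def by (rule R)
    also have "\<dots> \<le> poly R M" by (rule poly_nat_mono[OF M(4)])
    finally have r_le: "bits r \<le> poly R M" .
    have "costs ?P [encode (x, ys)] b (encode r) (Suc (length ys) * K M)"
      unfolding r_def by (rule Cons.IH) (use M in simp)
    then have "costs ?P [?a] (Call h (Op2 MkNode X YS)) (encode r)
        (7 * M + 7 + Suc (length ys) * K M + 1)"
      by (intro costs_Call[OF xys]) (auto simp: h_def nth_append)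
    then have t1: "costs ?P [?a] (Op2 MkNode YS (Call h (Op2 MkNode X YS))) (encode (ys, r))
        (12 * M + 14 + poly R M + Suc (length ys) * K M)"
      using M r_le by (intro costs_mono[OF costs_Op2[OF ys]]) (auto simp: encode_Pair)
    have t2: "costs ?P [?a] (Op2 MkNode Y (Op2 MkNode YS (Call h (Op2 MkNode X YS))))
        (encode (y, ys, r)) (17 * M + 22 + 2 * poly R M + Suc (length ys) * K M)"
      using M r_le by (intro costs_mono[OF costs_Op2[OF y t1]]) (auto simp: encode_Pair)
    have t3: "costs ?P [?a] T (encode (x, y, ys, r))
        (22 * M + 30 + 3 * poly R M + Suc (length ys) * K M)"
      unfolding T_def using M r_le
      by (intro costs_mono[OF costs_Op2[OF x t2]]) (auto simp: encode_Pair)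
    have "costs ?P [?a] (Call gs T) (encode (step x y ys r))
        (22 * M + 30 + 3 * poly R M + Suc (length ys) * K M + poly qs (bits (x, y, ys, r)) + 1)"
      using costs_computes[OF computes_append[OF P(1)] t3] by simp
    moreover have "poly qs (bits (x, y, ys, r)) \<le> poly qs (Suc (M + poly R M))"
      using M r_le by (intro poly_nat_mono) auto
    ultimately have s: "costs ?P [?a] (Call gs T) (encode (?para x (y # ys)))
        (22 * M + 31 + 3 * poly R M + Suc (length ys) * K M + poly qs (Suc (M + poly R M)))"
      by (auto simp: r_def elim!: costs_mono)
    have "costs ?P [?a] b (encode (?para x (y # ys)))
        ((3 * M + 6) + (22 * M + 31 + 3 * poly R M + Suc (length ys) * K M + poly qs (Suc (M + poly R M))) + 1)"
      by (subst (2) b_def, rule costs_Cond[OF c]) (use s in auto)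
    then show ?case
      by (elim costs_mono) (auto simp: K_def)
  qed
  have len: "length l < bits l" for l :: "'y list"
    by (induction l) auto
  let ?q = "[:0, 1:] * (pcompose qs ([:1, 1:] + R) + qi + (R + R + R) + [:40, 40:])"
  show ?thesis
  proof (rule ptimeI[of P b _ ?q])
    fix z :: "'x \<times> 'y list" and S
    obtain x l where z: "z = (x, l)" by (cases z)
    have "Suc (length l) * K (bits z) \<le> bits z * K (bits z)"
      using len[of l] z by (intro mult_le_mono) auto
    also have "\<dots> = poly ?q (bits z)"
      by (simp add: K_def poly_pcompose algebra_simps)
    finally show "costs ((P @ [b]) @ S) [encode z] b (encode (?para (fst z) (snd z)))
        (poly ?q (bits z))"
      using main[of x l "bits z" S] unfolding z by (auto elim!: costs_mono)
  qed
qed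

text \<open>The primitives compare integers only, and \<open>leaf_val\<close> takes every inner node
  for 0, so trees are compared by structural recursion with explicit \<open>IsNode\<close> tests.
  Injectivity of \<open>encode\<close> transfers the result to the encoded values.\<close>

lemma ptime_eq_pair: "ptime (\<lambda>z :: 'a::encodable \<times> 'a. fst z = snd z)"
proof -
  define A where "A = Op1 Fst (Var 0)"
  define B where "B = Op1 Snd (Var 0)"
  define E1 where "E1 = Call 0 (Op2 MkNode (Op1 Fst A) (Op1 Fst B))"
  define E2 where "E2 = Call 0 (Op2 MkNode (Op1 Snd A) (Op1 Snd B))"
  define b where "b = Cond (Op1 IsNode A) (Cond (Op1 IsNode B) (Cond E1 E2 (Lit 0)) (Lit 0))
    (Cond (Op1 IsNode B) (Lit 0) (Cond (Op2 Le A B) (Op2 Le B A) (Lit 0)))"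
  define truth where "truth c = Leaf (if c then 1 else 0)" for c
  have d: "dsize (truth c) \<le> 2" "dsize (Leaf 0) = 1" "dsize (Leaf 1) = 2" for c
    by (auto simp: truth_def dsize_01 simp del: dsize.simps(1))
  define K where "K M = 60 * M + 60" for M :: nat
  \<comment> \<open>The size of a node exceeds the sizes of its subtrees together by one, which
    leaves one share \<open>K M\<close> for the work at the node itself.\<close>
  have main: "costs (b # S) [Node u v] b (truth (u = v)) (dsize u * K M)"
    if "dsize (Node u v) \<le> M" for u v M S
    using that
  proof (induction u arbitrary: v)
    case (Leaf i)
    let ?P = "b # S" and ?a = "Node (Leaf i) v"
    have a: "costs ?P [?a] A (Leaf i) (3 * M)"
      unfolding A_def using Leaf
      by (intro costs_mono[OF costs_Op1[OF costs_Var]]) (auto simp del: dsize.simps(1))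
    have b: "costs ?P [?a] B v (3 * M)"
      unfolding B_def using Leaf
      by (intro costs_mono[OF costs_Op1[OF costs_Var]]) (auto simp del: dsize.simps(1))
    have na: "costs ?P [?a] (Op1 IsNode A) (Leaf 0) (3 * M + 2)"
      by (rule costs_mono[OF costs_Op1[OF a]]) (auto simp: d simp del: dsize.simps(1))
    have lit: "costs ?P [?a] (Lit 0) (truth False) 2"
      using costs_Lit[of ?P "[?a]" 0] by (simp add: truth_def floorlog_def numeral_2_eq_2)
    have "costs ?P [?a] b (truth (Leaf i = v)) (20 * M + 20)"
    proof (cases v)
      case (Leaf j)
      have nb: "costs ?P [?a] (Op1 IsNode B) (Leaf 0) (3 * M + 2)"
        using Leaf by (intro costs_mono[OF costs_Op1[OF b]]) (auto simp: d simp del: dsize.simps(1))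
      have le: "costs ?P [?a] (Op2 Le A B) (truth (i \<le> j)) (6 * M + 3)"
        using Leaf d by (intro costs_mono[OF costs_Op2[OF a b]])
          (auto simp: truth_def simp del: dsize.simps(1))
      have "costs ?P [?a] (Op2 Le B A) (truth (j \<le> i)) (6 * M + 3)"
        using Leaf d by (intro costs_mono[OF costs_Op2[OF b a]])
          (auto simp: truth_def simp del: dsize.simps(1))
      moreover have "costs ?P [?a] (Lit 0) (truth False) (6 * M + 3)"
        by (rule costs_mono[OF lit]) simp
      ultimately have "costs ?P [?a] (Cond (Op2 Le A B) (Op2 Le B A) (Lit 0)) (truth (Leaf i = v))
          ((6 * M + 3) + (6 * M + 3) + 1)"
        using Leaf by (intro costs_Cond[OF le]) (auto simp: truth_def split: if_splits)
      then have "costs ?P [?a] (Cond (Op1 IsNode B) (Lit 0)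
          (Cond (Op2 Le A B) (Op2 Le B A) (Lit 0))) (truth (Leaf i = v)) ((3 * M + 2) + (12 * M + 7) + 1)"
        by (intro costs_Cond[OF nb]) (auto elim!: costs_mono)
      then have "costs ?P [?a] b (truth (Leaf i = v)) ((3 * M + 2) + (15 * M + 10) + 1)"
        by (subst (2) b_def, intro costs_Cond[OF na]) (auto elim!: costs_mono)
      then show ?thesis by (auto elim!: costs_mono)
    next
      case (Node v1 v2)
      have nb: "costs ?P [?a] (Op1 IsNode B) (Leaf 1) (3 * M + 3)"
        using Node by (intro costs_mono[OF costs_Op1[OF b]]) (auto simp: d simp del: dsize.simps(1))
      have "costs ?P [?a] (Cond (Op1 IsNode B) (Lit 0)
          (Cond (Op2 Le A B) (Op2 Le B A) (Lit 0))) (truth (Leaf i = v)) ((3 * M + 3) + 2 + 1)"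
        using lit Node by (intro costs_Cond[OF nb]) auto
      then have "costs ?P [?a] b (truth (Leaf i = v)) ((3 * M + 2) + (3 * M + 6) + 1)"
        by (subst (2) b_def, intro costs_Cond[OF na]) (auto elim!: costs_mono)
      then show ?thesis by (auto elim!: costs_mono)
    qed
    moreover have "20 * M + 20 \<le> dsize (Leaf i) * K M"
      by (simp add: K_def)
    ultimately show ?case by (rule costs_mono)
  next
    case (Node u1 u2)
    let ?P = "b # S" and ?a = "Node (Node u1 u2) v"
    note dsize_pos[of u1] dsize_pos[of u2] dsize_pos[of v]
    note M = Node.prems
    have a: "costs ?P [?a] A (Node u1 u2) (3 * M)"
      unfolding A_def using M by (intro costs_mono[OF costs_Op1[OF costs_Var]]) auto
    have b: "costs ?P [?a] B v (3 * M)"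
      unfolding B_def using M by (intro costs_mono[OF costs_Op1[OF costs_Var]]) auto
    have na: "costs ?P [?a] (Op1 IsNode A) (Leaf 1) (3 * M + 3)"
      by (rule costs_mono[OF costs_Op1[OF a]]) (auto simp: d simp del: dsize.simps(1))
    have lit: "costs ?P [?a] (Lit 0) (truth False) 2"
      using costs_Lit[of ?P "[?a]" 0] by (simp add: truth_def floorlog_def numeral_2_eq_2)
    show ?case
    proof (cases v)
      case (Leaf j)
      have nb: "costs ?P [?a] (Op1 IsNode B) (Leaf 0) (3 * M + 2)"
        using Leaf by (intro costs_mono[OF costs_Op1[OF b]]) (auto simp: d simp del: dsize.simps(1))
      have "costs ?P [?a] (Cond (Op1 IsNode B) (Cond E1 E2 (Lit 0)) (Lit 0))
          (truth (Node u1 u2 = v)) ((3 * M + 2) + 2 + 1)"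
        using lit Leaf by (intro costs_Cond[OF nb]) auto
      then have "costs ?P [?a] b (truth (Node u1 u2 = v)) ((3 * M + 3) + (3 * M + 5) + 1)"
        by (subst (2) b_def, intro costs_Cond[OF na]) (auto elim!: costs_mono)
      then show ?thesis by (auto simp: K_def elim!: costs_mono)
    next
      case v: (Node v1 v2)
      have nb: "costs ?P [?a] (Op1 IsNode B) (Leaf 1) (3 * M + 3)"
        using v by (intro costs_mono[OF costs_Op1[OF b]]) (auto simp: d simp del: dsize.simps(1))
      have f: "costs ?P [?a] (Op1 Fst A) u1 (4 * M + 1)" "costs ?P [?a] (Op1 Snd A) u2 (4 * M + 1)"
        by (rule costs_mono[OF costs_Op1[OF a]]; use v M in simp)+
      have f': "costs ?P [?a] (Op1 Fst B) v1 (4 * M + 1)" "costs ?P [?a] (Op1 Snd B) v2 (4 * M + 1)"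
        by (rule costs_mono[OF costs_Op1[OF b]]; use v M in simp)+
      have p: "costs ?P [?a] (Op2 MkNode (Op1 Fst A) (Op1 Fst B)) (Node u1 v1) (9 * M + 3)"
        by (rule costs_mono[OF costs_Op2[OF f(1) f'(1)]]; use v M in simp)
      have p': "costs ?P [?a] (Op2 MkNode (Op1 Snd A) (Op1 Snd B)) (Node u2 v2) (9 * M + 3)"
        by (rule costs_mono[OF costs_Op2[OF f(2) f'(2)]]; use v M in simp)
      have "costs ?P [Node u1 v1] b (truth (u1 = v1)) (dsize u1 * K M)"
        "costs ?P [Node u2 v2] b (truth (u2 = v2)) (dsize u2 * K M)"
        using M v by (auto intro!: Node.IH)
      then have e: "costs ?P [?a] E1 (truth (u1 = v1)) (9 * M + 3 + dsize u1 * K M + 1)"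
          "costs ?P [?a] E2 (truth (u2 = v2)) (9 * M + 3 + dsize u2 * K M + 1)"
        unfolding E1_def E2_def by (auto intro: costs_Call[OF p, simplified] costs_Call[OF p', simplified])
      have "costs ?P [?a] (Lit 0) (truth False) (9 * M + 3 + dsize u2 * K M + 1)"
        by (rule costs_mono[OF lit]) simp
      with e(2) have "costs ?P [?a] (Cond E1 E2 (Lit 0)) (truth (Node u1 u2 = v))
          ((9 * M + 3 + dsize u1 * K M + 1) + (9 * M + 3 + dsize u2 * K M + 1) + 1)"
        using v by (intro costs_Cond[OF e(1)]) (auto simp: truth_def split: if_splits)
      then have "costs ?P [?a] (Cond (Op1 IsNode B) (Cond E1 E2 (Lit 0)) (Lit 0))
          (truth (Node u1 u2 = v)) ((3 * M + 3) +
          (18 * M + 9 + dsize u1 * K M + dsize u2 * K M) + 1)"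
        by (intro costs_Cond[OF nb]) (auto elim!: costs_mono)
      then have "costs ?P [?a] b (truth (Node u1 u2 = v)) ((3 * M + 3) +
          (21 * M + 13 + dsize u1 * K M + dsize u2 * K M) + 1)"
        by (subst (2) b_def, intro costs_Cond[OF na]) (auto elim!: costs_mono)
      then show ?thesis
        by (elim costs_mono) (simp add: K_def algebra_simps)
    qed
  qed
  show ?thesis
  proof (rule ptimeI[of "[]" b _ "[:0, 1:] * [:60, 60:]"])
    fix z :: "'a \<times> 'a" and S
    obtain x y where z: "z = (x, y)" by (cases z)
    have "bits x * K (bits z) \<le> bits z * K (bits z)"
      unfolding z by (intro mult_le_mono) auto
    then have "costs (b # S) [Node (encode x) (encode y)] b (truth (encode x = encode y))
        (poly ([:0, 1:] * [:60, 60:]) (bits z))"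
      by (intro costs_mono[OF main[where M = "bits z"]])
        (auto simp: K_def z encode_Pair algebra_simps)
    then show "costs (([] @ [b]) @ S) [encode z] b (encode (fst z = snd z))
        (poly ([:0, 1:] * [:60, 60:]) (bits z))"
      by (simp add: z encode_Pair encode_bool_def truth_def encode_eq_iff)
  qed
qed

lemma bits_mem: "y \<in> set ys \<Longrightarrow> bits y < bits ys"
  by (induction ys) auto

lemma length_less_bits: "length ys < bits ys"
  by (induction ys) auto

lemma bits_list_le:
  assumes "\<And>y. y \<in> set ys \<Longrightarrow> bits y \<le> N"
  shows "bits ys \<le> 1 + length ys * (1 + N)"
  using assms
proof (induction ys)
  case (Cons a ys)
  then have "bits a \<le> N" "bits ys \<le> 1 + length ys * (1 + N)" by auto
  then show ?case by simp
qed simp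

lemma bits_nat_le: "bits (n::nat) \<le> 1 + n"
  by (simp add: encode_nat_def floorlog_le_iff less_exp)

section \<open>Syntax-directed rules for polynomial time\<close>

named_theorems ptime_intros

lemma ptime_consts [ptime_intros]:
  "ptime (\<lambda>x :: 'a::encodable. True)" "ptime (\<lambda>x :: 'a. False)"
  "ptime (\<lambda>x :: 'a. [] :: 'b::encodable list)"
  "ptime (\<lambda>x :: 'a. 0 :: nat)" "ptime (\<lambda>x :: 'a. 1 :: nat)" "ptime (\<lambda>x :: 'a. numeral k :: nat)"
  "ptime (\<lambda>x :: 'a. 0 :: int)" "ptime (\<lambda>x :: 'a. 1 :: int)"
  by (rule ptime_Lit, simp add: encode_bool_def encode_nat_def encode_int_def encode_Nil; fail)+

lemmas ptime_id [ptime_intros]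

lemma ptime_fst [ptime_intros]: "ptime f \<Longrightarrow> ptime (\<lambda>x. fst (f x))"
  by (erule ptime_Op1[where p = Fst]) (simp add: encode_prod_def)

lemma ptime_snd [ptime_intros]: "ptime f \<Longrightarrow> ptime (\<lambda>x. snd (f x))"
  by (erule ptime_Op1[where p = Snd]) (simp add: encode_prod_def)

lemma ptime_Pair [ptime_intros]: "ptime f \<Longrightarrow> ptime g \<Longrightarrow> ptime (\<lambda>x. (f x, g x))"
  by (erule (1) ptime_Op2[where p = MkNode]) (simp add: encode_Pair)

lemma ptime_Cons [ptime_intros]: "ptime f \<Longrightarrow> ptime g \<Longrightarrow> ptime (\<lambda>x. f x # g x)"
  by (erule (1) ptime_Op2[where p = MkNode]) (simp add: encode_Cons)

lemma ptime_nat_plus [ptime_intros]: "ptime f \<Longrightarrow> ptime g \<Longrightarrow> ptime (\<lambda>x. f x + g x :: nat)"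
  by (erule (1) ptime_Op2[where p = Add]) (simp add: encode_nat_def)

lemma ptime_nat_times [ptime_intros]: "ptime f \<Longrightarrow> ptime g \<Longrightarrow> ptime (\<lambda>x. f x * g x :: nat)"
  by (erule (1) ptime_Op2[where p = Mul]) (simp add: encode_nat_def)

lemma ptime_nat_le [ptime_intros]: "ptime f \<Longrightarrow> ptime g \<Longrightarrow> ptime (\<lambda>x. f x \<le> (g x :: nat))"
  by (erule (1) ptime_Op2[where p = Le]) (simp add: encode_nat_def encode_bool_def)

lemma ptime_int_plus [ptime_intros]: "ptime f \<Longrightarrow> ptime g \<Longrightarrow> ptime (\<lambda>x. f x + g x :: int)"
  by (erule (1) ptime_Op2[where p = Add]) (simp add: encode_int_def)

lemma ptime_int_minus [ptime_intros]: "ptime f \<Longrightarrow> ptime g \<Longrightarrow> ptime (\<lambda>x. f x - g x :: int)"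
  by (erule (1) ptime_Op2[where p = Sub]) (simp add: encode_int_def)

lemma ptime_int_le [ptime_intros]: "ptime f \<Longrightarrow> ptime g \<Longrightarrow> ptime (\<lambda>x. f x \<le> (g x :: int))"
  by (erule (1) ptime_Op2[where p = Le]) (simp add: encode_int_def encode_bool_def)

lemmas ptime_If [ptime_intros]

lemma ptime_not [ptime_intros]: "ptime f \<Longrightarrow> ptime (\<lambda>x. \<not> f x)"
  using ptime_If[of f "\<lambda>x. False" "\<lambda>x. True"] ptime_consts by (simp add: if_bool_eq_conj)

lemma ptime_conj [ptime_intros]: "ptime f \<Longrightarrow> ptime g \<Longrightarrow> ptime (\<lambda>x. f x \<and> g x)"
  using ptime_If[of f g "\<lambda>x. False"] ptime_consts by (simp add: if_bool_eq_disj)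

lemma ptime_disj [ptime_intros]: "ptime f \<Longrightarrow> ptime g \<Longrightarrow> ptime (\<lambda>x. f x \<or> g x)"
  using ptime_If[of f "\<lambda>x. True" g] ptime_consts by (simp add: if_bool_eq_conj imp_conv_disj)

lemma ptime_nat_less [ptime_intros]: "ptime f \<Longrightarrow> ptime g \<Longrightarrow> ptime (\<lambda>x. f x < (g x :: nat))"
  unfolding not_le[symmetric] by (intro ptime_intros)

lemma ptime_int_less [ptime_intros]: "ptime f \<Longrightarrow> ptime g \<Longrightarrow> ptime (\<lambda>x. f x < (g x :: int))"
  unfolding not_le[symmetric] by (intro ptime_intros)

lemma ptime_eq [ptime_intros]: "ptime f \<Longrightarrow> ptime g \<Longrightarrow> ptime (\<lambda>x. f x = g x)"
  using ptime_comp[OF ptime_eq_pair ptime_Pair, of f g] by simp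

text \<open>\<open>n\<close> and \<open>int n\<close> have the same encoding; adding zero presents
  the change of type as a primitive operation.\<close>

lemma ptime_int [ptime_intros]: "ptime f \<Longrightarrow> ptime (\<lambda>x. int (f x))"
  by (erule ptime_Op2[where p = Add, OF _ ptime_consts(4)]) (simp add: encode_int_def encode_nat_def)

lemma ptime_nat_minus [ptime_intros]:
  assumes "ptime f" "ptime g"
  shows "ptime (\<lambda>x. f x - g x :: nat)"
proof -
  \<comment> \<open>Truncated subtraction is computed in the integers, and the nonnegative result is
    then read as a natural number.\<close>
  have "ptime (\<lambda>x. max 0 (int (f x) - int (g x)))"
    unfolding max_def by (intro ptime_intros assms)
  then show ?thesis
    by (rule ptime_Op2[where p = Add, OF _ ptime_consts(4)]) (simp add: encode_int_def encode_nat_def)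
qed

lemma ptime_Suc [ptime_intros]: "ptime f \<Longrightarrow> ptime (\<lambda>x. Suc (f x))"
  using ptime_nat_plus[OF _ ptime_consts(5)] by simp

text \<open>The exponent is a constant, as \<open>p\<close> is; for an exponent given in binary the
  result could be exponentially long.\<close>

lemma ptime_power [ptime_intros]: "ptime f \<Longrightarrow> ptime (\<lambda>x. f x ^ c :: nat)" for c :: nat
  by (induction c) (auto intro: ptime_intros)

text \<open>\<open>Fst\<close> returns \<open>Leaf 0\<close> on a leaf, and this encodes both the
  empty list and zero. Hence the default values here and in the next lemma.\<close>

lemma ptime_case_list_Nil [ptime_intros]:
  fixes f :: "'a::encodable \<Rightarrow> 'b::encodable list list"
  shows "ptime f \<Longrightarrow> ptime (\<lambda>x. case f x of [] \<Rightarrow> [] | y # ys \<Rightarrow> y)"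
  by (erule ptime_Op1[where p = Fst]) (auto simp: encode_Nil encode_Cons split: list.split)

lemma ptime_case_list_zero [ptime_intros]:
  fixes f :: "'a::encodable \<Rightarrow> int list"
  shows "ptime f \<Longrightarrow> ptime (\<lambda>x. case f x of [] \<Rightarrow> 0 | y # ys \<Rightarrow> y)"
  by (erule ptime_Op1[where p = Fst])
    (auto simp: encode_Nil encode_Cons encode_int_def split: list.split)

lemma ptime_arg2:
  "ptime (\<lambda>z :: 'a::encodable \<times> 'b::encodable \<times> 'c::encodable. (fst z, fst (snd z)))"
  by (intro ptime_intros)

lemma ptime_arg3:
  "ptime (\<lambda>z :: 'a::encodable \<times> 'b::encodable \<times> 'c::encodable \<times> 'd::encodable.
    (fst z, fst (snd z), fst (snd (snd z))))"
  by (intro ptime_intros)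

text \<open>The intermediate results of \<open>para\<close> are the values of the closed form
  \<open>h\<close> on suffixes, so the size condition becomes one on \<open>h\<close>.\<close>

lemma ptime_recursion:
  fixes step :: "'x::encodable \<Rightarrow> 'y::encodable \<Rightarrow> 'y list \<Rightarrow> 'r::encodable \<Rightarrow> 'r"
  assumes "ptime (\<lambda>z. step (fst z) (fst (snd z)) (fst (snd (snd z))) (snd (snd (snd z))))"
    and "ptime init" "ptime l"
    and "\<And>x ys. para (step x) (init x) ys = h x ys"
    and "\<And>x ys. bits (h x ys) \<le> poly R (bits x + bits ys)"
  shows "ptime (\<lambda>x. h x (l x))"
proof -
  have "bits (para (step x) (init x) ys) \<le> poly R (bits (x, ys))" for x ys
    unfolding assms(4) by (rule order.trans[OF assms(5) poly_nat_mono]) simp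
  from ptime_comp[OF ptime_para[OF assms(1,2) this], of "\<lambda>x. (x, l x)"]
  show ?thesis using ptime_Pair[OF ptime_id assms(3)] by (simp add: assms(4))
qed

lemma ptime_map [ptime_intros]:
  fixes f :: "'x::encodable \<Rightarrow> 'y::encodable \<Rightarrow> 'r::encodable"
  assumes f: "ptime (\<lambda>z. f (fst z) (snd z))" and l: "ptime l"
  shows "ptime (\<lambda>x. map (f x) (l x))"
proof -
  obtain q where q: "\<And>z. bits (f (fst z) (snd z)) \<le> poly q (bits z)"
    using ptime_bits_le[OF f] by blast
  show ?thesis
  proof (rule ptime_recursion[where step = "\<lambda>x y ys r. f x y # r" and init = "\<lambda>x. []"
        and R = "1 + [:0, 1:] * (1 + q)" and h = "\<lambda>x. map (f x)" and l = l])
    have "ptime (\<lambda>z. f (fst z) (fst (snd z)))"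
      by (rule ptime_comp[OF f ptime_arg2, simplified])
    then show "ptime (\<lambda>z. f (fst z) (fst (snd z)) # snd (snd (snd z)))"
      by (intro ptime_intros)
    show "para (\<lambda>y ys r. f x y # r) [] ys = map (f x) ys" for x ys
      by (induction ys) auto
    fix x and ys :: "'y list"
    have "bits (map (f x) ys) \<le> 1 + length (map (f x) ys) * (1 + poly q (bits x + bits ys))"
    proof (intro bits_list_le)
      fix r assume "r \<in> set (map (f x) ys)"
      then obtain y where y: "y \<in> set ys" "r = f x y" by auto
      have "bits r \<le> poly q (bits (x, y))" using q[of "(x, y)"] y by simp
      also have "\<dots> \<le> poly q (bits x + bits ys)"
        using bits_mem[OF y(1)] by (intro poly_nat_mono) simp
      finally show "bits r \<le> poly q (bits x + bits ys)" .
    qed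
    also have "\<dots> \<le> 1 + (bits x + bits ys) * (1 + poly q (bits x + bits ys))"
      using length_less_bits[of ys] by (intro add_mono mult_le_mono) auto
    finally show "bits (map (f x) ys) \<le> poly (1 + [:0, 1:] * (1 + q)) (bits x + bits ys)"
      by simp
  qed (intro ptime_intros l)+
qed

text \<open>The test also sees the rest of the list. This one recursion gives \<open>filter\<close>
  and \<open>remdups\<close>, and later the truncation of multiplicities in \<open>thin\<close> and
  the quota in \<open>kept_coords\<close>.\<close>

primrec sfilter :: "('a \<Rightarrow> 'a list \<Rightarrow> bool) \<Rightarrow> 'a list \<Rightarrow> 'a list" where
  "sfilter b [] = []"
| "sfilter b (y # ys) = (if b y ys then y # sfilter b ys else sfilter b ys)"

lemma sfilter_filter: "sfilter (\<lambda>y ys. b y) l = filter b l"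
  by (induction l) auto

lemma sfilter_remdups: "sfilter (\<lambda>y ys. y \<notin> set ys) l = remdups l"
  by (induction l) auto

lemma ptime_sfilter [ptime_intros]:
  fixes b :: "'x::encodable \<Rightarrow> 'y::encodable \<Rightarrow> 'y list \<Rightarrow> bool"
  assumes b: "ptime (\<lambda>z. b (fst z) (fst (snd z)) (snd (snd z)))" and l: "ptime l"
  shows "ptime (\<lambda>x. sfilter (b x) (l x))"
proof (rule ptime_recursion[where step = "\<lambda>x y ys r. if b x y ys then y # r else r"
      and init = "\<lambda>x. []" and R = "[:0, 1:]" and h = "\<lambda>x. sfilter (b x)" and l = l])
  show "ptime (\<lambda>z. if b (fst z) (fst (snd z)) (fst (snd (snd z)))
      then fst (snd z) # snd (snd (snd z)) else snd (snd (snd z)))"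
    by (intro ptime_intros ptime_comp[OF b ptime_arg3, simplified])
  show "para (\<lambda>y ys r. if b x y ys then y # r else r) [] ys = sfilter (b x) ys" for x ys
    by (induction ys) auto
  have "bits (sfilter (b x) ys) \<le> bits ys" for x ys
    by (induction ys) auto
  then show "bits (sfilter (b x) ys) \<le> poly [:0, 1:] (bits x + bits ys)" for x ys
    by (simp add: trans_le_add2)
qed (intro ptime_intros l)+

lemma ptime_filter [ptime_intros]:
  fixes b :: "'x::encodable \<Rightarrow> 'y::encodable \<Rightarrow> bool"
  assumes b: "ptime (\<lambda>z. b (fst z) (snd z))" and l: "ptime l"
  shows "ptime (\<lambda>x. filter (b x) (l x))"
proof -
  have "ptime (\<lambda>z :: 'x \<times> 'y \<times> 'y list. b (fst z) (fst (snd z)))"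
    by (rule ptime_comp[OF b ptime_arg2, simplified])
  from ptime_sfilter[of "\<lambda>x y ys. b x y", OF this l] show ?thesis
    by (simp add: sfilter_filter)
qed

lemma ptime_Bex [ptime_intros]:
  assumes "ptime (\<lambda>z. b (fst z) (snd z))" "ptime l"
  shows "ptime (\<lambda>x. \<exists>y\<in>set (l x). b x y)"
proof -
  have "(\<exists>y\<in>set (l x). b x y) \<longleftrightarrow> filter (b x) (l x) \<noteq> []" for x
    by (auto simp: filter_empty_conv)
  then show ?thesis by (simp only:) (intro ptime_intros assms)
qed

lemma ptime_Ball [ptime_intros]:
  assumes "ptime (\<lambda>z. b (fst z) (snd z))" "ptime l"
  shows "ptime (\<lambda>x. \<forall>y\<in>set (l x). b x y)"
proof -
  have "(\<forall>y\<in>set (l x). b x y) \<longleftrightarrow> \<not> (\<exists>y\<in>set (l x). \<not> b x y)" for x by blast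
  then show ?thesis by (simp only:) (intro ptime_intros assms)
qed

lemma ptime_member [ptime_intros]:
  assumes "ptime f" "ptime l"
  shows "ptime (\<lambda>x. f x \<in> set (l x))"
proof -
  have "f x \<in> set (l x) \<longleftrightarrow> (\<exists>y\<in>set (l x). y = f x)" for x by blast
  moreover have "ptime (\<lambda>z. f (fst z))"
    by (intro ptime_comp[OF assms(1)] ptime_intros)
  ultimately show ?thesis by (simp only:) (intro ptime_intros assms)
qed

lemma ptime_remdups [ptime_intros]:
  assumes "ptime l"
  shows "ptime (\<lambda>x. remdups (l x))"
  unfolding sfilter_remdups[symmetric] by (intro ptime_intros assms)

lemma ptime_length [ptime_intros]:
  fixes l :: "'x::encodable \<Rightarrow> 'y::encodable list"
  assumes "ptime l"
  shows "ptime (\<lambda>x. length (l x))"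
proof (rule ptime_recursion[where step = "\<lambda>x y ys r. Suc r" and init = "\<lambda>x. 0" and R = "[:1, 1:]"
      and h = "\<lambda>x. length" and l = l])
  show "para (\<lambda>y ys r. Suc r) 0 ys = length ys" for ys :: "'y list"
    by (induction ys) auto
  show "bits (length ys) \<le> poly [:1, 1:] (bits x + bits ys)" for x :: 'x and ys :: "'y list"
    using bits_nat_le[of "length ys"] length_less_bits[of ys] by simp
qed (intro ptime_intros assms)+

text \<open>A range up to \<open>n\<close> is exponentially long in the binary size of
  \<open>n\<close>, so ranges are produced along a list. The position of an entry is the total
  length minus the length of the suffix starting there, which is why the list serves both as
  parameter and as recursion argument.\<close>

lemma ptime_upt_length [ptime_intros]:
  fixes l :: "'x::encodable \<Rightarrow> 'y::encodable list"
  assumes "ptime l"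
  shows "ptime (\<lambda>x. [0..<length (l x)])"
proof -
  let ?h = "\<lambda>N ys :: 'y list. map (\<lambda>i. N - Suc i) (rev [0..<length ys])"
  have "ptime (\<lambda>z :: 'y list. ?h (length z) z)"
  proof (rule ptime_recursion[where step = "\<lambda>x y ys r. (length x - Suc (length ys)) # r"
        and init = "\<lambda>x. []" and R = "1 + [:0, 1:] * [:2, 1:]"
        and h = "\<lambda>x. ?h (length x)" and l = "\<lambda>x. x"])
    show "para (\<lambda>y ys. (#) (length x - Suc (length ys))) [] ys = ?h (length x) ys" for x ys :: "'y list"
      by (induction ys) auto
    fix x ys :: "'y list"
    have "bits (?h (length x) ys) \<le> 1 + length (?h (length x) ys) * (1 + (1 + length x))"
      by (intro bits_list_le) (auto intro!: order.trans[OF bits_nat_le])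
    also have "\<dots> \<le> 1 + (bits x + bits ys) * (1 + (1 + (bits x + bits ys)))"
      using length_less_bits[of ys] length_less_bits[of x] by (intro add_mono mult_le_mono) auto
    finally show "bits (?h (length x) ys) \<le> poly (1 + [:0, 1:] * [:2, 1:]) (bits x + bits ys)"
      by simp
  qed (intro ptime_intros)+
  moreover have "?h (length z) z = [0..<length z]" for z
    by (rule nth_equalityI) (auto simp: rev_nth)
  ultimately have "ptime (\<lambda>z :: 'y list. [0..<length z])" by simp
  from ptime_comp[OF this assms] show ?thesis .
qed

text \<open>The earlier result is either kept or replaced by a value computed without it, so sizes
  cannot build up and a polynomial bound comes for free.\<close>

lemma ptime_selection:
  fixes b :: "'x::encodable \<Rightarrow> 'y::encodable \<Rightarrow> 'y list \<Rightarrow> 'r::encodable \<Rightarrow> bool"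
  assumes b: "ptime (\<lambda>z. b (fst z) (fst (snd z)) (fst (snd (snd z))) (snd (snd (snd z))))"
    and f: "ptime (\<lambda>z. f (fst z) (fst (snd z)) (snd (snd z)))"
    and i: "ptime init" and l: "ptime l"
    and h: "\<And>x ys. para (\<lambda>y ys r. if b x y ys r then f x y ys else r) (init x) ys = h x ys"
  shows "ptime (\<lambda>x. h x (l x))"
proof -
  obtain q where q: "\<And>z. bits (f (fst z) (fst (snd z)) (snd (snd z))) \<le> poly q (bits z)"
    using ptime_bits_le[OF f] by blast
  obtain q' where q': "\<And>z. bits (init z) \<le> poly q' (bits z)"
    using ptime_bits_le[OF i] by blast
  show ?thesis
  proof (rule ptime_recursion[where step = "\<lambda>x y ys r. if b x y ys r then f x y ys else r"
        and init = init and R = "q' + pcompose q [:1, 1:]"])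
    show "ptime (\<lambda>z. if b (fst z) (fst (snd z)) (fst (snd (snd z))) (snd (snd (snd z)))
        then f (fst z) (fst (snd z)) (fst (snd (snd z))) else snd (snd (snd z)))"
      by (intro ptime_intros b ptime_comp[OF f ptime_arg3, simplified])
    show "bits (h x ys) \<le> poly (q' + pcompose q [:1, 1:]) (bits x + bits ys)" for x ys
      unfolding h[symmetric]
    proof (induction ys)
      case Nil
      have "bits (init x) \<le> poly q' (bits x)" by (rule q')
      also have "\<dots> \<le> poly q' (bits x + 1)" by (rule poly_nat_mono) simp
      finally show ?case by simp
    next
      case (Cons y ys)
      let ?r = "para (\<lambda>y ys r. if b x y ys r then f x y ys else r) (init x) ys"
      note Cons.IH
      also have "poly (q' + pcompose q [:1, 1:]) (bits x + bits ys)
          \<le> poly (q' + pcompose q [:1, 1:]) (bits x + bits (y # ys))"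
        by (rule poly_nat_mono) simp
      finally have "bits ?r \<le> poly (q' + pcompose q [:1, 1:]) (bits x + bits (y # ys))" .
      moreover have "bits (f x y ys) \<le> poly q (bits (x, y, ys))"
        using q[of "(x, y, ys)"] by simp
      then have "bits (f x y ys) \<le> poly (q' + pcompose q [:1, 1:]) (bits x + bits (y # ys))"
        by (simp add: poly_pcompose)
      ultimately show ?case by simp
    qed
  qed (intro ptime_intros i l h)+
qed

lemma ptime_drop [ptime_intros]:
  fixes l :: "'x::encodable \<Rightarrow> 'y::encodable list"
  assumes "ptime i" "ptime l"
  shows "ptime (\<lambda>x. drop (i x) (l x))"
proof -
  \<comment> \<open>The recursion proceeds from the right: the suffix found so far is extended as
    long as it is short enough to survive \<open>drop\<close>.\<close>
  let ?b = "\<lambda>x y ys r. Suc (length ys) \<le> length (l x) - i x"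
  have *: "para (\<lambda>y ys r. if ?b x y ys r then y # ys else r) [] ys
      = drop (length ys - (length (l x) - i x)) ys" for x ys
    by (induction ys) (auto simp: Suc_diff_le)
  have "ptime (\<lambda>z. i (fst z))" "ptime (\<lambda>z. l (fst z))"
    by (intro ptime_comp[OF assms(1)] ptime_comp[OF assms(2)] ptime_intros)+
  then have "ptime (\<lambda>x. drop (length (l x) - (length (l x) - i x)) (l x))"
    by (intro ptime_selection[where b = ?b and f = "\<lambda>x y ys. y # ys" and init = "\<lambda>x. []", OF _ _ _ _ *]
        ptime_intros assms)
  moreover have "drop (length (l x) - (length (l x) - i x)) (l x) = drop (i x) (l x)" for x
    by (cases "i x \<le> length (l x)") auto
  ultimately show ?thesis by simp
qed

lemma ptime_dropWhile [ptime_intros]: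
  fixes b :: "'x::encodable \<Rightarrow> 'y::encodable \<Rightarrow> bool"
  assumes b: "ptime (\<lambda>z. b (fst z) (snd z))" and l: "ptime l"
  shows "ptime (\<lambda>x. dropWhile (b x) (l x))"
proof (rule ptime_selection[where b = "\<lambda>x y ys r. \<not> b x y" and f = "\<lambda>x y ys. y # ys"
      and init = "\<lambda>x. []" and h = "\<lambda>x. dropWhile (b x)" and l = l])
  show "ptime (\<lambda>z. \<not> b (fst z) (fst (snd z)))"
    by (intro ptime_intros ptime_comp[OF b ptime_arg2, simplified])
  show "para (\<lambda>y ys r. if \<not> b x y then y # ys else r) [] ys = dropWhile (b x) ys" for x ys
    by (induction ys) auto
qed (intro ptime_intros l)+

lemma ptime_sum_list_int [ptime_intros]:
  fixes f :: "'x::encodable \<Rightarrow> 'y::encodable \<Rightarrow> int"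
  assumes f: "ptime (\<lambda>z. f (fst z) (snd z))" and l: "ptime l"
  shows "ptime (\<lambda>x. \<Sum>y\<leftarrow>l x. f x y)"
proof -
  have "ptime (\<lambda>x. sum_list (map (f x) (l x)))"
  proof (rule ptime_comp[of sum_list "\<lambda>x. map (f x) (l x)"])
    show "ptime (sum_list :: int list \<Rightarrow> int)"
    proof (rule ptime_recursion[where step = "\<lambda>x y ys r. y + r" and init = "\<lambda>x. 0"
          and l = "\<lambda>x. x" and h = "\<lambda>x ys. sum_list ys" and R = "[:0, 1:]"])
      show "para (\<lambda>y ys. (+) y) 0 ys = sum_list ys" for ys :: "int list"
        by (induction ys) auto
      have "bits (sum_list ys) \<le> bits ys" for ys :: "int list"
      proof (induction ys)
        case Nil then show ?case by (simp add: encode_int_def floorlog_def)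
      next
        case (Cons y ys)
        then show ?case
          using dsize_Leaf_plus[of y "sum_list ys"] by (simp add: encode_int_def)
      qed
      then show "bits (sum_list ys) \<le> poly [:0, 1:] (bits x + bits ys)" for x ys :: "int list"
        by (simp add: trans_le_add2)
    qed (intro ptime_intros)+
  qed (intro ptime_intros f l)
  then show ?thesis .
qed

section \<open>Clustering costs\<close>

definition weight :: "nat \<Rightarrow> real \<Rightarrow> real" where
  "weight p r = (if p = 0 then of_bool (r \<noteq> 0) else \<bar>r\<bar> ^ p)"

definition gauge :: "nat \<Rightarrow> real \<Rightarrow> real" where
  "gauge p t = (if p = 0 then t else root p t)"

text \<open>Splitting the norm into an outer monotone function and a sum over coordinates treats
  \<open>p = 0\<close> and \<open>p > 0\<close> alike: coordinatewise comparison of weights is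
  enough.\<close>

definition fnorm :: "nat \<Rightarrow> nat \<Rightarrow> (nat \<Rightarrow> real) \<Rightarrow> real" where
  "fnorm p d f = gauge p (\<Sum>i<d. weight p (f i))"

lemma weight_nonneg [simp]: "0 \<le> weight p r"
  by (simp add: weight_def)

lemma weight_zero [simp]: "weight p 0 = 0"
  by (simp add: weight_def)

lemma weight_minus [simp]: "weight p (- r) = weight p r"
  by (simp add: weight_def)

lemma weight_ge_1: "1 \<le> \<bar>r\<bar> \<Longrightarrow> 1 \<le> weight p r"
  by (auto simp: weight_def one_le_power)

lemma gauge_mono: "s \<le> t \<Longrightarrow> gauge p s \<le> gauge p t"
  by (simp add: gauge_def)

lemma gauge_0 [simp]: "gauge p 0 = 0" and gauge_1 [simp]: "gauge p 1 = 1"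
  by (simp_all add: gauge_def)

lemma fnorm_nonneg: "0 \<le> fnorm p d f"
  unfolding fnorm_def using gauge_mono[of 0 "\<Sum>i<d. weight p (f i)" p] by (simp add: sum_nonneg)

lemma fnorm_power:
  assumes "p > 0"
  shows "fnorm p d f ^ p = (\<Sum>i<d. \<bar>f i\<bar> ^ p)"
  using assms by (simp add: fnorm_def gauge_def weight_def sum_nonneg)

text \<open>In the induction step the difference of the two sides is a nonnegative multiple of
  \<open>(u - v) * (u ^ n - v ^ n)\<close>, whose factors have the same sign.\<close>

lemma power_convex:
  fixes u v l m :: real
  assumes "0 \<le> u" "0 \<le> v" "0 \<le> l" "0 \<le> m" "l + m = 1"
  shows "(l * u + m * v) ^ n \<le> l * u ^ n + m * v ^ n"
proof (induction n)
  case 0 then show ?case using assms by simp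
next
  case (Suc n)
  have "0 \<le> (u - v) * (u ^ n - v ^ n)"
    using assms power_mono[of u v n] power_mono[of v u n]
    by (cases "u \<le> v") (auto intro: mult_nonneg_nonneg mult_nonpos_nonpos)
  then have "0 \<le> l * m * ((u - v) * (u ^ n - v ^ n))"
    using assms by simp
  moreover have "l * u ^ Suc n + m * v ^ Suc n - (l * u + m * v) * (l * u ^ n + m * v ^ n)
      = l * m * ((u - v) * (u ^ n - v ^ n))"
  proof -
    have m: "m = 1 - l" using assms by simp
    show ?thesis unfolding m by (simp add: algebra_simps)
  qed
  ultimately have "(l * u + m * v) * (l * u ^ n + m * v ^ n) \<le> l * u ^ Suc n + m * v ^ Suc n"
    by linarith
  moreover have "(l * u + m * v) * (l * u + m * v) ^ n \<le> (l * u + m * v) * (l * u ^ n + m * v ^ n)"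
    using Suc assms by (intro mult_left_mono) auto
  ultimately show ?case by simp
qed

text \<open>For \<open>p > 0\<close> both functions are scaled to norm 1 and recombined with weights
  proportional to their norms, where convexity of powers applies. For \<open>p = 0\<close> the
  support of a sum lies in the union of the supports.\<close>

lemma fnorm_minkowski: "fnorm p d (\<lambda>i. f i + g i) \<le> fnorm p d f + fnorm p d g"
proof (cases "p = 0")
  case True
  have "(\<Sum>i<d. weight 0 (f i + g i)) \<le> (\<Sum>i<d. weight 0 (f i) + weight 0 (g i))"
    by (intro sum_mono) (simp add: weight_def)
  then show ?thesis
    using True by (simp add: fnorm_def gauge_def sum.distrib)
next
  case p: False
  define A where "A = fnorm p d f"
  define B where "B = fnorm p d g"
  have zero: "\<forall>i<d. h i = 0" if "fnorm p d h = 0" for h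
    using fnorm_power[of p d h] p that by (simp add: power_0_left sum_nonneg_eq_0_iff)
  consider "A = 0" | "B = 0" | "A > 0" "B > 0"
    using fnorm_nonneg[of p d f] fnorm_nonneg[of p d g] unfolding A_def B_def by linarith
  then show ?thesis
  proof cases
    case 1
    then have "fnorm p d (\<lambda>i. f i + g i) = fnorm p d g"
      using zero[of f] by (simp add: A_def fnorm_def)
    then show ?thesis using 1 by (simp add: A_def)
  next
    case 2
    then have "fnorm p d (\<lambda>i. f i + g i) = fnorm p d f"
      using zero[of g] by (simp add: B_def fnorm_def)
    then show ?thesis using 2 by (simp add: B_def)
  next
    case 3
    define l where "l = A / (A + B)"
    define m where "m = B / (A + B)"
    have lm: "0 \<le> l" "0 \<le> m" "l + m = 1"
      using 3 by (auto simp: l_def m_def add_divide_distrib[symmetric])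
    have "(\<Sum>i<d. \<bar>f i + g i\<bar> ^ p)
        \<le> (\<Sum>i<d. (A + B) ^ p * (l * (\<bar>f i\<bar> / A) ^ p + m * (\<bar>g i\<bar> / B) ^ p))"
    proof (intro sum_mono)
      fix i
      have "\<bar>f i + g i\<bar> ^ p \<le> (\<bar>f i\<bar> + \<bar>g i\<bar>) ^ p"
        by (intro power_mono) auto
      also have "\<bar>f i\<bar> + \<bar>g i\<bar> = (A + B) * (l * (\<bar>f i\<bar> / A) + m * (\<bar>g i\<bar> / B))"
      proof -
        have "(A + B) * l = A" "(A + B) * m = B"
          using 3 by (simp_all add: l_def m_def)
        then have "(A + B) * (l * (\<bar>f i\<bar> / A) + m * (\<bar>g i\<bar> / B)) = A * (\<bar>f i\<bar> / A) + B * (\<bar>g i\<bar> / B)"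
          by (simp add: distrib_left mult.assoc[symmetric])
        then show ?thesis using 3 by simp
      qed
      also have "\<dots> ^ p = (A + B) ^ p * (l * (\<bar>f i\<bar> / A) + m * (\<bar>g i\<bar> / B)) ^ p"
        by (rule power_mult_distrib)
      also have "\<dots> \<le> (A + B) ^ p * (l * (\<bar>f i\<bar> / A) ^ p + m * (\<bar>g i\<bar> / B) ^ p)"
        using 3 lm by (intro mult_left_mono power_convex) auto
      finally show "\<bar>f i + g i\<bar> ^ p \<le> \<dots>" .
    qed
    also have "\<dots> = (A + B) ^ p * (l * ((\<Sum>i<d. \<bar>f i\<bar> ^ p) / A ^ p) + m * ((\<Sum>i<d. \<bar>g i\<bar> ^ p) / B ^ p))"
      by (simp only: power_divide sum_distrib_left[symmetric] sum.distrib sum_divide_distrib[symmetric])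
    also have "(\<Sum>i<d. \<bar>f i\<bar> ^ p) / A ^ p = 1"
      using fnorm_power[of p d f] 3 p by (simp add: A_def[symmetric] flip: fnorm_power)
    also have "(\<Sum>i<d. \<bar>g i\<bar> ^ p) / B ^ p = 1"
      using fnorm_power[of p d g] 3 p by (simp add: B_def[symmetric] flip: fnorm_power)
    also have "(A + B) ^ p * (l * 1 + m * 1) = (A + B) ^ p"
      using lm by simp
    finally have "fnorm p d (\<lambda>i. f i + g i) ^ p \<le> (A + B) ^ p"
      using fnorm_power[of p d "\<lambda>i. f i + g i"] p by simp
    then have "fnorm p d (\<lambda>i. f i + g i) \<le> A + B"
      using 3 p fnorm_nonneg[of p d "\<lambda>i. f i + g i"] by (simp add: power_mono_iff)
    then show ?thesis by (simp add: A_def B_def)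
  qed
qed

section \<open>Distances between integer points\<close>

definition pdist :: "nat \<Rightarrow> real list \<Rightarrow> point \<Rightarrow> real" where
  "pdist p c x = lp_norm p (map2 (-) c (map real_of_int x))"

abbreviation idist :: "nat \<Rightarrow> point \<Rightarrow> point \<Rightarrow> real" where
  "idist p x y \<equiv> pdist p (map real_of_int x) y"

lemma pdist_fnorm:
  assumes "length c = d" "length x = d"
  shows "pdist p c x = fnorm p d (\<lambda>i. c ! i - real_of_int (x ! i))"
proof -
  let ?z = "map2 (-) c (map real_of_int x)"
  have z: "?z ! i = c ! i - real_of_int (x ! i)" if "i < d" for i
    using that assms by simp
  show ?thesis
  proof (cases "p = 0")
    case True
    have "real (card {i. i < d \<and> ?z ! i \<noteq> 0}) = (\<Sum>i\<in>{i. i < d \<and> ?z ! i \<noteq> 0}. 1)"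
      by simp
    also have "\<dots> = (\<Sum>i<d. of_bool (c ! i - real_of_int (x ! i) \<noteq> 0))"
      using z by (intro sum.mono_neutral_cong_left) auto
    finally show ?thesis
      using True assms by (simp add: pdist_def lp_norm_def fnorm_def gauge_def weight_def)
  next
    case False
    then show ?thesis
      using assms z by (simp add: pdist_def lp_norm_def fnorm_def gauge_def weight_def)
  qed
qed

lemma idist_fnorm:
  assumes "length x = d" "length y = d"
  shows "idist p x y = fnorm p d (\<lambda>i. real_of_int (x ! i) - real_of_int (y ! i))"
  using assms by (simp add: pdist_fnorm[of _ d] fnorm_def)

lemma pdist_nonneg: "0 \<le> pdist p c x"
  by (simp add: pdist_def lp_norm_def sum_nonneg)

lemma idist_triangle:
  assumes "length c = d" "length x = d" "length y = d"
  shows "idist p x y \<le> pdist p c x + pdist p c y"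
proof -
  have "idist p x y = fnorm p d (\<lambda>i. (real_of_int (x ! i) - c ! i) + (c ! i - real_of_int (y ! i)))"
    using assms by (simp add: pdist_fnorm[of _ d] fnorm_def)
  also have "\<dots> \<le> fnorm p d (\<lambda>i. real_of_int (x ! i) - c ! i) + fnorm p d (\<lambda>i. c ! i - real_of_int (y ! i))"
    by (rule fnorm_minkowski)
  also have "fnorm p d (\<lambda>i. real_of_int (x ! i) - c ! i) = fnorm p d (\<lambda>i. c ! i - real_of_int (x ! i))"
    unfolding fnorm_def using weight_minus[of p "c ! i - real_of_int (x ! i)" for i] by simp
  finally show ?thesis using assms by (simp add: pdist_fnorm[of _ d])
qed

lemma idist_refl [simp]: "idist p x x = 0"
  by (subst pdist_fnorm[of _ "length x"]) (auto simp: fnorm_def)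

lemma idist_ge_1:
  assumes "length x = d" "length y = d" "x \<noteq> y"
  shows "1 \<le> idist p x y"
proof -
  obtain i where i: "i < d" "x ! i \<noteq> y ! i"
    using assms nth_equalityI by metis
  have "1 \<le> weight p (real_of_int (x ! i) - real_of_int (y ! i))"
    using i by (intro weight_ge_1) linarith
  also have "\<dots> \<le> (\<Sum>i<d. weight p (real_of_int (x ! i) - real_of_int (y ! i)))"
    using i by (intro member_le_sum) auto
  finally have "gauge p 1 \<le> gauge p \<dots>" by (rule gauge_mono)
  then show ?thesis using assms by (simp add: pdist_fnorm[of _ d] fnorm_def)
qed

text \<open>The exponent is \<open>max 1 p\<close> because for \<open>p = 0\<close> the distance is
  already the sum of the weights.\<close>

lemma sum_weight_le:
  assumes "length x = d" "length y = d" "idist p x y \<le> real B"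
  shows "(\<Sum>i<d. weight p (real_of_int (x ! i - y ! i))) \<le> real B ^ max 1 p"
proof (cases "p = 0")
  case True
  then show ?thesis using assms by (simp add: pdist_fnorm[of _ d] fnorm_def gauge_def)
next
  case False
  let ?N = "fnorm p d (\<lambda>i. real_of_int (x ! i) - real_of_int (y ! i))"
  have "?N ^ p \<le> real B ^ p"
    using assms by (intro power_mono fnorm_nonneg) (simp add: idist_fnorm[of _ d])
  then show ?thesis using False by (simp add: fnorm_power weight_def max_def)
qed

lemma card_diff_le:
  assumes "length x = d" "length y = d" "idist p x y \<le> real B"
  shows "card {i. i < d \<and> x ! i \<noteq> y ! i} \<le> B ^ max 1 p"
proof -
  have "real (card {i. i < d \<and> x ! i \<noteq> y ! i}) = (\<Sum>i\<in>{i. i < d \<and> x ! i \<noteq> y ! i}. 1)"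
    by simp
  also have "\<dots> \<le> (\<Sum>i\<in>{i. i < d \<and> x ! i \<noteq> y ! i}. weight p (real_of_int (x ! i - y ! i)))"
    by (intro sum_mono weight_ge_1) auto
  also have "\<dots> \<le> (\<Sum>i<d. weight p (real_of_int (x ! i - y ! i)))"
    by (intro sum_mono2) auto
  also have "\<dots> \<le> real B ^ max 1 p" by (rule sum_weight_le[OF assms])
  finally show ?thesis by (metis of_nat_le_iff of_nat_power)
qed

lemma coord_diff_le:
  assumes "length x = d" "length y = d" "idist p x y \<le> real B" "p > 0" "i < d"
  shows "\<bar>x ! i - y ! i\<bar> \<le> int B"
proof -
  have "weight p (real_of_int (x ! i - y ! i)) \<le> (\<Sum>i<d. weight p (real_of_int (x ! i - y ! i)))"
    using assms by (intro member_le_sum) auto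
  also have "\<dots> \<le> real B ^ max 1 p" by (rule sum_weight_le[OF assms(1-3)])
  finally have "\<bar>real_of_int (x ! i - y ! i)\<bar> ^ p \<le> real B ^ p"
    using assms(4) by (simp add: weight_def max_def)
  then have "\<bar>real_of_int (x ! i - y ! i)\<bar> \<le> real B"
    using assms(4) by (simp add: power_mono_iff)
  then show ?thesis by linarith
qed

section \<open>The cost of a cluster\<close>

lemma cost_le:
  assumes "length c = d"
  shows "cost p d T \<le> (\<Sum>x\<in>#T. pdist p c x)"
proof -
  have "0 \<le> (\<Sum>x\<in>#T. pdist p c x)" for c
    by (induction T) (auto simp: pdist_nonneg)
  then show ?thesis
    unfolding cost_def pdist_def[symmetric] using assms
    by (intro cINF_lower bdd_belowI2[of _ 0]) auto
qed

text \<open>Together with \<open>cost_le\<close> this is the interface to the infimum: lower bounds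
  are always argued for an arbitrary center.\<close>

lemma cost_ge:
  assumes "\<And>c. length c = d \<Longrightarrow> L \<le> (\<Sum>x\<in>#T. pdist p c x)"
  shows "L \<le> cost p d T"
  unfolding cost_def pdist_def[symmetric] using assms
  by (intro cINF_greatest) (auto intro: exI[of _ "replicate d 0"])

lemma sum_mset_pdist_nonneg: "0 \<le> (\<Sum>x\<in>#T. pdist p c x)"
  by (induction T) (auto simp: pdist_nonneg)

lemma cost_nonneg: "0 \<le> cost p d T"
  by (rule cost_ge) (rule sum_mset_pdist_nonneg)

text \<open>Distinct \<open>x\<close> and \<open>y\<close> are two separate summands of the cost of
  any center, and the triangle inequality goes through that center.\<close>

lemma idist_le_cost:
  assumes "\<forall>x\<in>#T. length x = d" "x \<in># T" "y \<in># T"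
  shows "idist p x y \<le> cost p d T"
proof (cases "x = y")
  case True
  then show ?thesis by (simp add: cost_nonneg)
next
  case False
  with assms(2,3) obtain T' where T: "T = add_mset x (add_mset y T')"
    by (metis insert_noteq_member multi_member_split)
  show ?thesis
  proof (rule cost_ge)
    fix c :: "real list" assume "length c = d"
    then have "idist p x y \<le> pdist p c x + pdist p c y"
      using assms by (intro idist_triangle) auto
    also have "\<dots> \<le> (\<Sum>x\<in>#T. pdist p c x)"
      using sum_mset_pdist_nonneg[of p c T'] by (simp add: T)
    finally show "idist p x y \<le> (\<Sum>x\<in>#T. pdist p c x)" .
  qed
qed

lemma size_minus_count_le:
  assumes "\<forall>x\<in>#T. length x = d" "length y = d"
  shows "real (size T) - real (count T y) \<le> (\<Sum>z\<in>#T. idist p y z)"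
  using assms
proof (induction T)
  case (add z T)
  then show ?case using idist_ge_1[of y d z p] by auto
qed simp

text \<open>
  Averaging the triangle inequality over all pairs of points of a cheap cluster gives a point
  close to all others; since distinct points have distance at least \<open>1\<close>, it has a majority,
  which makes it an optimal center.
\<close>

lemma cheap_cluster_majority:
  assumes len: "\<forall>x\<in>#T. length x = d" and size: "4 * B < size T" and cost: "cost p d T \<le> real B"
  obtains y where "y \<in># T" "(\<Sum>z\<in>#T. idist p y z) = cost p d T"
    "real (size T) - real (count T y) \<le> cost p d T"
proof -
  define S where "S y = (\<Sum>z\<in>#T. idist p y z)" for y
  have T0: "T \<noteq> {#}" using size by auto
  \<comment> \<open>Summing the triangle inequality over all ordered pairs counts the distance of
    each point to the center \<open>size T\<close> times as first and \<open>size T\<close> times as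
    second point.\<close>
  have avg: "(\<Sum>y\<in>#T. S y) / (2 * real (size T)) \<le> cost p d T"
  proof (rule cost_ge)
    fix c :: "real list" assume c: "length c = d"
    define D where "D = (\<Sum>x\<in>#T. pdist p c x)"
    have "S y \<le> real (size T) * pdist p c y + D" if "y \<in># T" for y
    proof -
      have "S y \<le> (\<Sum>z\<in>#T. pdist p c y + pdist p c z)"
        unfolding S_def using len that c by (intro sum_mset_mono idist_triangle) auto
      then show ?thesis by (simp add: sum_mset.distrib D_def)
    qed
    then have "(\<Sum>y\<in>#T. S y) \<le> (\<Sum>y\<in>#T. real (size T) * pdist p c y + D)"
      by (intro sum_mset_mono) auto
    also have "\<dots> = real (size T) * D + real (size T) * D"
      by (simp add: sum_mset.distrib D_def sum_mset_distrib_left)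
    finally show "(\<Sum>y\<in>#T. S y) / (2 * real (size T)) \<le> (\<Sum>x\<in>#T. pdist p c x)"
      using T0 by (simp add: D_def divide_le_eq nonempty_has_size algebra_simps)
  qed
  have "\<exists>y\<in>#T. S y \<le> 2 * real B"
  proof (rule ccontr)
    assume "\<not> (\<exists>y\<in>#T. S y \<le> 2 * real B)"
    then have *: "\<And>y. y \<in># T \<Longrightarrow> 2 * real B < S y" by force
    obtain y T' where T: "T = add_mset y T'" using T0 multiset_cases by metis
    have "(\<Sum>y\<in>#T'. 2 * real B) \<le> (\<Sum>y\<in>#T'. S y)"
      using * by (intro sum_mset_mono) (auto simp: T intro: less_imp_le)
    then have "real (size T) * (2 * real B) < (\<Sum>y\<in>#T. S y)"
      using *[of y] by (simp add: T algebra_simps)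
    moreover have "(\<Sum>y\<in>#T. S y) \<le> real B * (2 * real (size T))"
      using order.trans[OF avg cost] T0 by (simp add: divide_le_eq nonempty_has_size)
    ultimately show False by (simp add: algebra_simps)
  qed
  then obtain y where y: "y \<in># T" "S y \<le> 2 * real B" by blast
  have ly: "length y = d" using len y by auto
  have "real (size T) - real (count T y) \<le> 2 * real B"
    using size_minus_count_le[OF len ly, of p] y(2) by (simp add: S_def)
  moreover have "4 * real B < real (size T)" using size by linarith
  ultimately have maj: "real (size T) \<le> 2 * real (count T y)" by linarith
  have "S y \<le> cost p d T"
  proof (rule cost_ge)
    fix c :: "real list" assume c: "length c = d"
    \<comment> \<open>Moving the center from \<open>c\<close> to \<open>y\<close> saves
      \<open>pdist p c y\<close> on each copy of \<open>y\<close> and loses at most this much on any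
      other point. A majority makes the total change nonpositive.\<close>
    have "(\<Sum>z\<in>#U. idist p y z) \<le> (\<Sum>z\<in>#U. pdist p c z)
        + (real (size U) - 2 * real (count U y)) * pdist p c y"
      if "\<forall>x\<in>#U. length x = d" for U
      using that
    proof (induction U)
      case (add z U)
      show ?case
      proof (cases "z = y")
        case True
        then show ?thesis using add by (simp add: algebra_simps)
      next
        case False
        then show ?thesis
          using add idist_triangle[of c d y z p] c ly by (auto simp: algebra_simps)
      qed
    qed simp
    from this[OF len] have "S y \<le> (\<Sum>z\<in>#T. pdist p c z)
        + (real (size T) - 2 * real (count T y)) * pdist p c y"
      by (simp add: S_def)
    moreover have "(real (size T) - 2 * real (count T y)) * pdist p c y \<le> 0"
      using maj pdist_nonneg[of p c y] by (simp add: mult_nonpos_nonneg)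
    ultimately show "S y \<le> (\<Sum>x\<in>#T. pdist p c x)" by linarith
  qed
  moreover have "cost p d T \<le> S y"
    unfolding S_def using ly by (intro cost_le) simp
  ultimately have "S y = cost p d T" by simp
  with y size_minus_count_le[OF len ly, of p] show thesis
    by (intro that[of y]) (auto simp: S_def)
qed

text \<open>
  A center for \<open>g\<close> is turned, coordinate by coordinate, into one for \<open>f\<close> that is at least as
  good.  For \<open>p = 0\<close> a coordinate of the center matters only if some point attains it.
\<close>

lemma cost_image_le:
  fixes f g :: "'a \<Rightarrow> point"
  assumes len: "\<forall>a\<in>#T. length (f a) = d'" "\<forall>a\<in>#T. length (g a) = d"
    and J: "J \<subseteq> {..<d'}" "inj_on t J" "t ` J \<subseteq> {..<d}"
    and const: "\<And>j a b. j < d' \<Longrightarrow> j \<notin> J \<Longrightarrow> a \<in># T \<Longrightarrow> b \<in># T \<Longrightarrow> f a ! j = f b ! j"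
    and zero: "\<And>j a b. p = 0 \<Longrightarrow> j \<in> J \<Longrightarrow> a \<in># T \<Longrightarrow> b \<in># T \<Longrightarrow>
      g a ! t j = g b ! t j \<Longrightarrow> f a ! j = f b ! j"
    and pos: "\<And>j a b. p > 0 \<Longrightarrow> j \<in> J \<Longrightarrow> a \<in># T \<Longrightarrow> b \<in># T \<Longrightarrow>
      f a ! j - f b ! j = g a ! t j - g b ! t j"
  shows "cost p d' (image_mset f T) \<le> cost p d (image_mset g T)"
proof (rule cost_ge)
  fix c :: "real list" assume c: "length c = d"
  have 1: "\<exists>r. \<forall>a\<in>#T. weight p (r - real_of_int (f a ! j)) \<le> weight p (c ! t j - real_of_int (g a ! t j))"
    if j: "j \<in> J" for j
  proof (cases "p = 0")
    case True
    show ?thesis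
    proof (cases "\<exists>b\<in>#T. c ! t j = real_of_int (g b ! t j)")
      case True
      then obtain b where b: "b \<in># T" "c ! t j = real_of_int (g b ! t j)" by blast
      have "weight p (real_of_int (f b ! j) - real_of_int (f a ! j))
          \<le> weight p (c ! t j - real_of_int (g a ! t j))" if "a \<in># T" for a
      proof (cases "g b ! t j = g a ! t j")
        case True
        with zero[OF \<open>p = 0\<close> j b(1) that] show ?thesis by simp
      next
        case False
        with b(2) \<open>p = 0\<close> show ?thesis by (simp add: weight_def)
      qed
      then show ?thesis by blast
    next
      \<comment> \<open>If no point attains this coordinate of \<open>c\<close>, all weights on the
        right are 1 and any value of \<open>r\<close> will do.\<close>
      case False
      with \<open>p = 0\<close> show ?thesis by (auto simp: weight_def)
    qed
  next
    case False
    show ?thesis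
    proof (cases "T = {#}")
      case False
      \<comment> \<open>The new coordinate lies relative to \<open>f b\<close> as that of
        \<open>c\<close> lies relative to \<open>g b\<close>; by \<open>pos\<close> this is then so
        for every \<open>a\<close>.\<close>
      then obtain b where b: "b \<in># T" by blast
      have "c ! t j - real_of_int (g b ! t j) + real_of_int (f b ! j) - real_of_int (f a ! j)
          = c ! t j - real_of_int (g a ! t j)" if "a \<in># T" for a
      proof -
        have "real_of_int (f b ! j - f a ! j) = real_of_int (g b ! t j - g a ! t j)"
          using pos[OF _ j b that] \<open>p \<noteq> 0\<close> by simp
        then show ?thesis by simp
      qed
      from this[THEN arg_cong[where f = "weight p"], THEN eq_refl] show ?thesis by blast
    qed simp
  qed
  have 2: "\<exists>r. \<forall>a\<in>#T. weight p (r - real_of_int (f a ! j)) \<le> 0" if j: "j < d'" "j \<notin> J" for j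
  proof (cases "T = {#}")
    case False
    then obtain b where b: "b \<in># T" by blast
    have "weight p (real_of_int (f b ! j) - real_of_int (f a ! j)) \<le> 0" if "a \<in># T" for a
      using const[OF j b that] by simp
    then show ?thesis by blast
  qed simp
  define u where "u a j = (if j \<in> J then weight p (c ! t j - real_of_int (g a ! t j)) else 0)" for a j
  have "\<exists>r. \<forall>a\<in>#T. weight p (r - real_of_int (f a ! j)) \<le> u a j" if "j < d'" for j
    using 1[of j] 2[OF that] by (cases "j \<in> J") (simp_all add: u_def)
  then obtain r where r: "\<And>j a. j < d' \<Longrightarrow> a \<in># T \<Longrightarrow> weight p (r j - real_of_int (f a ! j)) \<le> u a j"
    by metis
  let ?c = "map r [0..<d']"
  have "pdist p ?c (f a) \<le> pdist p c (g a)" if a: "a \<in># T" for a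
  proof -
    have "(\<Sum>j<d'. weight p (?c ! j - real_of_int (f a ! j))) \<le> (\<Sum>j<d'. u a j)"
      using r[OF _ a] by (intro sum_mono) auto
    also have "\<dots> = (\<Sum>j\<in>J. weight p (c ! t j - real_of_int (g a ! t j)))"
      using J(1) unfolding u_def by (subst sum.inter_restrict[symmetric]) (auto intro: sum.cong)
    also have "\<dots> = (\<Sum>i\<in>t ` J. weight p (c ! i - real_of_int (g a ! i)))"
      using J(2) by (simp add: sum.reindex)
    also have "\<dots> \<le> (\<Sum>i<d. weight p (c ! i - real_of_int (g a ! i)))"
      using J(3) by (intro sum_mono2) auto
    finally show ?thesis
      using len a c by (simp add: pdist_fnorm[of _ d'] pdist_fnorm[of _ d] fnorm_def gauge_mono)
  qed
  then have "(\<Sum>a\<in>#T. pdist p ?c (f a)) \<le> (\<Sum>a\<in>#T. pdist p c (g a))"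
    by (rule sum_mset_mono)
  moreover have "cost p d' (image_mset f T) \<le> (\<Sum>x\<in>#image_mset f T. pdist p ?c x)"
    by (rule cost_le) simp
  ultimately show "cost p d' (image_mset f T) \<le> (\<Sum>x\<in>#image_mset g T. pdist p c x)"
    by (simp add: image_mset.compositionality comp_def)
qed

section \<open>Partitions into clusters of equal size\<close>

lemma image_mset_sum: "image_mset f (\<Sum>i<k. C i) = (\<Sum>i<k. image_mset f (C i))"
  for k :: nat and C :: "nat \<Rightarrow> 'a multiset"
  by (induction k) auto

lemma size_mset_sum: "size (\<Sum>i<k. C i) = (\<Sum>i<k. size (C i))"
  for k :: nat and C :: "nat \<Rightarrow> 'a multiset"
  by (induction k) auto

lemma subset_mset_sum: "i < k \<Longrightarrow> C i \<subseteq># (\<Sum>i<k. C i)"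
  for k :: nat and C :: "nat \<Rightarrow> 'a multiset"
  by (subst sum.remove[of _ i]) auto

lemma equal_clusteringI:
  assumes "(\<Sum>i<k. C i) = X" "\<And>i. i < k \<Longrightarrow> size (C i) = s" "(\<Sum>i<k. cost p d (C i)) \<le> real B" "k > 0"
  shows "equal_clustering p d X k B"
proof -
  have "size X = (\<Sum>i<k. size (C i))"
    unfolding assms(1)[symmetric] by (rule size_mset_sum)
  then have "size X div k = s" using assms(2,4) by simp
  with assms show ?thesis unfolding equal_clustering_def by (intro exI[of _ C]) auto
qed

lemma equal_clusteringE:
  assumes "equal_clustering p d X k B" "k > 0" "size X = k * s"
  obtains C where "(\<Sum>i<k. C i) = X" "\<And>i. i < k \<Longrightarrow> size (C i) = s" "(\<Sum>i<k. cost p d (C i)) \<le> real B"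
  using assms unfolding equal_clustering_def by auto

lemma cluster_cost_le:
  fixes k :: nat
  assumes "(\<Sum>i<k. cost p d (C i)) \<le> real B" "i < k"
  shows "cost p d (C i) \<le> real B"
proof -
  have "cost p d (C i) \<le> (\<Sum>i<k. cost p d (C i))"
    using assms(2) by (intro member_le_sum) (auto simp: cost_nonneg)
  with assms(1) show ?thesis by simp
qed

text \<open>\<open>Z\<close> indexes both instances: clusters of the \<open>g\<close>-image are
  pulled back along the inverse of \<open>g\<close> and pushed forward by \<open>f\<close>. Taking
  the identity for one map and the reduction for the other, in both orders, yields an
  equivalence.\<close>

lemma equal_clustering_image:
  assumes inj: "inj_on g (set_mset Z)"
    and yes: "equal_clustering p d (image_mset g Z) k B" "k > 0" "size Z = k * s"
    and cost: "\<And>T. T \<subseteq># Z \<Longrightarrow> cost p d (image_mset g T) \<le> real B \<Longrightarrow>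
      cost p d' (image_mset f T) \<le> cost p d (image_mset g T)"
  shows "equal_clustering p d' (image_mset f Z) k B"
proof -
  from yes obtain C where C: "(\<Sum>i<k. C i) = image_mset g Z" "\<And>i. i < k \<Longrightarrow> size (C i) = s"
    "(\<Sum>i<k. cost p d (C i)) \<le> real B"
    by (elim equal_clusteringE[where s = s]) auto
  define h where "h = inv_into (set_mset Z) g"
  define T where "T i = image_mset h (C i)" for i
  have "(\<Sum>i<k. T i) = image_mset h (image_mset g Z)"
    unfolding T_def C(1)[symmetric] by (rule image_mset_sum[symmetric])
  also have "\<dots> = image_mset (h \<circ> g) Z"
    by (simp add: image_mset.compositionality)
  also have "\<dots> = image_mset id Z"
    using inj by (intro image_mset_cong) (simp add: h_def)
  finally have sum: "(\<Sum>i<k. T i) = Z" by simp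
  have gT: "image_mset g (T i) = C i" if "i < k" for i
  proof -
    have "set_mset (C i) \<subseteq> g ` set_mset Z"
      using set_mset_mono[OF subset_mset_sum[OF that, of C]] C(1) by simp
    then have "image_mset (g \<circ> h) (C i) = image_mset id (C i)"
      by (intro image_mset_cong) (auto simp: h_def f_inv_into_f subset_iff)
    then show ?thesis by (simp add: T_def image_mset.compositionality)
  qed
  show ?thesis
  proof (rule equal_clusteringI)
    show "(\<Sum>i<k. image_mset f (T i)) = image_mset f Z"
      using image_mset_sum[of f T k] sum by simp
    show "size (image_mset f (T i)) = s" if "i < k" for i
      using C(2)[OF that] by (simp add: T_def)
    have "(\<Sum>i<k. cost p d' (image_mset f (T i))) \<le> (\<Sum>i<k. cost p d (C i))"
    proof (intro sum_mono)
      fix i assume "i \<in> {..<k}"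
      then have i: "i < k" by simp
      have "cost p d' (image_mset f (T i)) \<le> cost p d (image_mset g (T i))"
        using subset_mset_sum[OF i, of T] cluster_cost_le[OF C(3) i]
        by (intro cost) (simp_all add: sum gT[OF i])
      then show "cost p d' (image_mset f (T i)) \<le> cost p d (C i)" by (simp add: gT[OF i])
    qed
    with C(3) show "(\<Sum>i<k. cost p d' (image_mset f (T i))) \<le> real B" by simp
  qed (fact yes)
qed

section \<open>Large clusters\<close>

text \<open>Each exception to a majority costs at least 1, so all clusters together have at most
  \<open>B\<close> of them. Adding \<open>B\<close> to a multiplicity turns its error, between
  \<open>-B\<close> and \<open>B\<close>, into a remainder between 0 and \<open>2 * B\<close>, which
  is below \<open>s\<close>.\<close>

lemma clustering_majorities:
  fixes k :: nat
  assumes C: "\<And>i. i < k \<Longrightarrow> size (C i) = s" "(\<Sum>i<k. cost p d (C i)) \<le> real B"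
    and s: "4 * B < s" and len: "\<And>x. x \<in># (\<Sum>i<k. C i) \<Longrightarrow> length x = d"
  obtains y where "\<And>i. i < k \<Longrightarrow> length (y i) = d"
    "\<And>i. i < k \<Longrightarrow> (\<Sum>z\<in>#C i. idist p (y i) z) = cost p d (C i)"
    "\<And>i. i < k \<Longrightarrow> s \<le> count (C i) (y i) + B"
    "\<And>x. (count (\<Sum>i<k. C i) x + B) div s = card {i. i < k \<and> y i = x}"
    "\<And>x. (count (\<Sum>i<k. C i) x + B) mod s \<le> 2 * B"
proof -
  have lenC: "\<forall>x\<in>#C i. length x = d" if "i < k" for i
    using len set_mset_mono[OF subset_mset_sum[OF that, of C]] by auto
  have "\<exists>y. y \<in># C i \<and> (\<Sum>z\<in>#C i. idist p y z) = cost p d (C i) \<and>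
      real s - real (count (C i) y) \<le> cost p d (C i)" if i: "i < k" for i
    using cheap_cluster_majority[OF lenC[OF i] _ cluster_cost_le[OF C(2) i]] C(1)[OF i] s by metis
  then obtain y where y: "\<And>i. i < k \<Longrightarrow> y i \<in># C i"
    "\<And>i. i < k \<Longrightarrow> (\<Sum>z\<in>#C i. idist p (y i) z) = cost p d (C i)"
    "\<And>i. i < k \<Longrightarrow> real s - real (count (C i) (y i)) \<le> cost p d (C i)"
    by metis
  define e where "e i = s - count (C i) (y i)" for i
  have "real (\<Sum>i<k. e i) \<le> (\<Sum>i<k. cost p d (C i))"
    unfolding of_nat_sum using y(3) cost_nonneg by (intro sum_mono) (auto simp: e_def of_nat_diff_if)
  with C(2) have e: "(\<Sum>i<k. e i) \<le> B" by linarith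
  have le_s: "count (C i) x \<le> s" if "i < k" for i x
    using C(1)[OF that] count_le_size[of "C i" x] by simp
  have other: "count (C i) x \<le> e i" if "i < k" "y i \<noteq> x" for i x
  proof -
    have "count U x + count U z \<le> size U" if "z \<noteq> x" for U z
      using that by (induction U) auto
    from this[OF that(2), of "C i"] show ?thesis using C(1)[OF that(1)] by (simp add: e_def)
  qed
  have key: "card {i. i < k \<and> y i = x} * s \<le> count (\<Sum>i<k. C i) x + B \<and>
      count (\<Sum>i<k. C i) x \<le> card {i. i < k \<and> y i = x} * s + B" for x
  proof -
    have "card {i. i < k \<and> y i = x} * s = (\<Sum>i\<in>{i. i < k \<and> y i = x}. s)" by simp
    also have "\<dots> = (\<Sum>i<k. if y i = x then s else 0)"
      by (intro sum.mono_neutral_cong_left) auto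
    finally have card: "card {i. i < k \<and> y i = x} * s = (\<Sum>i<k. if y i = x then s else 0)" .
    have "(\<Sum>i<k. if y i = x then s else 0) \<le> (\<Sum>i<k. count (C i) x + e i)"
      using le_s by (intro sum_mono) (auto simp: e_def)
    moreover have "(\<Sum>i<k. count (C i) x) \<le> (\<Sum>i<k. (if y i = x then s else 0) + e i)"
      using le_s other by (intro sum_mono) (auto intro: trans_le_add1)
    ultimately show ?thesis using e by (simp add: card sum.distrib count_sum)
  qed
  have div: "(count (\<Sum>i<k. C i) x + B) div s = card {i. i < k \<and> y i = x}"
    "(count (\<Sum>i<k. C i) x + B) mod s \<le> 2 * B" for x
  proof -
    define c where "c = card {i. i < k \<and> y i = x}"
    define r where "r = count (\<Sum>i<k. C i) x + B - c * s"
    have r: "count (\<Sum>i<k. C i) x + B = c * s + r" "r \<le> 2 * B"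
      using key[of x] unfolding r_def c_def by linarith+
    then have "r < s" using s by simp
    with r show "(count (\<Sum>i<k. C i) x + B) div s = card {i. i < k \<and> y i = x}"
      "(count (\<Sum>i<k. C i) x + B) mod s \<le> 2 * B"
      by (simp_all add: c_def)
  qed
  show thesis
  proof (rule that)
    show "s \<le> count (C i) (y i) + B" if "i < k" for i
    proof -
      have "e i \<le> (\<Sum>i<k. e i)" using that by (intro member_le_sum) auto
      with e show ?thesis by (simp add: e_def)
    qed
    show "length (y i) = d" if "i < k" for i using y(1)[OF that] lenC[OF that] by blast
  qed (fact y(2) div)+
qed

text \<open>
  A point that is the majority of exactly \<open>q\<close> clusters of size \<open>s\<close> has multiplicity \<open>q s\<close> up to an
  error of \<open>B\<close>, so that \<open>q\<close> can be read off.
\<close>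

lemma equal_clustering_shrink:
  assumes size: "size X = k * s" and k: "k > 0" and s: "4 * B < s'" "s' \<le> s"
    and len: "\<And>x. x \<in># X \<Longrightarrow> length x = d"
    and X': "\<And>x. count X' x = count X x - (count X x + B) div s * (s - s')"
  shows "equal_clustering p d X k B \<longleftrightarrow>
    (\<forall>x\<in>#X. (count X x + B) mod s \<le> 2 * B) \<and> size X' = k * s' \<and> equal_clustering p d X' k B"
proof (intro iffI conjI; (elim conjE)?)
  assume "equal_clustering p d X k B"
  then obtain C where C: "(\<Sum>i<k. C i) = X" "\<And>i. i < k \<Longrightarrow> size (C i) = s"
    "(\<Sum>i<k. cost p d (C i)) \<le> real B"
    using k size by (rule equal_clusteringE) blast
  have "4 * B < s" using s by simp
  note maj = clustering_majorities[OF C(2,3) this, unfolded C(1), OF _ len]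
  obtain y where y:
    "\<And>i. i < k \<Longrightarrow> length (y i) = d"
    "\<And>i. i < k \<Longrightarrow> (\<Sum>z\<in>#C i. idist p (y i) z) = cost p d (C i)"
    "\<And>i. i < k \<Longrightarrow> s \<le> count (C i) (y i) + B"
    "\<And>x. (count X x + B) div s = card {i. i < k \<and> y i = x}"
    "\<And>x. (count X x + B) mod s \<le> 2 * B"
    by (rule maj) blast+
  show "\<forall>x\<in>#X. (count X x + B) mod s \<le> 2 * B" using y(5) by blast
  define R where "R i = replicate_mset (s - s') (y i)" for i
  \<comment> \<open>The majority occurs at least \<open>s - B\<close> times and
    \<open>B < s'\<close>, so there are enough copies to remove.\<close>
  have RC: "R i \<subseteq># C i" if "i < k" for i
    using y(3)[OF that] s by (auto simp: R_def count_le_replicate_mset_subset_eq[symmetric])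
  have sum: "(\<Sum>i<k. C i - R i) = X'"
  proof (rule multiset_eqI)
    fix x
    have "count (\<Sum>i<k. C i - R i) x = (\<Sum>i<k. count (C i) x - count (R i) x)"
      by (simp add: count_sum)
    also have "\<dots> = (\<Sum>i<k. count (C i) x) - (\<Sum>i<k. count (R i) x)"
      using RC by (intro sum_subtractf_nat) (auto intro: mset_subset_eq_count)
    also have "(\<Sum>i<k. count (C i) x) = count X x"
      unfolding C(1)[symmetric] by (simp add: count_sum)
    also have "(\<Sum>i<k. count (R i) x) = (\<Sum>i\<in>{i. i < k \<and> y i = x}. s - s')"
      by (intro sum.mono_neutral_cong_right) (auto simp: R_def)
    also have "\<dots> = (count X x + B) div s * (s - s')"
      by (simp add: y(4))
    finally show "count (\<Sum>i<k. C i - R i) x = count X' x" by (simp add: X')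
  qed
  have sz: "size (C i - R i) = s'" if "i < k" for i
    using C(2)[OF that] RC[OF that] s by (simp add: size_Diff_submset) (simp add: R_def)
  show "size X' = k * s'"
    using sz unfolding sum[symmetric] by (simp add: size_mset_sum)
  have "cost p d (C i - R i) \<le> cost p d (C i)" if i: "i < k" for i
  proof -
    have "cost p d (C i - R i) \<le> (\<Sum>z\<in>#C i - R i. idist p (y i) z)"
      using y(1)[OF i] by (intro cost_le) simp
    also have "\<dots> \<le> (\<Sum>z\<in>#(C i - R i) + R i. idist p (y i) z)"
      using sum_mset_pdist_nonneg[of p _ "R i"] by simp
    also have "\<dots> = cost p d (C i)"
      using RC[OF i] y(2)[OF i] by simp
    finally show ?thesis .
  qed
  then have "(\<Sum>i<k. cost p d (C i - R i)) \<le> (\<Sum>i<k. cost p d (C i))"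
    by (intro sum_mono) auto
  with sum sz C(3) k show "equal_clustering p d X' k B"
    by (intro equal_clusteringI[where C = "\<lambda>i. C i - R i"]) auto
next
  assume bal: "\<forall>x\<in>#X. (count X x + B) mod s \<le> 2 * B" and size': "size X' = k * s'"
    and "equal_clustering p d X' k B"
  from this(3) k size' obtain C where C: "(\<Sum>i<k. C i) = X'" "\<And>i. i < k \<Longrightarrow> size (C i) = s'"
    "(\<Sum>i<k. cost p d (C i)) \<le> real B"
    by (rule equal_clusteringE) blast
  have "count X' x \<le> count X x" for x by (simp add: X')
  then have "X' \<subseteq># X" by (intro mset_subset_eqI)
  then have len': "length x = d" if "x \<in># X'" for x
    using len that by (meson mset_subset_eqD)
  note maj = clustering_majorities[OF C(2,3) s(1), unfolded C(1), OF _ len']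
  obtain y where y:
    "\<And>i. i < k \<Longrightarrow> length (y i) = d"
    "\<And>i. i < k \<Longrightarrow> (\<Sum>z\<in>#C i. idist p (y i) z) = cost p d (C i)"
    "\<And>x. (count X' x + B) div s' = card {i. i < k \<and> y i = x}"
    by (rule maj) blast+
  define R where "R i = replicate_mset (s - s') (y i)" for i
  have sum: "(\<Sum>i<k. C i + R i) = X"
  proof (rule multiset_eqI)
    fix x
    define q where "q = (count X x + B) div s"
    define r where "r = (count X x + B) mod s"
    have m: "count X x + B = q * s + r"
      by (simp add: q_def r_def)
    have r: "r \<le> 2 * B"
    proof (cases "x \<in># X")
      case False
      then have "r \<le> B" by (simp add: r_def not_in_iff)
      then show ?thesis by simp
    qed (use bal r_def in blast)
    have qs: "q * s = q * s' + q * (s - s')"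
      using s by (simp add: distrib_left[symmetric])
    \<comment> \<open>The truncated subtraction defining \<open>X'\<close> is exact: for
      \<open>q > 0\<close> the part \<open>q * s'\<close> that stays exceeds the added
      \<open>B\<close>.\<close>
    have le: "q * (s - s') \<le> count X x"
    proof (cases q)
      case (Suc q')
      then have "s' \<le> q * s'" by simp
      then show ?thesis using m qs s by linarith
    qed simp
    have X'x: "count X' x = count X x - q * (s - s')"
      unfolding X' q_def by (rule refl)
    then have "count X' x + B = q * s' + r"
      using m qs le by linarith
    \<comment> \<open>The remainder is unchanged and still below \<open>s'\<close>, so the number of
      dominated clusters read off \<open>X'\<close> agrees with the one read off
      \<open>X\<close>.\<close>
    then have q: "(count X' x + B) div s' = q"
      using r s by simp
    have "count (\<Sum>i<k. C i + R i) x = count X' x + (\<Sum>i<k. count (R i) x)"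
      unfolding C(1)[symmetric] by (simp add: count_sum sum.distrib)
    also have "(\<Sum>i<k. count (R i) x) = (\<Sum>i\<in>{i. i < k \<and> y i = x}. s - s')"
      by (intro sum.mono_neutral_cong_right) (auto simp: R_def)
    also have "\<dots> = q * (s - s')"
      using y(3)[of x] by (simp add: q)
    also have "count X' x + q * (s - s') = count X x"
      using le X'x by simp
    finally show "count (\<Sum>i<k. C i + R i) x = count X x" .
  qed
  \<comment> \<open>The added copies sit at the center, at distance zero.\<close>
  have "cost p d (C i + R i) \<le> cost p d (C i)" if i: "i < k" for i
  proof -
    have "cost p d (C i + R i) \<le> (\<Sum>z\<in>#C i + R i. idist p (y i) z)"
      using y(1)[OF i] by (intro cost_le) simp
    also have "\<dots> = cost p d (C i)"
      using y(2)[OF i] by (simp add: R_def)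
    finally show ?thesis .
  qed
  then have "(\<Sum>i<k. cost p d (C i + R i)) \<le> (\<Sum>i<k. cost p d (C i))"
    by (intro sum_mono) auto
  with sum C s k show "equal_clustering p d X k B"
    by (intro equal_clusteringI[where C = "\<lambda>i. C i + R i" and s = s]) (auto simp: R_def)
qed

section \<open>Compressing one coordinate\<close>

text \<open>
  \<open>squeeze\<close> shortens every gap longer than \<open>B + 1\<close> between consecutive values in \<open>vs\<close> to \<open>B + 1\<close>,
  so that differences up to \<open>B\<close> are kept and larger ones stay larger than \<open>B\<close>.
\<close>

definition gap :: "nat \<Rightarrow> int list \<Rightarrow> int \<Rightarrow> int" where
  "gap B vs w = para (\<lambda>v _ r. if w < v \<and> v - w < r then v - w else r) (int (Suc B)) vs"

text \<open>\<open>gap\<close> is the distance to the next larger entry of \<open>vs\<close>, capped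
  at \<open>B + 1\<close>. For an entry \<open>v\<close>, the sum telescopes to its distance from
  the smallest entry as long as no cap takes effect.\<close>

definition squeeze :: "nat \<Rightarrow> int list \<Rightarrow> int \<Rightarrow> int" where
  "squeeze B vs v = (\<Sum>w\<leftarrow>filter (\<lambda>w. w < v) (remdups vs). gap B vs w)"

lemma gap_le: "gap B vs w \<le> int (Suc B)"
  unfolding gap_def by (induction vs) auto

lemma gap_pos: "1 \<le> gap B vs w"
  unfolding gap_def by (induction vs) auto

lemma gap_le_diff: "v \<in> set vs \<Longrightarrow> w < v \<Longrightarrow> gap B vs w \<le> v - w"
  unfolding gap_def by (induction vs) auto

lemma gap_cases: "gap B vs w = int (Suc B) \<or> (\<exists>v\<in>set vs. w < v \<and> gap B vs w = v - w)"
  unfolding gap_def by (induction vs) auto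

lemma squeeze_sum: "squeeze B vs v = (\<Sum>w\<in>{w \<in> set vs. w < v}. gap B vs w)"
proof -
  have "squeeze B vs v = (\<Sum>w\<in>set (filter (\<lambda>w. w < v) (remdups vs)). gap B vs w)"
    unfolding squeeze_def by (intro sum_list_distinct_conv_sum_set distinct_filter distinct_remdups)
  then show ?thesis by simp
qed

lemma squeeze_nonneg: "0 \<le> squeeze B vs v"
  unfolding squeeze_sum using gap_pos by (intro sum_nonneg) (meson order.trans zero_le_one)

lemma squeeze_le: "squeeze B vs v \<le> int (length vs * Suc B)"
proof -
  have "squeeze B vs v \<le> (\<Sum>w\<in>set vs. gap B vs w)"
    unfolding squeeze_sum using gap_pos by (intro sum_mono2) (auto intro: order.trans[OF zero_le_one])
  also have "\<dots> \<le> (\<Sum>w\<in>set vs. int (Suc B))"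
    by (intro sum_mono gap_le)
  also have "\<dots> = int (card (set vs) * Suc B)" by (simp add: distrib_left)
  also have "\<dots> \<le> int (length vs * Suc B)"
    unfolding of_nat_le_iff by (intro mult_le_mono card_length) simp
  finally show ?thesis .
qed

text \<open>Both bounds add up along intermediate entries, which leaves consecutive entries, where
  the difference is a single gap.\<close>

lemma squeeze_diff:
  assumes "v \<in> set vs" "v' \<in> set vs" "v < v'"
  shows "squeeze B vs v' - squeeze B vs v \<le> v' - v"
    "min (int (Suc B)) (v' - v) \<le> squeeze B vs v' - squeeze B vs v"
proof -
  have *: "squeeze B vs v' - squeeze B vs v = (\<Sum>w\<in>{w \<in> set vs. v \<le> w \<and> w < v'}. gap B vs w)"
    if "v < v'" for v v'
  proof -
    have split: "{w \<in> set vs. w < v'} = {w \<in> set vs. w < v} \<union> {w \<in> set vs. v \<le> w \<and> w < v'}"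
      using that by auto
    have "squeeze B vs v' = squeeze B vs v + (\<Sum>w\<in>{w \<in> set vs. v \<le> w \<and> w < v'}. gap B vs w)"
      unfolding squeeze_sum by (subst split) (intro sum.union_disjoint; auto)
    then show ?thesis by simp
  qed
  have "squeeze B vs v' - squeeze B vs v \<le> v' - v \<and>
      min (int (Suc B)) (v' - v) \<le> squeeze B vs v' - squeeze B vs v"
    using assms
  proof (induction "nat (v' - v)" arbitrary: v v' rule: less_induct)
    case less
    show ?case
    proof (cases "\<exists>u\<in>set vs. v < u \<and> u < v'")
      case True
      then obtain u where u: "u \<in> set vs" "v < u" "u < v'" by blast
      have "squeeze B vs u - squeeze B vs v \<le> u - v \<and>
          min (int (Suc B)) (u - v) \<le> squeeze B vs u - squeeze B vs v"
        using u less.prems by (intro less.hyps) auto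
      moreover have "squeeze B vs v' - squeeze B vs u \<le> v' - u \<and>
          min (int (Suc B)) (v' - u) \<le> squeeze B vs v' - squeeze B vs u"
        using u less.prems by (intro less.hyps) auto
      ultimately show ?thesis using u by linarith
    next
      case False
      then have "{w \<in> set vs. v \<le> w \<and> w < v'} = {v}"
        using less.prems by force
      then have "squeeze B vs v' - squeeze B vs v = gap B vs v"
        using *[OF less.prems(3)] by simp
      moreover have "gap B vs v \<le> v' - v"
        using less.prems by (intro gap_le_diff)
      moreover have "min (int (Suc B)) (v' - v) \<le> gap B vs v"
        using gap_cases[of B vs v] False by force
      ultimately show ?thesis by simp
    qed
  qed
  then show "squeeze B vs v' - squeeze B vs v \<le> v' - v"
    "min (int (Suc B)) (v' - v) \<le> squeeze B vs v' - squeeze B vs v" by auto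
qed

lemma squeeze_close:
  assumes "v \<in> set vs" "v' \<in> set vs" "\<bar>v - v'\<bar> \<le> int B"
  shows "squeeze B vs v - squeeze B vs v' = v - v'"
proof (cases v v' rule: linorder_cases)
  case less
  with squeeze_diff[OF assms(1,2) less, of B] assms(3) show ?thesis by linarith
next
  case greater
  with squeeze_diff[OF assms(2,1) greater, of B] assms(3) show ?thesis by linarith
qed simp

text \<open>With \<open>squeeze_close\<close>: a difference of at most \<open>B\<close>, whether
  before or after squeezing, is preserved exactly. This serves the two directions of the
  equivalence.\<close>

lemma squeeze_close_converse:
  assumes "v \<in> set vs" "v' \<in> set vs" "\<bar>squeeze B vs v - squeeze B vs v'\<bar> \<le> int B"
  shows "squeeze B vs v - squeeze B vs v' = v - v'"
proof (cases v v' rule: linorder_cases)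
  case less
  with squeeze_diff[OF assms(1,2) less, of B] assms(3) show ?thesis by linarith
next
  case greater
  with squeeze_diff[OF assms(2,1) greater, of B] assms(3) show ?thesis by linarith
qed simp

section \<open>Reducing the dimension\<close>

text \<open>List access in a form whose running time is covered by \<open>ptime_drop\<close> and
  \<open>ptime_case_list_zero\<close>.\<close>

definition coord :: "point \<Rightarrow> nat \<Rightarrow> int" where
  "coord x i = (case drop i x of [] \<Rightarrow> 0 | z # _ \<Rightarrow> z)"

definition hamming :: "nat list \<Rightarrow> point \<Rightarrow> point \<Rightarrow> nat" where
  "hamming I x y = length (filter (\<lambda>i. coord x i \<noteq> coord y i) I)"

text \<open>
  Points of one cluster agree in all coordinates that are not marked.  These coordinates therefore
  only separate points, and \<open>B + 1\<close> copies of a label multiplied by \<open>B + 1\<close> do the same, also for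
  \<open>p = 0\<close>.  If there are at most \<open>B\<close> of them, they are treated like marked ones instead.
\<close>

definition marked :: "nat list \<Rightarrow> nat \<Rightarrow> point list \<Rightarrow> nat \<Rightarrow> bool" where
  "marked I H ps i \<longleftrightarrow> (\<exists>x\<in>set ps. \<exists>y\<in>set ps. hamming I x y \<le> H \<and> coord x i \<noteq> coord y i)"

definition unmarked :: "nat list \<Rightarrow> nat \<Rightarrow> point list \<Rightarrow> nat list" where
  "unmarked I H ps = filter (\<lambda>i. \<not> marked I H ps i) I"

text \<open>The length of the suffix starting at the first point that agrees with \<open>x\<close>
  on \<open>U\<close>. It identifies the class of \<open>x\<close> by a number of at most
  \<open>length ps\<close>.\<close>

definition label :: "point list \<Rightarrow> nat list \<Rightarrow> point \<Rightarrow> nat" where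
  "label ps U x = length (dropWhile (\<lambda>y. map (coord y) U \<noteq> map (coord x) U) ps)"

text \<open>Of the unmarked indices the last \<open>B + 1\<close> are kept, or all of them if there
  are fewer.\<close>

definition kept_coords :: "nat list \<Rightarrow> nat \<Rightarrow> nat \<Rightarrow> point list \<Rightarrow> nat list" where
  "kept_coords I H B ps =
    sfilter (\<lambda>i js. marked I H ps i \<or> length (filter (\<lambda>j. \<not> marked I H ps j) js) \<le> B) I"

definition squeezed :: "nat list \<Rightarrow> nat \<Rightarrow> nat \<Rightarrow> point list \<Rightarrow> nat \<Rightarrow> bool" where
  "squeezed I H B ps i \<longleftrightarrow> marked I H ps i \<or> length (unmarked I H ps) \<le> B"

definition new_point :: "nat list \<Rightarrow> nat \<Rightarrow> nat \<Rightarrow> point list \<Rightarrow> point \<Rightarrow> point" where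
  "new_point I H B ps x =
    map (\<lambda>i. if squeezed I H B ps i then squeeze B (map (\<lambda>y. coord y i) ps) (coord x i)
      else int (Suc B * label ps (unmarked I H ps) x)) (kept_coords I H B ps)"

lemma coord_nth: "i < length x \<Longrightarrow> coord x i = x ! i"
  by (simp add: coord_def Cons_nth_drop_Suc[symmetric])

lemma hamming_card:
  assumes "length x = d" "length y = d"
  shows "hamming [0..<d] x y = card {i. i < d \<and> x ! i \<noteq> y ! i}"
proof -
  have "hamming [0..<d] x y = card (set (filter (\<lambda>i. coord x i \<noteq> coord y i) [0..<d]))"
    unfolding hamming_def by (intro distinct_card[symmetric]) simp
  also have "set (filter (\<lambda>i. coord x i \<noteq> coord y i) [0..<d]) = {i. i < d \<and> x ! i \<noteq> y ! i}"
    using assms by (auto simp: coord_nth)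
  finally show ?thesis .
qed

text \<open>Suffixes of equal length coincide, and their common head agrees with both points on
  \<open>U\<close>.\<close>

lemma label_eqD:
  assumes "x \<in> set ps" "y \<in> set ps" "label ps U x = label ps U y"
  shows "map (coord x) U = map (coord y) U"
proof -
  let ?P = "\<lambda>x y. map (coord y) U \<noteq> map (coord x) U"
  have *: "dropWhile P xs = drop (length xs - length (dropWhile P xs)) xs" for P and xs :: "point list"
  proof -
    have "length xs = length (takeWhile P xs) + length (dropWhile P xs)"
      by (metis length_append takeWhile_dropWhile_id)
    then show ?thesis using dropWhile_eq_drop[of P xs] by simp
  qed
  have eq: "dropWhile (?P x) ps = dropWhile (?P y) ps"
    using *[of "?P x" ps] *[of "?P y" ps] assms(3) unfolding label_def by metis
  have hd: "map (coord (hd (dropWhile (?P z) ps))) U = map (coord z) U" if "z \<in> set ps" for z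
  proof -
    have "dropWhile (?P z) ps \<noteq> []" using that unfolding dropWhile_eq_Nil_conv by blast
    from hd_dropWhile[OF this] show ?thesis by (rule notnotD)
  qed
  have "map (coord x) U = map (coord (hd (dropWhile (?P x) ps))) U"
    by (rule hd[OF assms(1), symmetric])
  also have "\<dots> = map (coord (hd (dropWhile (?P y) ps))) U"
    unfolding eq by (rule refl)
  also have "\<dots> = map (coord y) U"
    by (rule hd[OF assms(2)])
  finally show ?thesis .
qed

lemma label_le: "label ps U x \<le> length ps"
  unfolding label_def by (rule length_dropWhile_le)

section \<open>Selecting all marked indices and a quota of the others\<close>

context
  fixes m :: "'a \<Rightarrow> bool" and B :: nat
begin

private abbreviation (input) "sel \<equiv> sfilter (\<lambda>i js. m i \<or> length (filter (\<lambda>j. \<not> m j) js) \<le> B)"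

lemma sel_subset: "set (sel l) \<subseteq> set l"
  by (induction l) auto

lemma sel_distinct: "distinct l \<Longrightarrow> distinct (sel l)"
  using sel_subset by (induction l) auto

lemma sel_filter: "filter m (sel l) = filter m l"
  by (induction l) auto

lemma sel_filter_not:
  "length (filter (\<lambda>j. \<not> m j) (sel l)) = min (Suc B) (length (filter (\<lambda>j. \<not> m j) l))"
  by (induction l) auto

lemma sel_length:
  "length (sel l) = length (filter m l) + min (Suc B) (length (filter (\<lambda>j. \<not> m j) l))"
  using sum_length_filter_compl[of m "sel l"] by (simp add: sel_filter sel_filter_not)

lemma sel_all: "length (filter (\<lambda>j. \<not> m j) l) \<le> B \<Longrightarrow> sel l = l"
  by (induction l) (auto split: if_splits)

end

section \<open>Equivalence of the instance with fewer coordinates\<close>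

context
  fixes p d H B :: nat and ps :: "point list"
  assumes H: "H = B ^ max 1 p" and len: "\<And>x. x \<in> set ps \<Longrightarrow> length x = d"
begin

private abbreviation (input) "K \<equiv> kept_coords [0..<d] H B ps"
private abbreviation (input) "F \<equiv> new_point [0..<d] H B ps"
private abbreviation (input) "mk \<equiv> marked [0..<d] H ps"
private abbreviation (input) "sq \<equiv> squeezed [0..<d] H B ps"
private abbreviation (input) "lab \<equiv> label ps (unmarked [0..<d] H ps)"
private abbreviation (input) "col i \<equiv> map (\<lambda>y. coord y i) ps"

lemma K_subset: "set K \<subseteq> {..<d}"
  unfolding kept_coords_def using sel_subset by fastforce

lemma K_distinct: "distinct K"
  unfolding kept_coords_def by (intro sel_distinct) simp

lemma squeezed_in_K:
  assumes "i < d" "sq i"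
  shows "i \<in> set K"
proof (cases "mk i")
  case True
  then have "i \<in> set (filter mk K)"
    unfolding kept_coords_def sel_filter using assms(1) by simp
  then show ?thesis by simp
next
  case False
  with assms have "K = [0..<d]"
    unfolding kept_coords_def by (intro sel_all) (simp add: squeezed_def unmarked_def)
  with assms(1) show ?thesis by simp
qed

text \<open>An index can be unsqueezed only if more than \<open>B\<close> indices are unmarked, and
  then the quota is filled.\<close>

lemma card_unsqueezed:
  assumes "i < d" "\<not> sq i"
  shows "card {j. j < length K \<and> \<not> sq (K ! j)} = Suc B"
proof -
  have "sq = mk" using assms(2) by (auto simp: squeezed_def)
  then have "{j. j < length K \<and> \<not> sq (K ! j)} = {j. j < length K \<and> \<not> mk (K ! j)}"
    by simp
  then have "card {j. j < length K \<and> \<not> sq (K ! j)} = length (filter (\<lambda>j. \<not> mk j) K)"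
    by (simp only: length_filter_conv_card)
  also have "\<dots> = min (Suc B) (length (filter (\<lambda>j. \<not> mk j) [0..<d]))"
    unfolding kept_coords_def by (rule sel_filter_not)
  also have "\<dots> = Suc B"
    using assms(2) by (simp add: squeezed_def unmarked_def)
  finally show ?thesis .
qed

lemma F_nth: "j < length K \<Longrightarrow> F x ! j =
    (if sq (K ! j) then squeeze B (col (K ! j)) (coord x (K ! j)) else int (Suc B * lab x))"
  by (simp add: new_point_def)

lemma F_length [simp]: "length (F x) = length K"
  by (simp add: new_point_def)

lemma coord_in_col: "x \<in> set ps \<Longrightarrow> coord x i \<in> set (col i)"
  by auto

text \<open>Close points differ in at most \<open>H\<close> coordinates, so every coordinate in
  which they differ is marked.\<close>

lemma label_eq_of_close:
  assumes "x \<in> set ps" "y \<in> set ps" "idist p x y \<le> real B"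
  shows "lab x = lab y"
proof -
  have "hamming [0..<d] x y \<le> H"
    unfolding hamming_card[OF len[OF assms(1)] len[OF assms(2)]] H
    by (rule card_diff_le[OF len[OF assms(1)] len[OF assms(2)] assms(3)])
  then have "map (coord x) (unmarked [0..<d] H ps) = map (coord y) (unmarked [0..<d] H ps)"
    using assms by (auto simp: unmarked_def marked_def)
  then show ?thesis by (simp add: label_def)
qed

text \<open>Different labels would exceed the distance: for \<open>p > 0\<close> by a single
  coordinate differing by at least \<open>B + 1\<close>, for \<open>p = 0\<close> by the number
  \<open>B + 1\<close> of differing coordinates. Equal labels give equality on all unmarked
  coordinates, including the discarded ones.\<close>

lemma coord_eq_of_image_close:
  assumes "x \<in> set ps" "y \<in> set ps" "idist p (F x) (F y) \<le> real B" "i < d" "\<not> sq i"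
  shows "coord x i = coord y i"
proof -
  let ?N = "{j. j < length K \<and> \<not> sq (K ! j)}"
  have card: "card ?N = Suc B" using assms by (intro card_unsqueezed)
  have "lab x = lab y"
  proof (rule ccontr)
    assume neq: "lab x \<noteq> lab y"
    then have diff: "int (Suc B) \<le> \<bar>F x ! j - F y ! j\<bar>" if "j \<in> ?N" for j
    proof -
      have "F x ! j - F y ! j = int (Suc B) * (int (lab x) - int (lab y))"
        using that by (simp add: F_nth right_diff_distrib del: of_nat_Suc mult_Suc)
      moreover have "1 \<le> \<bar>int (lab x) - int (lab y)\<bar>" using neq by linarith
      ultimately show ?thesis by (simp add: abs_mult mult_le_cancel_left1 del: of_nat_Suc)
    qed
    show False
    proof (cases "p = 0")
      case True
      have "card ?N \<le> card {j. j < length K \<and> F x ! j \<noteq> F y ! j}"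
        using diff by (intro card_mono) force+
      also have "\<dots> \<le> B ^ max 1 p" by (rule card_diff_le[OF F_length F_length assms(3)])
      finally show False using card True by simp
    next
      case False
      have "?N \<noteq> {}" using card by (intro notI) simp
      then obtain j where "j \<in> ?N" by blast
      with diff coord_diff_le[OF F_length F_length assms(3), of j] False show False by fastforce
    qed
  qed
  then have "map (coord x) (unmarked [0..<d] H ps) = map (coord y) (unmarked [0..<d] H ps)"
    by (rule label_eqD[OF assms(1,2)])
  moreover have "i \<in> set (unmarked [0..<d] H ps)"
    using assms(4,5) by (simp add: unmarked_def squeezed_def)
  ultimately show ?thesis by simp
qed

lemma squeeze_eq_of_image:
  assumes "x \<in> set ps" "y \<in> set ps" "j < length K" "sq (K ! j)" "F x ! j = F y ! j"
  shows "coord x (K ! j) = coord y (K ! j)"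
  using squeeze_close_converse[OF coord_in_col[OF assms(1)] coord_in_col[OF assms(2)], of B "K ! j"] assms
  by (simp add: F_nth)

text \<open>Injectivity lets clusters of images be pulled back. Equal images have distance zero, so
  \<open>coord_eq_of_image_close\<close> covers the unsqueezed coordinates.\<close>

lemma F_inj: "inj_on F (set ps)"
proof (rule inj_onI)
  fix x y assume x: "x \<in> set ps" and y: "y \<in> set ps" and eq: "F x = F y"
  show "x = y"
  proof (rule nth_equalityI)
    fix i assume "i < length x"
    then have i: "i < d" using len[OF x] by simp
    have "coord x i = coord y i"
    proof (cases "sq i")
      case True
      then obtain j where "j < length K" "K ! j = i"
        using squeezed_in_K[OF i] by (auto simp: in_set_conv_nth)
      then show ?thesis using squeeze_eq_of_image[OF x y, of j] True eq by simp
    next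
      case False
      then show ?thesis using coord_eq_of_image_close[OF x y _ i] eq by simp
    qed
    then show "x ! i = y ! i" using i len[OF x] len[OF y] by (simp add: coord_nth)
  qed (use len x y in simp)
qed

text \<open>Squeezed positions keep their small differences and the remaining ones hold a label that
  is constant on the cluster. The \<open>id\<close> fits
  \<open>equal_clustering_image\<close>.\<close>

lemma cost_new_point_le:
  assumes T: "T \<subseteq># mset ps" and cost: "cost p d T \<le> real B"
  shows "cost p (length K) (image_mset F T) \<le> cost p d (image_mset id T)"
proof -
  have mem: "x \<in> set ps" "length x = d" if "x \<in># T" for x
    using mset_subset_eqD[OF T that] len by auto
  have close: "idist p x y \<le> real B" if "x \<in># T" "y \<in># T" for x y
    using idist_le_cost[of T d x y p] mem that cost by force
  have K: "K ! j < d" if "j < length K" for j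
    using K_subset that nth_mem by blast
  show ?thesis
  proof (rule cost_image_le[where J = "{j. j < length K \<and> sq (K ! j)}" and t = "\<lambda>j. K ! j"])
    show "inj_on ((!) K) {j. j < length K \<and> sq (K ! j)}"
      using K_distinct by (auto simp: inj_on_def nth_eq_iff_index_eq)
    show "F x ! j = F y ! j"
      if "j < length K" "j \<notin> {j. j < length K \<and> sq (K ! j)}" "x \<in># T" "y \<in># T" for j x y
    proof -
      have "lab x = lab y"
        using that by (intro label_eq_of_close mem(1) close)
      then show ?thesis using that by (simp add: F_nth)
    qed
    show "F x ! j = F y ! j"
      if "j \<in> {j. j < length K \<and> sq (K ! j)}" "x \<in># T" "y \<in># T" "id x ! (K ! j) = id y ! (K ! j)"
      for j x y
      using that K mem(2) by (simp add: F_nth coord_nth)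
    show "F x ! j - F y ! j = id x ! (K ! j) - id y ! (K ! j)"
      if "p > 0" "j \<in> {j. j < length K \<and> sq (K ! j)}" "x \<in># T" "y \<in># T" for j x y
    proof -
      have j: "j < length K" "sq (K ! j)" "K ! j < d" using that K by auto
      have "\<bar>coord x (K ! j) - coord y (K ! j)\<bar> \<le> int B"
        using coord_diff_le[OF mem(2)[OF that(3)] mem(2)[OF that(4)] close[OF that(3,4)] that(1) j(3)]
          mem(2)[OF that(3)] mem(2)[OF that(4)] j(3) by (simp add: coord_nth)
      note squeeze_close[OF coord_in_col[OF mem(1)] coord_in_col[OF mem(1)], OF that(3,4) this]
      then show ?thesis using j mem(2)[OF that(3)] mem(2)[OF that(4)] by (simp add: F_nth coord_nth)
    qed
  qed (use mem(2) K in auto)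
qed

lemma cost_old_point_le:
  assumes T: "T \<subseteq># mset ps" and cost: "cost p (length K) (image_mset F T) \<le> real B"
  shows "cost p d (image_mset id T) \<le> cost p (length K) (image_mset F T)"
proof -
  have mem: "x \<in> set ps" "length x = d" if "x \<in># T" for x
    using mset_subset_eqD[OF T that] len by auto
  have close: "idist p (F x) (F y) \<le> real B" if "x \<in># T" "y \<in># T" for x y
    using idist_le_cost[of "image_mset F T" "length K" "F x" "F y" p] that cost by force
  define t where "t i = (SOME j. j < length K \<and> K ! j = i)" for i
  have t: "t i < length K \<and> K ! t i = i" if "i < d" "sq i" for i
    unfolding t_def using squeezed_in_K[OF that]
    by (intro someI_ex[of "\<lambda>j. j < length K \<and> K ! j = i"]) (simp add: in_set_conv_nth)
  show ?thesis
  proof (rule cost_image_le[where J = "{i. i < d \<and> sq i}" and t = t])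
    show "inj_on t {i. i < d \<and> sq i}"
      using t by (intro inj_onI) (metis mem_Collect_eq)
    show "id x ! i = id y ! i"
      if "i < d" "i \<notin> {i. i < d \<and> sq i}" "x \<in># T" "y \<in># T" for i x y
      using that coord_eq_of_image_close[OF mem(1) mem(1) close, of x y i] mem(2)
      by (simp add: coord_nth)
    show "id x ! i = id y ! i"
      if "i \<in> {i. i < d \<and> sq i}" "x \<in># T" "y \<in># T" "F x ! t i = F y ! t i" for i x y
      using that squeeze_eq_of_image[OF mem(1) mem(1), of x y "t i"] t[of i] mem(2)
      by (simp add: coord_nth)
    show "id x ! i - id y ! i = F x ! t i - F y ! t i"
      if "p > 0" "i \<in> {i. i < d \<and> sq i}" "x \<in># T" "y \<in># T" for i x y
    proof -
      have i: "i < d" "sq i" "t i < length K" "K ! t i = i" using that t by auto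
      have "\<bar>F x ! t i - F y ! t i\<bar> \<le> int B"
        by (rule coord_diff_le[OF F_length F_length close[OF that(3,4)] that(1) i(3)])
      with squeeze_close_converse[OF coord_in_col[OF mem(1)[OF that(3)]] coord_in_col[OF mem(1)[OF that(4)]], of B i] i
      show ?thesis using mem(2)[OF that(3)] mem(2)[OF that(4)] by (simp add: F_nth coord_nth)
    qed
  qed (use mem(2) t in auto)
qed

lemma equal_clustering_new_points:
  assumes "k > 0" "length ps = k * s"
  shows "equal_clustering p (length K) (mset (map F ps)) k B \<longleftrightarrow> equal_clustering p d (mset ps) k B"
proof
  have size: "size (mset ps) = k * s" using assms(2) by simp
  have inj: "inj_on F (set_mset (mset ps))" "inj_on id (set_mset (mset ps))"
    using F_inj by simp_all
  show "equal_clustering p d (mset ps) k B"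
    if "equal_clustering p (length K) (mset (map F ps)) k B"
    using equal_clustering_image[OF inj(1) _ assms(1) size cost_old_point_le] that
    by (simp add: id_def)
  show "equal_clustering p (length K) (mset (map F ps)) k B"
    if "equal_clustering p d (mset ps) k B"
    using equal_clustering_image[OF inj(2) _ assms(1) size cost_new_point_le] that by simp
qed

lemma new_point_bound:
  assumes "z \<in> set (F x)"
  shows "\<bar>z\<bar> \<le> int (length ps * Suc B)"
proof -
  have "int (Suc B * lab x) \<le> int (length ps * Suc B)"
    using label_le[of ps _ x] by (simp only: of_nat_le_iff mult.commute[of "Suc B"] mult_le_mono1)
  moreover have "\<bar>squeeze B vs v\<bar> \<le> int (length vs * Suc B)" for vs v
    using squeeze_nonneg[of B vs v] squeeze_le[of B vs v] by simp
  from this[of "col _"] have "\<bar>squeeze B (col i) v\<bar> \<le> int (length ps * Suc B)" for i v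
    by (simp only: length_map)
  ultimately show ?thesis using assms
    unfolding new_point_def by (auto simp del: of_nat_mult of_nat_Suc mult_Suc)
qed

lemma length_K_le: "length K \<le> length (filter mk [0..<d]) + Suc B"
  unfolding kept_coords_def sel_length by simp

end

section \<open>Counting the marked coordinates\<close>

text \<open>
  A spanning forest \<open>F\<close> of a graph, without mentioning paths: it is small, and a function that is
  constant along the edges in \<open>F\<close> is constant along all edges.  Induction over the edges, where \<open>\<rho>\<close>
  maps each vertex to a representative of its component.
\<close>

lemma spanning_forest:
  assumes "finite V" "finite E" "E \<subseteq> V \<times> V"
  obtains F where "F \<subseteq> E" "card F \<le> card V"
    "\<And>f :: 'a \<Rightarrow> 'b. \<And>a b. (\<And>a b. (a, b) \<in> F \<Longrightarrow> f a = f b) \<Longrightarrow> (a, b) \<in> E \<Longrightarrow> f a = f b"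
proof -
  \<comment> \<open>The invariant that representatives and forest edges together number at most
    \<open>card V\<close> bounds the forest.\<close>
  have "\<exists>F \<rho>. F \<subseteq> E \<and> \<rho> ` V \<subseteq> V \<and> card (\<rho> ` V) + card F \<le> card V \<and>
      (\<forall>(a, b)\<in>E. \<rho> a = \<rho> b) \<and>
      (\<forall>f :: 'a \<Rightarrow> 'b. (\<forall>(a, b)\<in>F. f a = f b) \<longrightarrow> (\<forall>a\<in>V. f (\<rho> a) = f a))"
    using assms(2,3)
  proof (induction E rule: finite_induct)
    case empty
    show ?case by (intro exI[of _ "{}"] exI[of _ id]) auto
  next
    case (insert e E)
    obtain u v where e: "e = (u, v)" by (cases e)
    have uv: "u \<in> V" "v \<in> V" using insert.prems e by auto
    from insert obtain F \<rho> where F: "F \<subseteq> E" "\<rho> ` V \<subseteq> V" "card (\<rho> ` V) + card F \<le> card V"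
      "\<forall>(a, b)\<in>E. \<rho> a = \<rho> b"
      "\<And>f :: 'a \<Rightarrow> 'b. (\<forall>(a, b)\<in>F. f a = f b) \<Longrightarrow> (\<forall>a\<in>V. f (\<rho> a) = f a)"
      by auto
    show ?case
    proof (cases "\<rho> u = \<rho> v")
      case True
      then show ?thesis using F e by (intro exI[of _ F] exI[of _ \<rho>]) auto
    next
      case False
      \<comment> \<open>Merging the class of \<open>u\<close> into that of \<open>v\<close> loses
        one representative for the one edge gained.\<close>
      define \<rho>' where "\<rho>' x = (if \<rho> x = \<rho> u then \<rho> v else \<rho> x)" for x
      have "\<rho>' ` V \<subseteq> \<rho> ` V - {\<rho> u}"
        using uv False by (auto simp: \<rho>'_def)
      then have "card (\<rho>' ` V) \<le> card (\<rho> ` V - {\<rho> u})"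
        using assms(1) by (intro card_mono) auto
      also have "\<dots> = card (\<rho> ` V) - 1"
        using uv assms(1) by (intro card_Diff_singleton) auto
      finally have 1: "card (\<rho>' ` V) \<le> card (\<rho> ` V) - 1" .
      have 2: "0 < card (\<rho> ` V)" using uv assms(1) by (auto simp: card_gt_0_iff)
      have 3: "card (insert e F) \<le> Suc (card F)" by (rule card_insert_le_m1) auto
      have 4: "\<forall>a\<in>V. f (\<rho>' a) = f a" if f: "\<forall>(a, b)\<in>insert e F. f a = f b" for f :: "'a \<Rightarrow> 'b"
      proof -
        have "\<forall>a\<in>V. f (\<rho> a) = f a" using f by (intro F(5)) auto
        moreover have "f u = f v" using f e by auto
        ultimately show ?thesis using uv by (auto simp: \<rho>'_def) metis
      qed
      show ?thesis
        using F(1,2,3,4) e uv 1 2 3 4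
        by (intro exI[of _ "insert e F"] exI[of _ \<rho>'] conjI) (force simp: \<rho>'_def)+
    qed
  qed
  then obtain F \<rho> where F: "F \<subseteq> E" "card (\<rho> ` V) + card F \<le> card V" "\<forall>(a, b)\<in>E. \<rho> a = \<rho> b"
    "\<And>f :: 'a \<Rightarrow> 'b. (\<forall>(a, b)\<in>F. f a = f b) \<Longrightarrow> (\<forall>a\<in>V. f (\<rho> a) = f a)"
    by auto
  show thesis
  proof (rule that)
    fix f :: "'a \<Rightarrow> 'b" and a b assume f: "\<And>a b. (a, b) \<in> F \<Longrightarrow> f a = f b" and ab: "(a, b) \<in> E"
    have "\<forall>a\<in>V. f (\<rho> a) = f a" using f by (intro F(4)) auto
    moreover have "a \<in> V" "b \<in> V" "\<rho> a = \<rho> b" using ab F(3) assms(3) by auto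
    ultimately show "f a = f b" by metis
  qed (use F in auto)
qed

lemma card_UN_mset_le:
  assumes "\<And>x. x \<in># T \<Longrightarrow> finite (A x)"
  shows "card (\<Union>x\<in>set_mset T. A x) \<le> (\<Sum>x\<in>#T. card (A x))"
  using assms
proof (induction T)
  case (add x T)
  have "card (\<Union>x\<in>set_mset (add_mset x T). A x) \<le> card (A x) + card (\<Union>x\<in>set_mset T. A x)"
    by (simp add: card_Un_le)
  with add show ?case by fastforce
qed simp

section \<open>Coordinates that vary within a cluster\<close>

definition mixed :: "nat \<Rightarrow> point multiset \<Rightarrow> nat set" where
  "mixed d T = {i. i < d \<and> (\<exists>x\<in>#T. \<exists>y\<in>#T. x ! i \<noteq> y ! i)}"

text \<open>Whatever value the center takes in a mixed coordinate, some point of the cluster differs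
  from it there and pays 1.\<close>

lemma card_mixed_le_zero:
  assumes "\<forall>x\<in>#T. length x = d"
  shows "real (card (mixed d T)) \<le> cost 0 d T"
proof (rule cost_ge)
  fix c :: "real list" assume c: "length c = d"
  let ?A = "\<lambda>x. {i. i < d \<and> c ! i \<noteq> real_of_int (x ! i)}"
  have "mixed d T \<subseteq> (\<Union>x\<in>set_mset T. ?A x)"
    by (auto simp: mixed_def) (metis of_int_eq_iff)
  then have "card (mixed d T) \<le> card (\<Union>x\<in>set_mset T. ?A x)"
    by (intro card_mono) auto
  also have "\<dots> \<le> (\<Sum>x\<in>#T. card (?A x))" by (rule card_UN_mset_le) simp
  finally have "real (card (mixed d T)) \<le> real (\<Sum>x\<in>#T. card (?A x))"
    by (simp only: of_nat_le_iff)
  also have "\<dots> = (\<Sum>x\<in>#T. real (card (?A x)))"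
    by (induction T) auto
  also have "\<dots> = (\<Sum>x\<in>#T. pdist 0 c x)"
  proof (intro arg_cong[where f = sum_mset] image_mset_cong)
    fix x assume "x \<in># T"
    then have x: "length x = d" using assms by simp
    have "?A x = {i. i < length (map2 (-) c (map real_of_int x)) \<and> map2 (-) c (map real_of_int x) ! i \<noteq> 0}"
      using x c by auto
    then show "real (card (?A x)) = pdist 0 c x"
      by (simp add: pdist_def lp_norm_def)
  qed
  finally show "real (card (mixed d T)) \<le> (\<Sum>x\<in>#T. pdist 0 c x)" .
qed

text \<open>In a mixed coordinate some point differs from a fixed reference point \<open>r\<close>,
  and each point differs from \<open>r\<close> in few coordinates.\<close>

lemma card_mixed_le_pos:
  assumes "\<forall>x\<in>#T. length x = d" "cost p d T \<le> real B"
  shows "card (mixed d T) \<le> size T * B ^ max 1 p"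
proof (cases "T = {#}")
  case False
  then obtain r where r: "r \<in># T" by blast
  let ?A = "\<lambda>x. {i. i < d \<and> r ! i \<noteq> x ! i}"
  have "mixed d T \<subseteq> (\<Union>x\<in>set_mset T. ?A x)"
    by (auto simp: mixed_def) metis
  then have "card (mixed d T) \<le> card (\<Union>x\<in>set_mset T. ?A x)"
    by (intro card_mono) auto
  also have "\<dots> \<le> (\<Sum>x\<in>#T. card (?A x))" by (rule card_UN_mset_le) simp
  also have "\<dots> \<le> (\<Sum>x\<in>#T. B ^ max 1 p)"
    using assms r by (intro sum_mset_mono card_diff_le) (auto intro: order.trans[OF idist_le_cost])
  finally show ?thesis by simp
qed (simp add: mixed_def)

text \<open>For \<open>p = 0\<close> the pairwise bound would only give order
  \<open>k * B ^ 2\<close>, so the cost itself is used. For \<open>p > 0\<close> the 5 comes from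
  \<open>4 * B + 1\<close> being at most \<open>5 * B\<close>.\<close>

lemma sum_card_mixed_le:
  fixes k :: nat
  assumes C: "\<And>i. i < k \<Longrightarrow> size (C i) = s" "(\<Sum>i<k. cost p d (C i)) \<le> real B"
    and len: "\<And>i x. i < k \<Longrightarrow> x \<in># C i \<Longrightarrow> length x = d"
    and s: "s \<le> 4 * B + 1" and B: "B > 0" and k: "k > 0"
  shows "(\<Sum>i<k. card (mixed d (C i))) \<le> 5 * (k * B ^ (p + 1))"
proof (cases "p = 0")
  case True
  have "real (\<Sum>i<k. card (mixed d (C i))) \<le> (\<Sum>i<k. cost p d (C i))"
    unfolding of_nat_sum True using len by (intro sum_mono card_mixed_le_zero) auto
  then have "(\<Sum>i<k. card (mixed d (C i))) \<le> B" using C(2) by linarith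
  also have "\<dots> \<le> k * B" using k by simp
  finally show ?thesis using True by simp
next
  case False
  have "(\<Sum>i<k. card (mixed d (C i))) \<le> (\<Sum>i<k. s * B ^ p)"
  proof (intro sum_mono)
    fix i assume "i \<in> {..<k}"
    then have i: "i < k" by simp
    then have "card (mixed d (C i)) \<le> size (C i) * B ^ max 1 p"
      using len cluster_cost_le[OF C(2) i] by (intro card_mixed_le_pos) auto
    then show "card (mixed d (C i)) \<le> s * B ^ p" using C(1)[OF i] False by (simp add: max_def)
  qed
  also have "\<dots> = k * (s * B ^ p)" by simp
  also have "\<dots> \<le> k * ((5 * B) * B ^ p)"
    using s B by (intro mult_le_mono) auto
  finally show ?thesis by (simp add: algebra_simps)
qed

text \<open>The vertices are clusters, and an edge joins clusters containing points that differ in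
  at most \<open>H\<close> coordinates; \<open>w\<close> picks such a pair. Outside \<open>S\<close>
  a coordinate is constant on each cluster and along forest edges, hence along all edges, so it is
  not marked. The constant is 5 for mixed coordinates plus 1 for at most \<open>k\<close> forest
  edges.\<close>

lemma card_marked_le:
  assumes yes: "equal_clustering p d (mset ps) k B"
    and H: "H = B ^ max 1 p" and len: "\<And>x. x \<in> set ps \<Longrightarrow> length x = d"
    and size: "length ps = k * s" and s: "s \<le> 4 * B + 1" and B: "B > 0" and k: "k > 0"
  shows "length (filter (marked [0..<d] H ps) [0..<d]) \<le> 6 * (k * B ^ (p + 1))"
proof -
  from yes k size obtain C where C: "(\<Sum>i<k. C i) = mset ps" "\<And>i. i < k \<Longrightarrow> size (C i) = s"
    "(\<Sum>i<k. cost p d (C i)) \<le> real B"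
    by (elim equal_clusteringE[where s = s]) auto
  have mem: "x \<in> set ps" if "i < k" "x \<in># C i" for i x
    using mset_subset_eqD[OF subset_mset_sum[OF that(1), of C] that(2)] C(1) by simp
  define D where "D x y = {i. i < d \<and> x ! i \<noteq> (y :: point) ! i}" for x y
  define near where "near a b = (\<lambda>(x, y). x \<in># C a \<and> y \<in># C b \<and> card (D x y) \<le> H)" for a b
  define E where "E = {(a, b). a < k \<and> b < k \<and> (\<exists>xy. near a b xy)}"
  have E: "E \<subseteq> {..<k} \<times> {..<k}" by (auto simp: E_def)
  then have "finite E" by (rule finite_subset) auto
  then obtain F where F: "F \<subseteq> E" "card F \<le> card {..<k}"
    "\<And>f :: nat \<Rightarrow> int. \<And>a b. (\<And>a b. (a, b) \<in> F \<Longrightarrow> f a = f b) \<Longrightarrow> (a, b) \<in> E \<Longrightarrow> f a = f b"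
    using spanning_forest[OF finite_lessThan _ E, where 'b = int] by blast
  define w where "w = (\<lambda>(a, b). SOME xy. near a b xy)"
  have w: "near a b (w (a, b))" if "(a, b) \<in> E" for a b
    using that unfolding w_def E_def by (auto intro: someI_ex)
  define S where "S = (\<Union>a<k. mixed d (C a)) \<union> (\<Union>e\<in>F. D (fst (w e)) (snd (w e)))"
  have finF: "finite F" using F(1) \<open>finite E\<close> by (rule finite_subset)
  have "card S \<le> card (\<Union>a<k. mixed d (C a)) + card (\<Union>e\<in>F. D (fst (w e)) (snd (w e)))"
    unfolding S_def by (rule card_Un_le)
  also have "card (\<Union>a<k. mixed d (C a)) \<le> (\<Sum>a<k. card (mixed d (C a)))"
    by (rule card_UN_le) simp
  also have "\<dots> \<le> 5 * (k * B ^ (p + 1))"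
    using len mem by (intro sum_card_mixed_le[OF C(2,3) _ s B k]) auto
  also have "card (\<Union>e\<in>F. D (fst (w e)) (snd (w e))) \<le> (\<Sum>e\<in>F. card (D (fst (w e)) (snd (w e))))"
    by (rule card_UN_le[OF finF])
  also have "\<dots> \<le> (\<Sum>e\<in>F. H)"
  proof (intro sum_mono)
    fix e assume "e \<in> F"
    then obtain a b where "e = (a, b)" "(a, b) \<in> E" using F(1) by (cases e) auto
    with w[of a b] show "card (D (fst (w e)) (snd (w e))) \<le> H"
      by (auto simp: near_def split: prod.splits)
  qed
  also have "\<dots> = card F * H" by simp
  also have "\<dots> \<le> k * B ^ (p + 1)"
    using F(2) B unfolding H by (intro mult_le_mono power_increasing) auto
  finally have card: "card S \<le> 6 * (k * B ^ (p + 1))" by linarith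
  have "i \<in> S" if i: "i < d" "marked [0..<d] H ps i" for i
  proof (rule ccontr)
    assume iS: "i \<notin> S"
    define v where "v a = (SOME x. x \<in># C a) ! i" for a
    have v: "x ! i = v a" if "a < k" "x \<in># C a" for a x
    proof -
      have 1: "(SOME x. x \<in># C a) \<in># C a" using that(2) by (rule someI)
      have "i \<notin> mixed d (C a)" using iS that(1) by (simp add: S_def)
      with i(1) that(2) 1 show ?thesis unfolding mixed_def v_def by blast
    qed
    have "v a = v b" if "(a, b) \<in> F" for a b
    proof -
      have ab: "(a, b) \<in> E" using that F(1) by blast
      obtain x y where xy: "w (a, b) = (x, y)" by (cases "w (a, b)")
      have "i \<notin> D x y" using iS that xy by (force simp: S_def)
      then have "x ! i = y ! i" using i by (simp add: D_def)
      moreover have "x \<in># C a" "y \<in># C b" using w[OF ab] xy by (auto simp: near_def)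
      ultimately show ?thesis using v ab by (metis (no_types, lifting) E_def case_prodD mem_Collect_eq)
    qed
    then have vE: "v a = v b" if "(a, b) \<in> E" for a b
      using F(3)[of v] that by blast
    obtain x y where xy: "x \<in> set ps" "y \<in> set ps" "hamming [0..<d] x y \<le> H" "coord x i \<noteq> coord y i"
      using i(2) by (auto simp: marked_def)
    have "\<exists>a<k. z \<in># C a" if "z \<in> set ps" for z
    proof -
      have "z \<in># (\<Sum>a<k. C a)" using that C(1) by simp
      then show ?thesis by (induction k) (auto simp: less_Suc_eq)
    qed
    with xy obtain a b where ab: "a < k" "x \<in># C a" "b < k" "y \<in># C b" by blast
    have "card (D x y) \<le> H"
      using xy(3) unfolding hamming_card[OF len[OF xy(1)] len[OF xy(2)]] D_def .
    then have "near a b (x, y)" using ab by (simp add: near_def)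
    then have "(a, b) \<in> E" using ab by (auto simp: E_def)
    then have "v a = v b" by (rule vE)
    then have "x ! i = y ! i" using v ab by metis
    then show False using xy i len by (simp add: coord_nth)
  qed
  then have sub: "set (filter (marked [0..<d] H ps) [0..<d]) \<subseteq> S" by auto
  have "finite S" by (auto simp: S_def finF mixed_def D_def)
  then have "card (set (filter (marked [0..<d] H ps) [0..<d])) \<le> card S"
    using sub by (intro card_mono)
  moreover have "card (set (filter (marked [0..<d] H ps) [0..<d]))
      = length (filter (marked [0..<d] H ps) [0..<d])"
    by (rule distinct_card) simp
  ultimately show ?thesis using card by simp
qed

section \<open>The kernelization\<close>

text \<open>There is no division among the primitives; a list that is long enough bounds the search.\<close>

definition quot :: "'a list \<Rightarrow> nat \<Rightarrow> nat \<Rightarrow> nat" where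
  "quot l n k = length (filter (\<lambda>j. Suc j * k \<le> n) [0..<length l])"

definition copies :: "point list \<Rightarrow> point \<Rightarrow> nat" where
  "copies ps x = length (filter (\<lambda>y. y = x) ps)"

definition centered :: "nat \<Rightarrow> nat \<Rightarrow> point list \<Rightarrow> point \<Rightarrow> nat" where
  "centered s B ps x = quot ps (copies ps x + B) s"

text \<open>Multiplicity plus \<open>B\<close> leaves a remainder of at most \<open>2 * B\<close>
  modulo \<open>s\<close>, expressed without a remainder operation.\<close>

definition balanced :: "nat \<Rightarrow> nat \<Rightarrow> point list \<Rightarrow> bool" where
  "balanced s B ps \<longleftrightarrow> (\<forall>x\<in>set ps. copies ps x + B \<le> centered s B ps x * s + 2 * B)"

definition thin :: "nat \<Rightarrow> nat \<Rightarrow> point list \<Rightarrow> point list" where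
  "thin s B ps =
    sfilter (\<lambda>x ys. copies ys x < copies ps x - centered s B ps x * (s - (4 * B + 1))) ps"

type_synonym raw_instance = "nat \<times> point list \<times> nat \<times> nat"

definition yes_raw :: raw_instance where
  "yes_raw = (0, [], 1, 0)"

text \<open>Two distinct points forced into one cluster with budget 0. This may be the output even
  for \<open>B = 0\<close>, whence the \<open>max 1\<close> in the size bounds.\<close>

definition no_raw :: raw_instance where
  "no_raw = (1, [[0], [1]], 1, 0)"

text \<open>Indices are produced along the first point because the number \<open>dim\<close> alone
  does not allow a range in polynomial time. \<open>kernel_small\<close> handles the empty list
  separately.\<close>

definition coords :: "point list \<Rightarrow> nat list" where
  "coords ps = [0..<length (case ps of [] \<Rightarrow> [] | x # _ \<Rightarrow> x)]"

definition reduce_dim :: "nat \<Rightarrow> nat \<Rightarrow> nat \<Rightarrow> point list \<Rightarrow> raw_instance" where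
  "reduce_dim p k B ps =
    (if 6 * (k * B ^ (p + 1)) < length (filter (marked (coords ps) (B ^ max 1 p) ps) (coords ps))
     then no_raw
     else (length (kept_coords (coords ps) (B ^ max 1 p) B ps),
       map (new_point (coords ps) (B ^ max 1 p) B ps) ps, k, B))"

definition kernel_small :: "nat \<Rightarrow> nat \<Rightarrow> nat \<Rightarrow> point list \<Rightarrow> raw_instance" where
  "kernel_small p k B ps = (if B = 0 \<or> ps = [] then yes_raw else reduce_dim p k B ps)"

definition kernel_raw :: "nat \<Rightarrow> nat \<Rightarrow> nat \<Rightarrow> point list \<Rightarrow> raw_instance" where
  "kernel_raw p k B ps =
    (if quot ps (length ps) k \<le> 4 * B + 1 then kernel_small p k B ps
     else if balanced (quot ps (length ps) k) B ps \<and>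
       length (thin (quot ps (length ps) k) B ps) = k * (4 * B + 1)
     then kernel_small p k B (thin (quot ps (length ps) k) B ps)
     else no_raw)"

definition to_raw :: "eqc_instance \<Rightarrow> raw_instance" where
  "to_raw x = (dim x, points x, clusters x, budget x)"

definition of_raw :: "raw_instance \<Rightarrow> eqc_instance" where
  "of_raw z = Eqc_Instance (fst z) (fst (snd z)) (fst (snd (snd z))) (snd (snd (snd z)))"

definition kernel :: "nat \<Rightarrow> eqc_instance \<Rightarrow> eqc_instance" where
  "kernel p x = of_raw (kernel_raw p (clusters x) (budget x) (points x))"

subsection \<open>Running time\<close>

lemma ptime_coord [ptime_intros]:
  assumes "ptime f" "ptime g"
  shows "ptime (\<lambda>x. coord (f x) (g x))"
  unfolding coord_def by (intro ptime_intros assms)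

lemma ptime_hamming [ptime_intros]:
  assumes "ptime I" "ptime f" "ptime g"
  shows "ptime (\<lambda>x. hamming (I x) (f x) (g x))"
  unfolding hamming_def by (intro ptime_intros assms assms[THEN ptime_comp])

lemma ptime_marked [ptime_intros]:
  assumes "ptime I" "ptime H" "ptime ps" "ptime i"
  shows "ptime (\<lambda>x. marked (I x) (H x) (ps x) (i x))"
  unfolding marked_def by (intro ptime_intros assms assms[THEN ptime_comp])

lemma ptime_unmarked [ptime_intros]:
  assumes "ptime I" "ptime H" "ptime ps"
  shows "ptime (\<lambda>x. unmarked (I x) (H x) (ps x))"
  unfolding unmarked_def by (intro ptime_intros assms assms[THEN ptime_comp])

lemma ptime_label [ptime_intros]:
  assumes "ptime ps" "ptime U" "ptime f"
  shows "ptime (\<lambda>x. label (ps x) (U x) (f x))"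
  unfolding label_def by (intro ptime_intros assms assms[THEN ptime_comp])

lemma ptime_kept_coords [ptime_intros]:
  assumes "ptime I" "ptime H" "ptime B" "ptime ps"
  shows "ptime (\<lambda>x. kept_coords (I x) (H x) (B x) (ps x))"
  unfolding kept_coords_def by (intro ptime_intros assms assms[THEN ptime_comp])

lemma ptime_squeezed [ptime_intros]:
  assumes "ptime I" "ptime H" "ptime B" "ptime ps" "ptime i"
  shows "ptime (\<lambda>x. squeezed (I x) (H x) (B x) (ps x) (i x))"
  unfolding squeezed_def by (intro ptime_intros assms)

lemma ptime_gap [ptime_intros]:
  assumes "ptime B" "ptime vs" "ptime w"
  shows "ptime (\<lambda>x. gap (B x) (vs x) (w x))"
proof (rule ptime_selection[where b = "\<lambda>x v vs r. w x < v \<and> v - w x < r" and f = "\<lambda>x v vs. v - w x"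
      and init = "\<lambda>x. int (Suc (B x))" and h = "\<lambda>x vs. gap (B x) vs (w x)" and l = vs])
  show "para (\<lambda>v vs r. if w x < v \<and> v - w x < r then v - w x else r) (int (Suc (B x))) vs
      = gap (B x) vs (w x)" for x vs
    by (simp only: gap_def)
qed (intro ptime_intros assms assms[THEN ptime_comp])+

lemma ptime_squeeze [ptime_intros]:
  assumes "ptime B" "ptime vs" "ptime v"
  shows "ptime (\<lambda>x. squeeze (B x) (vs x) (v x))"
  unfolding squeeze_def by (intro ptime_intros assms assms[THEN ptime_comp])

lemma ptime_new_point [ptime_intros]:
  assumes "ptime I" "ptime H" "ptime B" "ptime ps" "ptime f"
  shows "ptime (\<lambda>x. new_point (I x) (H x) (B x) (ps x) (f x))"
  unfolding new_point_def by (intro ptime_intros assms assms[THEN ptime_comp])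

lemma ptime_quot [ptime_intros]:
  assumes "ptime l" "ptime n" "ptime k"
  shows "ptime (\<lambda>x. quot (l x) (n x) (k x))"
  unfolding quot_def by (intro ptime_intros assms assms[THEN ptime_comp])

lemma ptime_copies [ptime_intros]:
  assumes "ptime ps" "ptime f"
  shows "ptime (\<lambda>x. copies (ps x) (f x))"
  unfolding copies_def by (intro ptime_intros assms assms[THEN ptime_comp])

lemma ptime_centered [ptime_intros]:
  assumes "ptime s" "ptime B" "ptime ps" "ptime f"
  shows "ptime (\<lambda>x. centered (s x) (B x) (ps x) (f x))"
  unfolding centered_def by (intro ptime_intros assms)

lemma ptime_balanced [ptime_intros]:
  assumes "ptime s" "ptime B" "ptime ps"
  shows "ptime (\<lambda>x. balanced (s x) (B x) (ps x))"
  unfolding balanced_def by (intro ptime_intros assms assms[THEN ptime_comp])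

lemma ptime_thin [ptime_intros]:
  assumes "ptime s" "ptime B" "ptime ps"
  shows "ptime (\<lambda>x. thin (s x) (B x) (ps x))"
  unfolding thin_def by (intro ptime_intros assms assms[THEN ptime_comp])

lemma ptime_coords [ptime_intros]:
  assumes "ptime ps"
  shows "ptime (\<lambda>x. coords (ps x))"
  unfolding coords_def by (intro ptime_intros assms)

lemma ptime_kernel_small [ptime_intros]:
  assumes "ptime k" "ptime B" "ptime ps"
  shows "ptime (\<lambda>x. kernel_small p (k x) (B x) (ps x))"
  unfolding kernel_small_def reduce_dim_def yes_raw_def no_raw_def
  by (intro ptime_intros assms assms[THEN ptime_comp])

lemma ptime_kernel_raw:
  "ptime (\<lambda>z :: raw_instance. kernel_raw p (fst (snd (snd z))) (snd (snd (snd z))) (fst (snd z)))"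
  unfolding kernel_raw_def no_raw_def by (intro ptime_intros)

text \<open>Tuples carry exactly the encoding prescribed for instances, so polynomial time on tuples
  is polynomial time for \<open>enc_eqc\<close>.\<close>

lemma encode_to_raw: "encode (to_raw x) = enc_eqc x"
proof -
  have "encode = enc_list (Leaf :: int \<Rightarrow> data)"
    by (simp add: encode_list_def encode_int_def)
  then have encode_list_points: "encode = enc_list (enc_list (Leaf :: int \<Rightarrow> data))"
    by (metis encode_list_def)
  show ?thesis
    by (simp add: to_raw_def enc_eqc_def encode_Pair encode_nat_def encode_list_points)
qed

lemma to_raw_of_raw: "to_raw (of_raw z) = z"
  by (simp add: to_raw_def of_raw_def)

lemma poly_time_kernel: "poly_time_computable enc_eqc I (kernel p)"
proof -
  let ?f = "\<lambda>z :: raw_instance. kernel_raw p (fst (snd (snd z))) (snd (snd (snd z))) (fst (snd z))"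
  obtain P g q where P: "computes P g ?f q"
    using ptime_kernel_raw unfolding ptime_def by blast
  \<comment> \<open>Function 0 has to be the main one: a forwarding function is put in front and all
    of \<open>P\<close> moves up by one.\<close>
  let ?e = "Call (Suc g) (Var 0)"
  let ?P = "[?e] @ map (relocate 1) P"
  have P': "computes ?P (Suc g) ?f q"
    using computes_relocate[OF P, of "[?e]"] by simp
  let ?q = "[:4, 2:] + q"
  have "\<exists>t\<le>poly ?q (dsize (enc_eqc x)). eval ?P [enc_eqc x] (Call 0 (Var 0)) (enc_eqc (kernel p x)) t" for x
  proof -
    have "kernel p x = of_raw (?f (to_raw x))"
      by (simp add: kernel_def to_raw_def)
    then have "enc_eqc (kernel p x) = encode (?f (to_raw x))"
      by (simp only: encode_to_raw[symmetric] to_raw_of_raw)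
    moreover have "costs ?P [encode (to_raw x)] (Call 0 (Var 0)) (encode (?f (to_raw x)))
        ((1 + bits (to_raw x)) + (1 + bits (to_raw x) + poly q (bits (to_raw x)) + 1) + 1)"
    proof (rule costs_Call[OF costs_arg])
      show "costs ?P [encode (to_raw x)] (?P ! 0) (encode (?f (to_raw x)))
          (1 + bits (to_raw x) + poly q (bits (to_raw x)) + 1)"
        using costs_computes[OF P' costs_arg, of "[]" "to_raw x"] by simp
    qed simp
    then have "costs ?P [encode (to_raw x)] (Call 0 (Var 0)) (encode (?f (to_raw x)))
        (poly ?q (bits (to_raw x)))"
      by (rule costs_mono) simp
    ultimately show ?thesis by (simp only: costs_def encode_to_raw)
  qed
  then show ?thesis unfolding poly_time_computable_def by blast
qed

subsection \<open>Correctness and size\<close>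

lemma quot_eq_div:
  assumes "0 < k" "n div k \<le> length l"
  shows "quot l n k = n div k"
proof -
  have "quot l n k = card (set (filter (\<lambda>j. Suc j * k \<le> n) [0..<length l]))"
    unfolding quot_def by (intro distinct_card[symmetric]) simp
  also have "set (filter (\<lambda>j. Suc j * k \<le> n) [0..<length l]) = {..<n div k}"
    using assms by (auto simp: less_eq_div_iff_mult_less_eq[symmetric] simp del: mult_Suc)
  finally show ?thesis by simp
qed

lemma copies_eq_count: "copies ps x = count (mset ps) x"
  unfolding copies_def by (induction ps) auto

text \<open>Searching up to \<open>length ps\<close> suffices: since \<open>B < s\<close>, the
  quotient is at most the multiplicity of \<open>x\<close>.\<close>

lemma centered_eq_div:
  assumes "4 * B + 1 < s"
  shows "centered s B ps x = (count (mset ps) x + B) div s"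
proof -
  let ?m = "count (mset ps) x"
  have "?m + B < Suc ?m * s"
  proof -
    have "?m + B < ?m * 1 + s" using assms by simp
    also have "\<dots> \<le> ?m * s + s" using assms by (intro add_mono mult_le_mono) auto
    finally show ?thesis by simp
  qed
  then have "(?m + B) div s < Suc ?m" by (rule less_mult_imp_div_less)
  moreover have "?m \<le> length ps" by (metis count_le_size size_mset)
  ultimately show ?thesis
    unfolding centered_def copies_eq_count using assms by (intro quot_eq_div) auto
qed

text \<open>A copy of \<open>x\<close> is kept if fewer than \<open>f x\<close> copies follow it, so
  exactly the last ones survive.\<close>

lemma count_sfilter: "count (mset (sfilter (\<lambda>x ys. copies ys x < f x) ps)) x = min (count (mset ps) x) (f x)"
  by (induction ps) (auto simp: copies_eq_count)

lemma count_thin: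
  assumes "4 * B + 1 < s"
  shows "count (mset (thin s B ps)) x = count (mset ps) x - (count (mset ps) x + B) div s * (s - (4 * B + 1))"
  unfolding thin_def count_sfilter using assms by (simp add: centered_eq_div copies_eq_count)

lemma balanced_iff:
  assumes "4 * B + 1 < s"
  shows "balanced s B ps \<longleftrightarrow> (\<forall>x\<in>#mset ps. (count (mset ps) x + B) mod s \<le> 2 * B)"
proof -
  have "m \<le> m div s * s + 2 * B \<longleftrightarrow> m mod s \<le> 2 * B" for m
    by (subst (1) div_mult_mod_eq[symmetric, of m s]) linarith
  then show ?thesis
    unfolding balanced_def centered_eq_div[OF assms] by (simp add: copies_eq_count)
qed

lemma set_thin: "set (thin s B ps) \<subseteq> set ps"
proof -
  have "set (sfilter b ps) \<subseteq> set ps" for b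
    by (induction ps) auto
  then show ?thesis unfolding thin_def .
qed

text \<open>Clusters with at most one point cost nothing. This settles \<open>B = 0\<close> once
  clusters have at most \<open>4 * B + 1\<close> points.\<close>

lemma yes_of_tiny_clusters:
  assumes "k > 0" "length ps = k * s" "s \<le> 1" "\<And>x. x \<in> set ps \<Longrightarrow> length x = d"
  shows "equal_clustering p d (mset ps) k B"
proof -
  define C where "C i = (if s = 0 then {#} else {#ps ! i#})" for i
  have "(\<Sum>i<k. C i) = mset ps"
  proof (cases "s = 0")
    case False
    with assms have "length ps = k" by (cases s) auto
    then have "mset ps = mset (map ((!) ps) [0..<k])" using map_nth[of ps] by simp
    also have "mset (map f [0..<n]) = (\<Sum>i<n. {#f i#})" for f :: "nat \<Rightarrow> point" and n
      by (induction n) auto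
    finally show ?thesis using False by (simp add: C_def)
  qed (use assms in \<open>simp add: C_def\<close>)
  moreover have "cost p d (C i) \<le> 0" if "i < k" for i
  proof (cases "s = 0")
    case False
    with assms that have "ps ! i \<in> set ps" by (cases s) auto
    then have "length (ps ! i) = d" by (rule assms(4))
    then show ?thesis
      using cost_le[of "map real_of_int (ps ! i)" d p "C i"] False by (simp add: C_def)
  next
    case True
    then show ?thesis using cost_le[of "replicate d 0" d p "C i"] by (simp add: C_def)
  qed
  then have "(\<Sum>i<k. cost p d (C i)) \<le> (\<Sum>i<k. 0)"
    by (intro sum_mono) auto
  ultimately show ?thesis
    using assms(1,3) by (intro equal_clusteringI[where C = C and s = s]) (auto simp: C_def)
qed

text \<open>The common constant 10 covers 5 for the number of points, 6 + 2 for marked and label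
  coordinates, and 5 * 2 for the values of coordinates.\<close>

definition raw_ok :: "nat \<Rightarrow> nat \<Rightarrow> nat \<Rightarrow> raw_instance \<Rightarrow> bool" where
  "raw_ok p k B z \<longleftrightarrow> of_raw z \<in> eqc_instances \<and>
    clusters (of_raw z) + budget (of_raw z) \<le> k + B \<and>
    length (points (of_raw z)) \<le> 10 * max 1 (k * B) \<and>
    dim (of_raw z) \<le> 10 * max 1 (k * B ^ (p + 1)) \<and>
    (\<forall>a\<in>set (points (of_raw z)). \<forall>z\<in>set a. \<bar>z\<bar> \<le> int (10 * max 1 (k * B ^ 2)))"

lemma raw_ok_yes: "k > 0 \<Longrightarrow> raw_ok p k B yes_raw"
  by (simp add: raw_ok_def of_raw_def yes_raw_def eqc_instances_def)

lemma eqc_yes_yes: "eqc_yes p (of_raw yes_raw)"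
  using yes_of_tiny_clusters[of 1 "[]" 0 0 p 0]
  by (simp add: eqc_yes_def of_raw_def yes_raw_def)

lemma raw_ok_no: "k > 0 \<Longrightarrow> raw_ok p k B no_raw"
proof -
  have 1: "1 \<le> max 1 a" for a :: nat by simp
  define u where "u = max 1 (k * B)"
  define v where "v = max 1 (k * B ^ (p + 1))"
  define w where "w = max 1 (k * B ^ 2)"
  have "1 \<le> u" "1 \<le> v" "1 \<le> w" unfolding u_def v_def w_def by (rule 1)+
  then show "0 < k \<Longrightarrow> raw_ok p k B no_raw"
    unfolding raw_ok_def u_def[symmetric] v_def[symmetric] w_def[symmetric]
    by (auto simp: of_raw_def no_raw_def eqc_instances_def)
qed

lemma not_eqc_yes_no: "\<not> eqc_yes p (of_raw no_raw)"
proof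
  assume "eqc_yes p (of_raw no_raw)"
  then obtain C :: "nat \<Rightarrow> point multiset" where C: "C 0 = mset [[0], [1]]" "cost p 1 (C 0) \<le> 0"
    by (auto simp: eqc_yes_def of_raw_def no_raw_def equal_clustering_def)
  have "1 \<le> idist p [0] [1]" by (rule idist_ge_1) auto
  also have "\<dots> \<le> cost p 1 (C 0)" using C(1) by (intro idist_le_cost) auto
  finally show False using C(2) by simp
qed

lemma kernel_small_correct:
  assumes k: "k > 0" and size: "length ps = k * s" and s: "s \<le> 4 * B + 1"
    and len: "\<And>x. x \<in> set ps \<Longrightarrow> length x = d"
  shows "raw_ok p k B (kernel_small p k B ps) \<and>
    (eqc_yes p (of_raw (kernel_small p k B ps)) \<longleftrightarrow> equal_clustering p d (mset ps) k B)"
proof (cases "B = 0 \<or> ps = []")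
  case True
  \<comment> \<open>For \<open>B = 0\<close> this is the size threshold; for an empty list
    \<open>s = 0\<close>.\<close>
  then have "s \<le> 1" using s k size by auto
  with yes_of_tiny_clusters[OF k size _ len] True show ?thesis
    by (simp add: kernel_small_def raw_ok_yes[OF k] eqc_yes_yes)
next
  case False
  then have B: "B > 0" and coords: "coords ps = [0..<d]"
    using len by (auto simp: coords_def split: list.splits)
  let ?H = "B ^ max 1 p"
  let ?D = "length (filter (marked [0..<d] ?H ps) [0..<d])"
  have small: "kernel_small p k B ps = reduce_dim p k B ps"
    using False by (simp add: kernel_small_def)
  show ?thesis
  proof (cases "6 * (k * B ^ (p + 1)) < ?D")
    case True
    then have "\<not> equal_clustering p d (mset ps) k B"
      using card_marked_le[OF _ refl len size s B k, of p] by auto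
    with True show ?thesis
      unfolding small by (simp add: reduce_dim_def coords raw_ok_no[OF k] not_eqc_yes_no)
  next
    case D: False
    let ?K = "kept_coords [0..<d] ?H B ps"
    let ?F = "new_point [0..<d] ?H B ps"
    have raw: "kernel_small p k B ps = (length ?K, map ?F ps, k, B)"
      unfolding small using D by (simp add: reduce_dim_def coords)
    have "length ps \<le> k * (5 * B)"
      unfolding size using s B by (intro mult_le_mono) auto
    then have n: "length ps \<le> 5 * (k * B)" by (simp add: algebra_simps)
    have "B \<le> B ^ (p + 1)" using B by (intro self_le_power) auto
    moreover have "1 \<le> B ^ (p + 1)" using B by simp
    ultimately have "Suc B \<le> 2 * B ^ (p + 1)" by linarith
    also have "\<dots> \<le> 2 * (k * B ^ (p + 1))" using k by simp
    finally have "length ?K \<le> 10 * (k * B ^ (p + 1))"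
      using length_K_le[where B = B and p = p and ps = ps and d = d, OF refl len] D by linarith
    moreover have "length ps * Suc B \<le> 10 * (k * B ^ 2)"
    proof -
      have "length ps * Suc B \<le> (5 * (k * B)) * (2 * B)"
        using n B by (intro mult_le_mono) auto
      then show ?thesis by (simp add: power2_eq_square algebra_simps)
    qed
    then have "\<bar>z\<bar> \<le> int (10 * (k * B ^ 2))" if "z \<in> set (?F x)" for z x
      using new_point_bound[OF refl len that] by (meson of_nat_le_iff order.trans)
    ultimately have "raw_ok p k B (kernel_small p k B ps)"
      using k n B size unfolding raw raw_ok_def
      by (auto simp: of_raw_def eqc_instances_def new_point_def max_def)
    moreover have "eqc_yes p (of_raw (kernel_small p k B ps)) \<longleftrightarrow> equal_clustering p d (mset ps) k B"
      unfolding raw using equal_clustering_new_points[OF refl len k size]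
      by (simp add: eqc_yes_def of_raw_def)
    ultimately show ?thesis ..
  qed
qed

lemma kernel_correct:
  assumes x: "x \<in> eqc_instances"
  shows "raw_ok p (clusters x) (budget x) (kernel_raw p (clusters x) (budget x) (points x)) \<and>
    (eqc_yes p (kernel p x) \<longleftrightarrow> eqc_yes p x)"
proof -
  define k B ps d where defs: "k = clusters x" "B = budget x" "ps = points x" "d = dim x"
  have k: "k > 0" and len: "\<And>x. x \<in> set ps \<Longrightarrow> length x = d" and "k dvd length ps"
    using x by (auto simp: eqc_instances_def defs)
  then obtain s where size: "length ps = k * s" by (auto elim: dvdE)
  have quot: "quot ps (length ps) k = s"
    using k by (subst quot_eq_div) (auto simp: size)
  have "raw_ok p k B (kernel_raw p k B ps) \<and>
    (eqc_yes p (of_raw (kernel_raw p k B ps)) \<longleftrightarrow> equal_clustering p d (mset ps) k B)"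
  proof (cases "s \<le> 4 * B + 1")
    case True
    with kernel_small_correct[OF k size True len] show ?thesis
      by (simp add: kernel_raw_def quot)
  next
    case False
    then have s: "4 * B + 1 < s" by simp
    have shrink: "equal_clustering p d (mset ps) k B \<longleftrightarrow> balanced s B ps \<and>
        length (thin s B ps) = k * (4 * B + 1) \<and> equal_clustering p d (mset (thin s B ps)) k B"
      using equal_clustering_shrink[of "mset ps" k s B "4 * B + 1" d "mset (thin s B ps)" p]
        size k s len count_thin[OF s] balanced_iff[OF s]
      by simp
    show ?thesis
    proof (cases "balanced s B ps \<and> length (thin s B ps) = k * (4 * B + 1)")
      case True
      have "\<And>x. x \<in> set (thin s B ps) \<Longrightarrow> length x = d" using len set_thin by blast
      from kernel_small_correct[OF k _ order.refl this] True shrink False show ?thesis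
        by (simp add: kernel_raw_def quot)
    next
      case no: False
      then have "kernel_raw p k B ps = no_raw" using False by (auto simp: kernel_raw_def quot)
      moreover have "\<not> equal_clustering p d (mset ps) k B" using no shrink by blast
      ultimately show ?thesis by (simp add: raw_ok_no[OF k] not_eqc_yes_no)
    qed
  qed
  then show ?thesis
    by (simp add: kernel_def eqc_yes_def[of p x] flip: defs)
qed

lemma bits_int_le: "\<bar>z\<bar> \<le> int N \<Longrightarrow> bits (z :: int) \<le> 1 + N"
  using bits_nat_le[of "nat \<bar>z\<bar>"] by (simp add: encode_nat_def encode_int_def)

text \<open>With \<open>m = k + B\<close> every bound \<open>k * B ^ n\<close> is at most
  \<open>m ^ Suc n\<close>. Numbers are charged by their value instead of their binary length, which
  is still polynomial because all values are polynomial in \<open>m\<close>.\<close>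

lemma raw_ok_size:
  fixes p :: nat
  defines "X \<equiv> [:0, 1 :: nat:]"
  assumes ok: "raw_ok p k B z"
  shows "bits z + clusters (of_raw z) + budget (of_raw z) \<le> poly (6 + 3 * X + 10 * (1 + X ^ (p + 2)) +
    (1 + 10 * (1 + X ^ 2) * (2 + 10 * (1 + X ^ (p + 2)) * (2 + 10 * (1 + X ^ 3))))) (k + B)"
proof -
  obtain d ps k' B' where z: "z = (d, ps, k', B')" by (cases z) auto
  define m where "m = k + B"
  have km: "k * B ^ n \<le> m ^ Suc n" for n
    using mult_le_mono[of k m "B ^ n" "m ^ n"] by (simp add: m_def power_mono)
  have max_le: "max 1 a \<le> 1 + b" if "a \<le> b" for a b :: nat using that by simp
  have inst: "\<And>a. a \<in> set ps \<Longrightarrow> length a = d" and kB: "k' + B' \<le> m"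
    and n: "length ps \<le> 10 * max 1 (k * B)" and d: "d \<le> 10 * max 1 (k * B ^ (p + 1))"
    and c: "\<And>a v. a \<in> set ps \<Longrightarrow> v \<in> set a \<Longrightarrow> \<bar>v\<bar> \<le> int (10 * max 1 (k * B ^ 2))"
    using ok by (auto simp: raw_ok_def z of_raw_def eqc_instances_def m_def)
  have n: "length ps \<le> 10 * (1 + m ^ 2)"
    using n max_le[OF km[of 1]] by (simp add: numeral_2_eq_2)
  have d: "d \<le> 10 * (1 + m ^ (p + 2))"
    using d max_le[OF km[of "p + 1"]] by simp
  have "10 * max 1 (k * B ^ 2) \<le> 10 * (1 + m ^ 3)"
    using max_le[OF km[of 2]] by (simp add: numeral_3_eq_3 numeral_2_eq_2)
  then have c: "\<bar>v\<bar> \<le> int (10 * (1 + m ^ 3))" if "a \<in> set ps" "v \<in> set a" for a v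
    using c[OF that] by (meson of_nat_le_iff order.trans)
  have a: "bits a \<le> 1 + 10 * (1 + m ^ (p + 2)) * (1 + (1 + 10 * (1 + m ^ 3)))" if "a \<in> set ps" for a
  proof -
    have "bits a \<le> 1 + length a * (1 + (1 + 10 * (1 + m ^ 3)))"
      using c[OF that] by (intro bits_list_le bits_int_le)
    also have "\<dots> \<le> 1 + 10 * (1 + m ^ (p + 2)) * (1 + (1 + 10 * (1 + m ^ 3)))"
      using inst[OF that] d by (intro add_mono mult_le_mono) auto
    finally show ?thesis .
  qed
  have "bits ps \<le> 1 + length ps * (1 + (1 + 10 * (1 + m ^ (p + 2)) * (1 + (1 + 10 * (1 + m ^ 3)))))"
    using a by (intro bits_list_le)
  also have "\<dots> \<le> 1 + 10 * (1 + m ^ 2) *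
      (1 + (1 + 10 * (1 + m ^ (p + 2)) * (1 + (1 + 10 * (1 + m ^ 3)))))"
    using n by (intro add_mono mult_le_mono) auto
  finally have ps: "bits ps \<le> \<dots>" .
  have "bits z + k' + B' \<le> 6 + 3 * m + 10 * (1 + m ^ (p + 2)) + (1 + 10 * (1 + m ^ 2) *
      (1 + (1 + 10 * (1 + m ^ (p + 2)) * (1 + (1 + 10 * (1 + m ^ 3))))))"
    using ps bits_nat_le[of d] bits_nat_le[of k'] bits_nat_le[of B'] d kB unfolding z bits_Pair
    by linarith
  then show ?thesis
    unfolding m_def[symmetric] by (simp add: z of_raw_def X_def algebra_simps)
qed

lemma polynomial_kernel_kernel: "polynomial_kernel enc_eqc eqc_instances (eqc_yes p) eqc_param (kernel p)"
  unfolding polynomial_kernel_def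
proof (intro conjI ballI)
  show "poly_time_computable enc_eqc eqc_instances (kernel p)"
    by (rule poly_time_kernel)
next
  fix x assume x: "x \<in> eqc_instances"
  show "kernel p x \<in> eqc_instances" "eqc_yes p (kernel p x) \<longleftrightarrow> eqc_yes p x"
    using kernel_correct[OF x, of p] by (auto simp: raw_ok_def kernel_def)
next
  have "dsize (enc_eqc (kernel p x)) + eqc_param (kernel p x) \<le>
      poly (6 + 3 * [:0, 1:] + 10 * (1 + [:0, 1:] ^ (p + 2)) + (1 + 10 * (1 + [:0, 1:] ^ 2) *
        (2 + 10 * (1 + [:0, 1:] ^ (p + 2)) * (2 + 10 * (1 + [:0, 1:] ^ 3))))) (eqc_param x)"
    if x: "x \<in> eqc_instances" for x
    using raw_ok_size[of p "clusters x" "budget x"] kernel_correct[OF x, of p]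
    by (simp only: kernel_def encode_to_raw[symmetric] to_raw_of_raw eqc_param_def add.assoc)
  then show "\<exists>s. \<forall>x\<in>eqc_instances. dsize (enc_eqc (kernel p x)) + eqc_param (kernel p x) \<le> poly s (eqc_param x)"
    by blast
qed

theorem theorem3:
  fixes p :: nat
  shows "\<exists>(f :: eqc_instance \<Rightarrow> eqc_instance) (C :: nat).
    polynomial_kernel enc_eqc eqc_instances (eqc_yes p) eqc_param f \<and>
    (\<forall>x\<in>eqc_instances. let k = clusters x; B = budget x in
      length (points (f x)) \<le> C * max 1 (k * B) \<and>
      dim (f x) \<le> C * max 1 (k * B ^ (p + 1)) \<and>
      (\<forall>a\<in>set (points (f x)). \<forall>z\<in>set a. \<bar>z\<bar> \<le> int (C * max 1 (k * B ^ 2))))"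
proof (intro exI conjI)
  show "polynomial_kernel enc_eqc eqc_instances (eqc_yes p) eqc_param (kernel p)"
    by (rule polynomial_kernel_kernel)
  show "\<forall>x\<in>eqc_instances. let k = clusters x; B = budget x in
      length (points (kernel p x)) \<le> 10 * max 1 (k * B) \<and>
      dim (kernel p x) \<le> 10 * max 1 (k * B ^ (p + 1)) \<and>
      (\<forall>a\<in>set (points (kernel p x)). \<forall>z\<in>set a. \<bar>z\<bar> \<le> int (10 * max 1 (k * B ^ 2)))"
    using kernel_correct[of _ p] unfolding Let_def raw_ok_def kernel_def[symmetric] by blast
qed

end
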